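(* Fix a nonnegative integer $m$. There is an algorithm which, given a nonnegative integer $d\times n$ matrix $\mathcal{A}$ of rank $d$ with $n-d=m$, decides whether $\mathcal{A}$ is normal, and whose running time is bounded by a polynomial in $n$ and the bit-size of $\mathcal{A}$.
   Context: Let $a_1,\ldots,a_n\in\mathbb{Z}^d$ be the columns of $\mathcal{A}$. Write $C(\mathcal{A})=\{\sum_i r_i a_i : r_i\in\mathbb{R}_{\ge 0}\}$, $\mathbb{Z}\mathcal{A}=\{\sum_i m_i a_i : m_i\in\mathbb{Z}\}$ and $\mathbb{N}\mathcal{A}=\{\sum_i m_i a_i : m_i\in\mathbb{Z}_{\ge 0}\}$. The matrix $\mathcal{A}$ is called normal if $C(\mathcal{A})\cap\mathbb{Z}\mathcal{A}=\mathbb{N}\mathcal{A}$. The number $n-d$ is the codimension of the toric ideal $I_{\mathcal{A}}=\langle x^p-x^q : p,q\in\mathbb{N}^n,\ \mathcal{A}p=\mathcal{A}q\rangle$. The bit-size of $\mathcal{A}$ is the total number of bits in the binary encoding of its entries. The polynomial may depend on the fixed number $m$. *)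

theory Defs
  imports
    "HOL-Library.Log_Nat"
    "HOL-Computational_Algebra.Polynomial"
    "Jordan_Normal_Form.DL_Rank"
begin

section \<open>Random access machines under the logarithmic cost criterion\<close>

text \<open>
  The machine model is the random access machine, in structured form: a program works on one
  memory of integer cells addressed by integers (registers are the cells at constant addresses)
  and indirect addressing is \<open>Mem\<close> applied to a computed address. Cells hold integers
  of arbitrary size, so time is charged by bit length: each operation costs one unit plus the
  length of the integer it produces, and the integers it consumes, memory addresses included, have
  been charged when they were produced. Hence neither large numbers nor far addresses come for
  free, and running times agree with those of Turing machines up to a polynomial.
\<close>

definition bit_length :: "int \<Rightarrow> nat" where
  "bit_length k = max 1 (floorlog 2 (nat \<bar>k\<bar>))"

type_synonym memory = "int \<Rightarrow> int"

datatype ram_exp =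
    Const int
  | Mem ram_exp
  | Plus ram_exp ram_exp
  | Minus ram_exp ram_exp
  | Times ram_exp ram_exp
  | Quot ram_exp ram_exp

fun exp_val :: "ram_exp \<Rightarrow> memory \<Rightarrow> int" where
  "exp_val (Const k) s = k"
| "exp_val (Mem a) s = s (exp_val a s)"
| "exp_val (Plus a b) s = exp_val a s + exp_val b s"
| "exp_val (Minus a b) s = exp_val a s - exp_val b s"
| "exp_val (Times a b) s = exp_val a s * exp_val b s"
| "exp_val (Quot a b) s = exp_val a s div exp_val b s"

fun exp_cost :: "ram_exp \<Rightarrow> memory \<Rightarrow> nat" where
  "exp_cost (Const k) s = 1 + bit_length k"
| "exp_cost (Mem a) s = exp_cost a s + 1 + bit_length (exp_val (Mem a) s)"
| "exp_cost (Plus a b) s = exp_cost a s + exp_cost b s + 1 + bit_length (exp_val (Plus a b) s)"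
| "exp_cost (Minus a b) s = exp_cost a s + exp_cost b s + 1 + bit_length (exp_val (Minus a b) s)"
| "exp_cost (Times a b) s = exp_cost a s + exp_cost b s + 1 + bit_length (exp_val (Times a b) s)"
| "exp_cost (Quot a b) s = exp_cost a s + exp_cost b s + 1 + bit_length (exp_val (Quot a b) s)"

text \<open>
  \<open>Store a b\<close> writes the value of \<open>b\<close> to the cell whose address is the value of \<open>a\<close>.
  A test \<open>a\<close> in \<open>Cond\<close> and \<open>Loop\<close> succeeds iff the value of \<open>a\<close> is positive.
\<close>

datatype ram_prog =
    Skip
  | Store ram_exp ram_exp
  | Seq ram_prog ram_prog
  | Cond ram_exp ram_prog ram_prog
  | Loop ram_exp ram_prog

text \<open>\<open>runs c s t s'\<close>: started in memory \<open>s\<close>, the program \<open>c\<close> halts after time \<open>t\<close> in memory \<open>s'\<close>.\<close>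

inductive runs :: "ram_prog \<Rightarrow> memory \<Rightarrow> nat \<Rightarrow> memory \<Rightarrow> bool" where
  runs_Skip: "runs Skip s 1 s"
| runs_Store:
    "runs (Store a b) s (1 + exp_cost a s + exp_cost b s) (s(exp_val a s := exp_val b s))"
| runs_Seq:
    "\<lbrakk>runs c1 s t1 s'; runs c2 s' t2 s''\<rbrakk> \<Longrightarrow> runs (Seq c1 c2) s (1 + t1 + t2) s''"
| runs_Cond_True:
    "\<lbrakk>0 < exp_val a s; runs c1 s t s'\<rbrakk> \<Longrightarrow> runs (Cond a c1 c2) s (1 + exp_cost a s + t) s'"
| runs_Cond_False:
    "\<lbrakk>\<not> 0 < exp_val a s; runs c2 s t s'\<rbrakk> \<Longrightarrow> runs (Cond a c1 c2) s (1 + exp_cost a s + t) s'"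
| runs_Loop_False:
    "\<not> 0 < exp_val a s \<Longrightarrow> runs (Loop a c) s (1 + exp_cost a s) s"
| runs_Loop_True:
    "\<lbrakk>0 < exp_val a s; runs c s t1 s'; runs (Loop a c) s' t2 s''\<rbrakk>
      \<Longrightarrow> runs (Loop a c) s (1 + exp_cost a s + t1 + t2) s''"

inductive_cases runs_SkipE: "runs Skip s t s'"
inductive_cases runs_StoreE: "runs (Store a b) s t s'"
inductive_cases runs_SeqE: "runs (Seq c1 c2) s t s'"
inductive_cases runs_CondE: "runs (Cond a c1 c2) s t s'"
inductive_cases runs_LoopE: "runs (Loop a c) s t s'"

lemma runs_deterministic:
  "runs c s t s' \<Longrightarrow> runs c s u s'' \<Longrightarrow> u = t \<and> s'' = s'"
proof (induction arbitrary: u s'' rule: runs.induct)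
  case (runs_Skip s)
  then show ?case by (elim runs_SkipE) simp
next
  case (runs_Store a b s)
  then show ?case by (elim runs_StoreE) simp
next
  case (runs_Seq c1 s t1 s1 c2 t2 s2)
  from runs_Seq.prems obtain v1 r v2
    where "u = Suc (v1 + v2)" and c1: "runs c1 s v1 r" and c2: "runs c2 r v2 s''"
    by (rule runs_SeqE)
  moreover from runs_Seq.IH(1)[OF c1] have "v1 = t1" "r = s1" by simp_all
  moreover from runs_Seq.IH(2) c2 \<open>r = s1\<close> have "v2 = t2 \<and> s'' = s2" by simp
  ultimately show ?case by simp
next
  case (runs_Cond_True a s c1 t s1 c2)
  from runs_Cond_True.prems obtain v where "u = Suc (exp_cost a s + v)" "runs c1 s v s''"
    using runs_Cond_True.hyps(1) by (elim runs_CondE) simp_all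
  with runs_Cond_True.IH show ?case by simp
next
  case (runs_Cond_False a s c2 t s1 c1)
  from runs_Cond_False.prems obtain v where "u = Suc (exp_cost a s + v)" "runs c2 s v s''"
    using runs_Cond_False.hyps(1) by (elim runs_CondE) simp_all
  with runs_Cond_False.IH show ?case by simp
next
  case (runs_Loop_False a s c)
  from runs_Loop_False.prems show ?case
    by (rule runs_LoopE) (use runs_Loop_False.hyps(1) in simp_all)
next
  case (runs_Loop_True a s c t1 s1 t2 s2)
  from runs_Loop_True.prems obtain v1 r v2
    where "u = Suc (exp_cost a s + v1 + v2)" and c: "runs c s v1 r" and l: "runs (Loop a c) r v2 s''"
    by (rule runs_LoopE) (use runs_Loop_True.hyps(1) in simp_all)
  moreover from runs_Loop_True.IH(1)[OF c] have "v1 = t1" "r = s1" by simp_all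
  moreover from runs_Loop_True.IH(2) l \<open>r = s1\<close> have "v2 = t2 \<and> s'' = s2" by simp
  ultimately show ?case by simp
qed

section \<open>Integer matrices as inputs\<close>

text \<open>
  The numbers of rows and of columns are stored in the cells \<open>0\<close> and \<open>1\<close>, the entries follow row by
  row from cell \<open>2\<close> on, and all other cells are \<open>0\<close>.
\<close>

definition input_memory :: "int mat \<Rightarrow> memory" where
  "input_memory A k =
    (if k = 0 then int (dim_row A)
     else if k = 1 then int (dim_col A)
     else if 2 \<le> k \<and> k < 2 + int (dim_row A * dim_col A)
       then A $$ (nat (k - 2) div dim_col A, nat (k - 2) mod dim_col A)
     else 0)"

definition bit_size :: "int mat \<Rightarrow> nat" where
  "bit_size A = (\<Sum>i<dim_row A. \<Sum>j<dim_col A. bit_length (A $$ (i, j)))"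

section \<open>Normal matrices\<close>

definition column_combinations :: "real set \<Rightarrow> int mat \<Rightarrow> real vec set" where
  "column_combinations S A =
    {map_mat real_of_int A *\<^sub>v r | r. r \<in> carrier_vec (dim_col A) \<and> (\<forall>i<dim_col A. r $ i \<in> S)}"

definition column_cone :: "int mat \<Rightarrow> real vec set" where
  "column_cone A = column_combinations {0..} A"

definition column_lattice :: "int mat \<Rightarrow> real vec set" where
  "column_lattice A = column_combinations \<int> A"

definition column_semigroup :: "int mat \<Rightarrow> real vec set" where
  "column_semigroup A = column_combinations \<nat> A"

definition normal_mat :: "int mat \<Rightarrow> bool" where
  "normal_mat A \<longleftrightarrow> column_cone A \<inter> column_lattice A = column_semigroup A"

end

theory Submission
  imports Defs
begin

text \<open>
  For a set \<open>\<sigma>\<close> of \<open>d\<close> linearly independent columns let \<open>h\<close> be the linear functional with value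
  1 on \<open>\<sigma>\<close>, and call \<open>\<sigma>\<close> lower if \<open>h\<close> is at least 1 on every nonzero column. Maximizing the sum
  of the coefficients of a real nonnegative representation shows that the cones over the lower sets
  cover \<open>C(A)\<close>. If \<open>A\<close> is normal and \<open>\<sigma>\<close> is lower, a lattice point with coordinates in \<open>[0, 1)\<close> over
  \<open>\<sigma>\<close> lies in \<open>\<nat>A\<close>, and since \<open>h\<close> is at most \<open>d\<close> there, the \<open>m\<close> columns outside of \<open>\<sigma>\<close> occur at
  most \<open>d\<close> times in its representation. So each class of \<open>\<int>A / \<int>\<sigma>\<close> has such a representative among
  \<open>(d + 1)\<^sup>m\<close> multiplicity vectors, and conversely these representatives decompose every lattice
  point of the cone over \<open>\<sigma>\<close>. There are at most \<open>n\<^sup>m\<close> sets \<open>\<sigma>\<close>. Coordinates over \<open>\<sigma>\<close> come from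
  fraction-free Gauss-Jordan elimination, which only meets minors of \<open>A\<close>.
\<close>

section \<open>Time bounds for programs\<close>

text \<open>The lattice of \<sigma> can have exponential index in the lattice of all columns, so its
  classes cannot be visited one by one. Instead \<open>cover_test\<close> asks that every
  multiplicity vector with entries at most d + 1 be congruent to a good vector with entries at most
  d. This closes the box of good vectors under adding a column, and induction then reaches every
  class. Good means that the coordinates over \<sigma> are below 1. When such a representative is
  subtracted from a point of the cone over \<sigma> in the same class, the resulting coordinates are
  integers above -1, hence nonnegative. The maximization is a linear program, and lowness says that
  h is feasible for its dual. Zero columns are exempt: they would make the program unbounded, and
  their multiplicities are arbitrary. Degenerate bases would allow pivots that gain nothing; they
  are avoided by moving the point slightly, and the finiteness of the set of bases leads back to the
  original point.\<close>

lemma bit_length_le: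
  assumes "\<bar>k\<bar> \<le> 2 ^ W"
  shows "bit_length k \<le> Suc W"
proof -
  have "nat \<bar>k\<bar> \<le> 2 ^ W"
    using assms by (simp add: nat_le_iff)
  then have "floorlog 2 (nat \<bar>k\<bar>) \<le> floorlog 2 (2 ^ W)"
    by (rule floorlog_mono)
  also have "\<dots> \<le> Suc W"
    by (intro floorlog_leI) auto
  finally show ?thesis
    by (simp add: bit_length_def)
qed

lemma abs_less_bit_length: "\<bar>k\<bar> < 2 ^ bit_length k"
proof (cases "k = 0")
  case False
  have "nat \<bar>k\<bar> < 2 ^ floorlog 2 (nat \<bar>k\<bar>)"
    using floorlog_bounds[of "nat \<bar>k\<bar>" 2] False by simp
  also have "\<dots> \<le> 2 ^ bit_length k"
    by (intro power_increasing) (auto simp: bit_length_def)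
  finally have "int (nat \<bar>k\<bar>) < int (2 ^ bit_length k)"
    by (simp only: of_nat_less_iff)
  then show ?thesis
    by simp
qed simp

lemma bit_length_pos: "1 \<le> bit_length k"
  by (simp add: bit_length_def)

text \<open>The factor on the exponent: over a memory bounded by \<open>2 ^ W\<close> the values are
  at most \<open>2 ^ (W * exp_size e)\<close>. \<open>Mem\<close> returns to a single word, whatever
  the size of the address.\<close>

fun exp_size :: "ram_exp \<Rightarrow> nat" where
  "exp_size (Const k) = bit_length k"
| "exp_size (Mem a) = 1"
| "exp_size (Plus a b) = exp_size a + exp_size b"
| "exp_size (Minus a b) = exp_size a + exp_size b"
| "exp_size (Times a b) = exp_size a + exp_size b"
| "exp_size (Quot a b) = exp_size a + exp_size b"

fun exp_weight :: "ram_exp \<Rightarrow> nat" where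
  "exp_weight (Const k) = 1 + bit_length k"
| "exp_weight (Mem a) = exp_weight a + 3"
| "exp_weight (Plus a b) = exp_weight a + exp_weight b + exp_size a + exp_size b + 2"
| "exp_weight (Minus a b) = exp_weight a + exp_weight b + exp_size a + exp_size b + 2"
| "exp_weight (Times a b) = exp_weight a + exp_weight b + exp_size a + exp_size b + 2"
| "exp_weight (Quot a b) = exp_weight a + exp_weight b + exp_size a + exp_size b + 2"

lemma exp_size_pos: "1 \<le> exp_size e"
  using bit_length_pos by (induction e) auto

definition bounded_memory :: "nat \<Rightarrow> memory \<Rightarrow> bool" where
  "bounded_memory W s \<longleftrightarrow> (\<forall>k. \<bar>s k\<bar> \<le> 2 ^ W)"

lemma bounded_memoryD: "bounded_memory W s \<Longrightarrow> \<bar>s k\<bar> \<le> 2 ^ W"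
  by (simp add: bounded_memory_def)

text \<open>Sums obey the exponent rule of products because \<open>u + v \<le> u * v\<close> as soon
  as both numbers are at least 2.\<close>

lemma power2_add_le:
  fixes x y :: int
  assumes "\<bar>x\<bar> \<le> 2 ^ (W * p)" "\<bar>y\<bar> \<le> 2 ^ (W * q)" "1 \<le> W" "1 \<le> p" "1 \<le> q"
  shows "\<bar>x\<bar> + \<bar>y\<bar> \<le> 2 ^ (W * (p + q))"
proof -
  have *: "2 \<le> (2 :: int) ^ (W * r)" if "1 \<le> r" for r
    using that assms by (metis One_nat_def Suc_le_eq nat_0_less_mult_iff one_le_numeral
        power_increasing power_one_right)
  have "u + v \<le> u * v" if "2 \<le> u" "2 \<le> v" for u v :: int
  proof -
    have "0 \<le> (u - 2) * (v - 2)"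
      using that by simp
    then show ?thesis
      using that by (simp add: algebra_simps)
  qed
  from this[OF *[OF assms(4)] *[OF assms(5)]] assms(1,2) show ?thesis
    by (simp add: algebra_simps power_add)
qed

text \<open>Rounding down can push a negative quotient away from zero, but for
  \<open>u < 0 < v\<close> not below \<open>u\<close>, since \<open>u * v \<le> u\<close>. Division
  by 0 gives 0.\<close>

lemma abs_div_le:
  fixes x y :: int
  shows "\<bar>x div y\<bar> \<le> \<bar>x\<bar>"
proof -
  have pos: "\<bar>u div v\<bar> \<le> \<bar>u\<bar>" if "0 < v" for u v :: int
  proof (cases "0 \<le> u")
    case True
    then show ?thesis
      using that zdiv_mono2[of u 1 v] by (simp add: pos_imp_zdiv_nonneg_iff)
  next
    case False
    have "u * v div v \<le> u div v"
      using that False by (intro zdiv_mono1) (auto simp: mult_le_cancel_left1)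
    moreover have "u div v < 0"
      using that False by (simp add: pos_imp_zdiv_neg_iff)
    ultimately show ?thesis
      using that by simp
  qed
  show ?thesis
    using pos[of y x] pos[of "- y" "- x"] by (cases y "0 :: int" rule: linorder_cases) auto
qed

lemma abs_exp_val_le:
  assumes "bounded_memory W s" "1 \<le> W"
  shows "\<bar>exp_val e s\<bar> \<le> 2 ^ (W * exp_size e)"
proof (induction e)
  case (Const k)
  have "\<bar>k\<bar> \<le> 2 ^ bit_length k"
    using abs_less_bit_length[of k] by simp
  also have "\<dots> \<le> 2 ^ (W * bit_length k)"
    using assms by (intro power_increasing) auto
  finally show ?case by simp
next
  case (Mem e)
  then show ?case using assms by (simp add: bounded_memory_def)
next
  case (Plus a b)
  show ?case
    using power2_add_le[OF Plus assms(2) exp_size_pos exp_size_pos] by simp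
next
  case (Minus a b)
  show ?case
    using power2_add_le[OF Minus assms(2) exp_size_pos exp_size_pos] by simp
next
  case (Times a b)
  then show ?case
    by (simp add: abs_mult mult_mono algebra_simps power_add)
next
  case (Quot a b)
  have "\<bar>exp_val a s div exp_val b s\<bar> \<le> \<bar>exp_val a s\<bar>"
    by (rule abs_div_le)
  also have "\<dots> \<le> 2 ^ (W * exp_size a)"
    by (rule Quot.IH(1))
  also have "\<dots> \<le> 2 ^ (W * (exp_size a + exp_size b))"
    by (intro power_increasing) auto
  finally show ?case by simp
qed

lemma exp_cost_le:
  assumes "bounded_memory W s" "1 \<le> W"
  shows "exp_cost e s \<le> exp_weight e * W"
proof -
  have bl: "1 + bit_length (exp_val e s) \<le> (exp_size e + 2) * W" for e
  proof -
    have "1 + bit_length (exp_val e s) \<le> W * exp_size e + 2"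
      using bit_length_le[OF abs_exp_val_le[OF assms]] by simp
    also have "\<dots> \<le> (exp_size e + 2) * W"
      using assms(2) by (simp add: algebra_simps)
    finally show ?thesis .
  qed
  show ?thesis
  proof (induction e)
    case (Const k)
    show ?case
      using mult_le_mono2[OF assms(2), of "1 + bit_length k"] by simp
  next
    case (Mem e)
    then show ?case using bl[of "Mem e"] by (simp add: algebra_simps)
  next
    case (Plus a b)
    then show ?case using bl[of "Plus a b"] by (simp add: algebra_simps)
  next
    case (Minus a b)
    then show ?case using bl[of "Minus a b"] by (simp add: algebra_simps)
  next
    case (Times a b)
    then show ?case using bl[of "Times a b"] by (simp add: algebra_simps)
  next
    case (Quot a b)
    then show ?case using bl[of "Quot a b"] by (simp add: algebra_simps)
  qed
qed

text \<open>Time in units of \<open>W\<close>, with \<open>L\<close> as a common bound on the rounds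
  of all loops; \<open>Suc L\<close> because the final failing test is charged as well.\<close>

fun prog_weight :: "nat \<Rightarrow> ram_prog \<Rightarrow> nat" where
  "prog_weight L Skip = 1"
| "prog_weight L (Store a b) = 1 + exp_weight a + exp_weight b"
| "prog_weight L (Seq c1 c2) = 1 + prog_weight L c1 + prog_weight L c2"
| "prog_weight L (Cond a c1 c2) = 1 + exp_weight a + prog_weight L c1 + prog_weight L c2"
| "prog_weight L (Loop a c) = Suc L * (1 + exp_weight a + prog_weight L c)"

text \<open>A loop raises the exponent by one. In sequences and conditionals the exponents are
  simply added, which wastes degree but stays polynomial for a fixed program.\<close>

lemma prog_weight_le_power: "\<exists>C e. \<forall>L\<ge>1. prog_weight L c \<le> C * L ^ e"
proof (induction c)
  case Skip
  show ?case by (rule exI[of _ 1], rule exI[of _ 0]) simp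
next
  case (Store a b)
  show ?case by (rule exI[of _ "1 + exp_weight a + exp_weight b"], rule exI[of _ 0]) simp
next
  case (Seq c1 c2)
  then obtain C1 e1 C2 e2 where *: "\<forall>L\<ge>1. prog_weight L c1 \<le> C1 * L ^ e1"
    "\<forall>L\<ge>1. prog_weight L c2 \<le> C2 * L ^ e2" by blast
  have "prog_weight L (Seq c1 c2) \<le> (1 + C1 + C2) * L ^ (e1 + e2)" if "L \<ge> 1" for L
  proof -
    have "prog_weight L c1 \<le> C1 * L ^ (e1 + e2)" "prog_weight L c2 \<le> C2 * L ^ (e1 + e2)"
      using that by (auto intro!: order_trans[OF *(1)[rule_format, OF that]]
          order_trans[OF *(2)[rule_format, OF that]] mult_le_mono2 power_increasing)
    moreover have "1 \<le> L ^ (e1 + e2)"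
      using that by simp
    ultimately show ?thesis by (simp add: algebra_simps)
  qed
  then show ?case by blast
next
  case (Cond a c1 c2)
  then obtain C1 e1 C2 e2 where *: "\<forall>L\<ge>1. prog_weight L c1 \<le> C1 * L ^ e1"
    "\<forall>L\<ge>1. prog_weight L c2 \<le> C2 * L ^ e2" by blast
  have "prog_weight L (Cond a c1 c2) \<le> (1 + exp_weight a + C1 + C2) * L ^ (e1 + e2)" if "L \<ge> 1" for L
  proof -
    have "prog_weight L c1 \<le> C1 * L ^ (e1 + e2)" "prog_weight L c2 \<le> C2 * L ^ (e1 + e2)"
      using that by (auto intro!: order_trans[OF *(1)[rule_format, OF that]]
          order_trans[OF *(2)[rule_format, OF that]] mult_le_mono2 power_increasing)
    moreover have "1 + exp_weight a \<le> (1 + exp_weight a) * L ^ (e1 + e2)"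
      using that mult_le_mono2[of 1 "L ^ (e1 + e2)" "1 + exp_weight a"] by simp
    ultimately show ?thesis by (simp add: algebra_simps)
  qed
  then show ?case by blast
next
  case (Loop a c)
  then obtain C e where *: "\<forall>L\<ge>1. prog_weight L c \<le> C * L ^ e" by blast
  have "prog_weight L (Loop a c) \<le> (2 * (1 + exp_weight a + C)) * L ^ Suc e" if "L \<ge> 1" for L
  proof -
    have "1 + exp_weight a \<le> (1 + exp_weight a) * L ^ e"
      using that mult_le_mono2[of 1 "L ^ e" "1 + exp_weight a"] by simp
    with *[rule_format, OF that] have "1 + exp_weight a + prog_weight L c \<le> (1 + exp_weight a + C) * L ^ e"
      by (simp add: algebra_simps)
    moreover have "Suc L \<le> 2 * L" using that by simp
    ultimately have "Suc L * (1 + exp_weight a + prog_weight L c) \<le> (2 * L) * ((1 + exp_weight a + C) * L ^ e)"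
      by (rule mult_le_mono[rotated])
    then show ?thesis by (simp add: algebra_simps)
  qed
  then show ?case by blast
qed

text \<open>
  Running times need no bookkeeping in this logic: as long as all cells stay below \<open>2 ^ W\<close> and no
  loop makes more than \<open>L\<close> rounds, they are bounded by a quantity read off the program text.
\<close>

definition triple ::
  "nat \<Rightarrow> nat \<Rightarrow> (memory \<Rightarrow> bool) \<Rightarrow> ram_prog \<Rightarrow> (memory \<Rightarrow> bool) \<Rightarrow> bool" where
  "triple L W P c Q \<longleftrightarrow> (\<forall>s. bounded_memory W s \<longrightarrow> P s \<longrightarrow>
    (\<exists>t s'. runs c s t s' \<and> t \<le> prog_weight L c * W \<and> bounded_memory W s' \<and> Q s'))"

lemma triple_conseq:
  assumes "triple L W P c Q"
    and "\<And>s. bounded_memory W s \<Longrightarrow> P' s \<Longrightarrow> P s" "\<And>s. bounded_memory W s \<Longrightarrow> Q s \<Longrightarrow> Q' s"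
  shows "triple L W P' c Q'"
  using assms unfolding triple_def by meson

lemmas triple_pre = triple_conseq[OF _ _ asm_rl]
lemmas triple_post = triple_conseq[OF _ asm_rl]

text \<open>Lets a proof fix, for a given start state, the ghost data (a basis, a tableau, a
  determinant) that a precondition only asserts to exist.\<close>

lemma triple_obtain:
  assumes "\<And>s. P s \<Longrightarrow> \<exists>P'. P' s \<and> triple L W P' c Q"
  shows "triple L W P c Q"
  using assms unfolding triple_def by metis

section \<open>Hoare rules for bounded memories and bounded loops\<close>

locale ram_bounds =
  fixes L W :: nat
  assumes W_pos: "1 \<le> W"
begin

lemma triple_Skip:
  assumes "\<And>s. bounded_memory W s \<Longrightarrow> P s \<Longrightarrow> Q s"
  shows "triple L W P Skip Q"
  using assms W_pos runs_Skip unfolding triple_def by fastforce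

lemma triple_Store:
  assumes "\<And>s. bounded_memory W s \<Longrightarrow> P s \<Longrightarrow>
    \<bar>exp_val b s\<bar> \<le> 2 ^ W \<and> Q (s(exp_val a s := exp_val b s))"
  shows "triple L W P (Store a b) Q"
  unfolding triple_def
proof (intro allI impI)
  fix s assume s: "bounded_memory W s" "P s"
  have "1 + exp_cost a s + exp_cost b s \<le> prog_weight L (Store a b) * W"
    using exp_cost_le[OF s(1) W_pos, of a] exp_cost_le[OF s(1) W_pos, of b] W_pos
    by (simp add: algebra_simps)
  moreover have "bounded_memory W (s(exp_val a s := exp_val b s))"
    using assms[OF s] s(1) by (simp add: bounded_memory_def)
  ultimately show "\<exists>t s'. runs (Store a b) s t s' \<and> t \<le> prog_weight L (Store a b) * W \<and>
      bounded_memory W s' \<and> Q s'"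
    using assms[OF s] runs_Store by blast
qed

lemma triple_Seq:
  assumes "triple L W P c1 Q" "triple L W Q c2 R"
  shows "triple L W P (Seq c1 c2) R"
  unfolding triple_def
proof (intro allI impI)
  fix s assume s: "bounded_memory W s" "P s"
  then obtain t1 s1 where 1: "runs c1 s t1 s1" "t1 \<le> prog_weight L c1 * W" "bounded_memory W s1" "Q s1"
    using assms(1) unfolding triple_def by blast
  then obtain t2 s2 where 2: "runs c2 s1 t2 s2" "t2 \<le> prog_weight L c2 * W" "bounded_memory W s2" "R s2"
    using assms(2) unfolding triple_def by blast
  have "1 + t1 + t2 \<le> prog_weight L (Seq c1 c2) * W"
    using 1(2) 2(2) W_pos by (simp add: algebra_simps)
  with runs_Seq[OF 1(1) 2(1)] 2 show "\<exists>t s'. runs (Seq c1 c2) s t s' \<and>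
      t \<le> prog_weight L (Seq c1 c2) * W \<and> bounded_memory W s' \<and> R s'"
    by blast
qed

lemma triple_Cond:
  assumes "triple L W (\<lambda>s. P s \<and> 0 < exp_val a s) c1 Q"
    and "triple L W (\<lambda>s. P s \<and> \<not> 0 < exp_val a s) c2 Q"
  shows "triple L W P (Cond a c1 c2) Q"
  unfolding triple_def
proof (intro allI impI)
  fix s assume s: "bounded_memory W s" "P s"
  note a = exp_cost_le[OF s(1) W_pos, of a]
  show "\<exists>t s'. runs (Cond a c1 c2) s t s' \<and> t \<le> prog_weight L (Cond a c1 c2) * W \<and>
      bounded_memory W s' \<and> Q s'"
  proof (cases "0 < exp_val a s")
    case True
    with s obtain t s1 where 1: "runs c1 s t s1" "t \<le> prog_weight L c1 * W" "bounded_memory W s1" "Q s1"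
      using assms(1) unfolding triple_def by blast
    have "1 + exp_cost a s + t \<le> prog_weight L (Cond a c1 c2) * W"
      using 1(2) a W_pos by (simp add: algebra_simps)
    with runs_Cond_True[OF True 1(1)] 1 show ?thesis by blast
  next
    case False
    with s obtain t s1 where 1: "runs c2 s t s1" "t \<le> prog_weight L c2 * W" "bounded_memory W s1" "Q s1"
      using assms(2) unfolding triple_def by blast
    have "1 + exp_cost a s + t \<le> prog_weight L (Cond a c1 c2) * W"
      using 1(2) a W_pos by (simp add: algebra_simps)
    with runs_Cond_False[OF False 1(1)] 1 show ?thesis by blast
  qed
qed

text \<open>The invariant carries the number of the round, so the total is known in advance and
  replaces a variant. The induction is on the rounds that remain.\<close>

lemma triple_Loop:
  assumes body: "\<And>i. i < N \<Longrightarrow> triple L W (I i) c (I (Suc i))"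
    and test: "\<And>i s. i \<le> N \<Longrightarrow> I i s \<Longrightarrow> 0 < exp_val a s \<longleftrightarrow> i < N"
    and "N \<le> L"
  shows "triple L W (I 0) (Loop a c) (I N)"
proof -
  let ?w = "(1 + exp_weight a + prog_weight L c) * W"
  have *: "\<exists>t s'. runs (Loop a c) s t s' \<and> t \<le> Suc k * ?w \<and> bounded_memory W s' \<and> I N s'"
    if "bounded_memory W s" "I (N - k) s" "k \<le> N" for k s
    using that
  proof (induction k arbitrary: s)
    case 0
    then have "\<not> 0 < exp_val a s"
      using test[of N s] by simp
    moreover have "1 + exp_cost a s \<le> ?w"
      using exp_cost_le[OF 0(1) W_pos, of a] W_pos by (simp add: algebra_simps)
    ultimately show ?case
      using runs_Loop_False[of a s c] 0 by auto
  next
    case (Suc k)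
    from Suc.prems have i: "N - Suc k < N" "Suc (N - Suc k) = N - k" by auto
    from body[OF i(1)] Suc.prems obtain t1 s1 where 1: "runs c s t1 s1"
      "t1 \<le> prog_weight L c * W" "bounded_memory W s1" "I (N - k) s1"
      unfolding triple_def i(2) by blast
    from Suc.IH[OF 1(3,4)] Suc.prems(3) obtain t2 s2 where 2: "runs (Loop a c) s1 t2 s2"
      "t2 \<le> Suc k * ?w" "bounded_memory W s2" "I N s2" by auto
    have "0 < exp_val a s"
      using test[of "N - Suc k" s] Suc.prems i by simp
    note runs_Loop_True[OF this 1(1) 2(1)]
    moreover have "1 + exp_cost a s + t1 + t2 \<le> Suc (Suc k) * ?w"
      using exp_cost_le[OF Suc.prems(1) W_pos, of a] 1(2) 2(2) W_pos by (simp add: algebra_simps)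
    ultimately show ?case using 2 by blast
  qed
  show ?thesis
    unfolding triple_def
  proof (intro allI impI)
    fix s assume "bounded_memory W s" "I 0 s"
    with *[of s N] obtain t s' where r: "runs (Loop a c) s t s'" "t \<le> Suc N * ?w"
      "bounded_memory W s'" "I N s'" by auto
    have "Suc N * ?w \<le> Suc L * ?w"
      using \<open>N \<le> L\<close> by (intro mult_le_mono1) simp
    then have "t \<le> prog_weight L (Loop a c) * W"
      using r(2) by (simp add: algebra_simps)
    with r show "\<exists>t s'. runs (Loop a c) s t s' \<and> t \<le> prog_weight L (Loop a c) * W \<and>
        bounded_memory W s' \<and> I N s'" by blast
  qed
qed

end

definition For :: "int \<Rightarrow> ram_exp \<Rightarrow> ram_prog \<Rightarrow> ram_prog" where
  "For r e c = Seq (Store (Const r) (Const 0))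
    (Loop (Minus e (Mem (Const r))) (Seq c (Store (Const r) (Plus (Mem (Const r)) (Const 1)))))"

text \<open>The counter is incremented outside of the body, so \<open>I\<close> has to survive
  writes to its cell and the value of the counter is kept beside \<open>I\<close>. The bound
  \<open>e\<close> is evaluated anew in every round, hence \<open>I\<close> must determine
  it.\<close>

lemma (in ram_bounds) triple_For:
  assumes body: "\<And>i. i < N \<Longrightarrow>
      triple L W (\<lambda>s. I i s \<and> s r = int i) c (\<lambda>s. I (Suc i) s \<and> s r = int i)"
    and upd: "\<And>i s v. I i s \<Longrightarrow> I i (s(r := v))"
    and test: "\<And>i s. I i s \<Longrightarrow> exp_val e s = int N"
    and "N \<le> L" "N \<le> 2 ^ W"
    and pre: "\<And>s. P s \<Longrightarrow> I 0 s"
    and post: "\<And>s. I N s \<Longrightarrow> Q s"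
  shows "triple L W P (For r e c) Q"
proof -
  let ?I = "\<lambda>i s. I i s \<and> s r = int i"
  have N: "int N \<le> 2 ^ W"
    using \<open>N \<le> 2 ^ W\<close> by (metis of_nat_le_iff of_nat_numeral of_nat_power)
  have "triple L W (?I 0) (Loop (Minus e (Mem (Const r)))
      (Seq c (Store (Const r) (Plus (Mem (Const r)) (Const 1))))) (?I N)"
  proof (rule triple_Loop)
    fix i assume i: "i < N"
    show "triple L W (?I i) (Seq c (Store (Const r) (Plus (Mem (Const r)) (Const 1)))) (?I (Suc i))"
    proof (rule triple_Seq[OF body[OF i]], rule triple_Store)
      fix s assume "I (Suc i) s \<and> s r = int i"
      moreover have "\<bar>int i + 1\<bar> \<le> 2 ^ W"
        using i N by linarith
      ultimately show "\<bar>exp_val (Plus (Mem (Const r)) (Const 1)) s\<bar> \<le> 2 ^ W \<and>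
          ?I (Suc i) (s(exp_val (Const r) s := exp_val (Plus (Mem (Const r)) (Const 1)) s))"
        using upd by auto
    qed
  next
    fix i s assume "i \<le> N" "?I i s"
    then show "0 < exp_val (Minus e (Mem (Const r))) s \<longleftrightarrow> i < N"
      using test[of i s] by auto
  qed fact
  moreover have "triple L W P (Store (Const r) (Const 0)) (?I 0)"
    by (rule triple_Store) (auto intro: upd pre)
  ultimately have "triple L W P (For r e c) (?I N)"
    unfolding For_def by (rule triple_Seq[rotated])
  then show ?thesis
    by (rule triple_post) (auto intro: post)
qed

section \<open>Lower bases\<close>

lemma sum_delta_mult:
  fixes f :: "nat \<Rightarrow> 'a :: comm_ring_1"
  shows "r < d \<Longrightarrow> (\<Sum>i<d. f i * (if i = r then 1 else 0)) = f r"
    "r < d \<Longrightarrow> (\<Sum>i<d. f i * (if r = i then 1 else 0)) = f r"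
    "r < d \<Longrightarrow> (\<Sum>i<d. (if i = r then 1 else 0) * f i) = f r"
    "r < d \<Longrightarrow> (\<Sum>i<d. (if r = i then 1 else 0) * f i) = f r"
proof -
  have *: "f i * (if i = r then 1 else 0) = (if i = r then f i else 0)"
    "f i * (if r = i then 1 else 0) = (if r = i then f i else 0)"
    "(if i = r then 1 else 0) * f i = (if i = r then f i else 0)"
    "(if r = i then 1 else 0) * f i = (if r = i then f i else 0)" for i
    by simp_all
  show "r < d \<Longrightarrow> (\<Sum>i<d. f i * (if i = r then 1 else 0)) = f r"
    "r < d \<Longrightarrow> (\<Sum>i<d. f i * (if r = i then 1 else 0)) = f r"
    "r < d \<Longrightarrow> (\<Sum>i<d. (if i = r then 1 else 0) * f i) = f r"
    "r < d \<Longrightarrow> (\<Sum>i<d. (if r = i then 1 else 0) * f i) = f r"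
    unfolding * by simp_all
qed

text \<open>Provides arbitrarily small positive perturbations that avoid the roots of finitely many
  polynomials.\<close>

lemma eventually_at_right_notin_finite:
  fixes S :: "real set"
  assumes "finite S"
  shows "eventually (\<lambda>x. x \<notin> S) (at_right 0)"
  using assms
proof induction
  case (insert s S)
  have "eventually (\<lambda>x. x \<noteq> s) (at_right 0)"
  proof (cases "0 < s")
    case True
    have "eventually (\<lambda>x. x < s) (at_right 0)"
      using order_tendstoD(2)[OF tendsto_ident_at True] .
    then show ?thesis
      by eventually_elim simp
  next
    case False
    then show ?thesis
      using eventually_at_right_less[of "0 :: real"] by (auto elim: eventually_mono)
  qed
  with insert.IH show ?case
    by eventually_elim auto
qed simp

section \<open>Coordinates and exchange of basis columns\<close>

locale columns =
  fixes d n :: nat and a :: "nat \<Rightarrow> nat \<Rightarrow> real"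
begin

definition coord :: "(nat \<Rightarrow> nat \<Rightarrow> real) \<Rightarrow> (nat \<Rightarrow> real) \<Rightarrow> nat \<Rightarrow> real" where
  "coord G y i = (\<Sum>k<d. G i k * y k)"

text \<open>The columns \<open>\<beta> 0, \<dots>, \<beta> (d - 1)\<close> form an invertible matrix with inverse \<open>G\<close>.\<close>

definition basis :: "(nat \<Rightarrow> nat) \<Rightarrow> (nat \<Rightarrow> nat \<Rightarrow> real) \<Rightarrow> bool" where
  "basis \<beta> G \<longleftrightarrow> (\<forall>i<d. \<beta> i < n) \<and>
    (\<forall>i<d. \<forall>l<d. coord G (\<lambda>k. a k (\<beta> l)) i = (if i = l then 1 else 0)) \<and>
    (\<forall>k<d. \<forall>l<d. (\<Sum>i<d. a k (\<beta> i) * G i l) = (if k = l then 1 else 0))"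

lemma basis_less: "basis \<beta> G \<Longrightarrow> i < d \<Longrightarrow> \<beta> i < n"
  by (simp add: basis_def)

lemma coord_basis: "basis \<beta> G \<Longrightarrow> i < d \<Longrightarrow> l < d \<Longrightarrow> coord G (\<lambda>k. a k (\<beta> l)) i = (if i = l then 1 else 0)"
  by (simp add: basis_def)

lemma coord_expand:
  assumes "basis \<beta> G" "k < d"
  shows "(\<Sum>i<d. a k (\<beta> i) * coord G y i) = y k"
proof -
  have "(\<Sum>i<d. a k (\<beta> i) * coord G y i) = (\<Sum>i<d. \<Sum>l<d. a k (\<beta> i) * G i l * y l)"
    by (simp add: coord_def sum_distrib_left mult.assoc)
  also have "\<dots> = (\<Sum>l<d. (\<Sum>i<d. a k (\<beta> i) * G i l) * y l)"
    by (subst sum.swap) (simp add: sum_distrib_right)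
  also have "\<dots> = (\<Sum>l<d. (if k = l then 1 else 0) * y l)"
    using assms by (intro sum.cong) (auto simp: basis_def)
  also have "\<dots> = y k"
    using assms(2) by (rule sum_delta_mult)
  finally show ?thesis .
qed

lemma coord_cong: "(\<And>k. k < d \<Longrightarrow> y k = z k) \<Longrightarrow> coord G y i = coord G z i"
  by (simp add: coord_def)

lemma coord_sum: "coord G (\<lambda>k. \<Sum>j\<in>J. v k j * c j) i = (\<Sum>j\<in>J. coord G (\<lambda>k. v k j) i * c j)"
proof -
  have "coord G (\<lambda>k. \<Sum>j\<in>J. v k j * c j) i = (\<Sum>k<d. \<Sum>j\<in>J. G i k * v k j * c j)"
    by (simp add: coord_def sum_distrib_left mult.assoc)
  also have "\<dots> = (\<Sum>j\<in>J. coord G (\<lambda>k. v k j) i * c j)"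
    by (subst sum.swap) (simp add: coord_def sum_distrib_right)
  finally show ?thesis .
qed

lemma coord_add: "coord G (\<lambda>k. y k + z k) i = coord G y i + coord G z i"
  by (simp add: coord_def sum.distrib algebra_simps)

lemma coord_scale: "coord G (\<lambda>k. y k * c) i = coord G y i * c"
  by (simp add: coord_def sum_distrib_right mult.assoc)

lemma coord_unique:
  assumes "basis \<beta> G" "i < d" "\<And>k. k < d \<Longrightarrow> (\<Sum>i<d. a k (\<beta> i) * c i) = y k"
  shows "coord G y i = c i"
proof -
  have "coord G y i = coord G (\<lambda>k. \<Sum>i<d. a k (\<beta> i) * c i) i"
    using assms(3) by (intro coord_cong) simp
  also have "\<dots> = (\<Sum>l<d. (if i = l then 1 else 0) * c l)"
    unfolding coord_sum using assms by (intro sum.cong) (auto simp: coord_basis)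
  finally show ?thesis
    using assms(2) by (simp only: sum_delta_mult)
qed

lemma basis_unique:
  assumes "basis \<beta> G" "basis \<beta>' G'" "\<And>i. i < d \<Longrightarrow> \<beta> i = \<beta>' i" "i < d"
  shows "coord G y i = coord G' y i"
  using assms by (intro coord_unique) (auto simp: coord_expand)

text \<open>The pivot step of the simplex method: \<open>G'\<close> comes from the inverse by the
  row operations that turn the coordinate vector \<open>y\<close> of the entering column into the
  unit vector at \<open>r\<close>.\<close>

lemma basis_exchange:
  assumes B: "basis \<beta> G" and "j < n" "r < d"
    and r: "coord G (\<lambda>k. a k j) r \<noteq> 0"
  defines "y \<equiv> coord G (\<lambda>k. a k j)"
  defines "G' \<equiv> (\<lambda>i k. if i = r then G r k / y r else G i k - y i / y r * G r k)"
  shows "basis (\<beta>(r := j)) G'"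
    and "coord G' z i = (if i = r then coord G z r / y r else coord G z i - y i / y r * coord G z r)"
proof -
  have c: "coord G' z i = (if i = r then coord G z r / y r else coord G z i - y i / y r * coord G z r)" for i z
    by (simp add: coord_def G'_def sum_divide_distrib sum_subtractf sum_distrib_left algebra_simps)
  then show "coord G' z i = (if i = r then coord G z r / y r else coord G z i - y i / y r * coord G z r)" .
  have yr: "y r \<noteq> 0"
    using r by (simp add: y_def)
  have "(\<Sum>i<d. a k ((\<beta>(r := j)) i) * G' i l) = (if k = l then 1 else 0)" if "k < d" "l < d" for k l
  proof -
    have "(\<Sum>i<d. a k ((\<beta>(r := j)) i) * G' i l) =
        a k j * (G r l / y r) + (\<Sum>i\<in>{..<d} - {r}. a k (\<beta> i) * (G i l - y i / y r * G r l))"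
      using \<open>r < d\<close> by (subst sum.remove[of _ r]) (auto simp: G'_def intro!: sum.cong)
    \<comment> \<open>The omitted summand is zero because \<open>y r / y r = 1\<close>, so the index
      \<open>r\<close> may be put back.\<close>
    also have "(\<Sum>i\<in>{..<d} - {r}. a k (\<beta> i) * (G i l - y i / y r * G r l)) =
        (\<Sum>i<d. a k (\<beta> i) * (G i l - y i / y r * G r l))"
      using \<open>r < d\<close> yr by (subst (2) sum.remove[of _ r]) auto
    also have "\<dots> = (\<Sum>i<d. a k (\<beta> i) * G i l) - (\<Sum>i<d. a k (\<beta> i) * y i) * (G r l / y r)"
      by (simp add: sum_distrib_left sum_distrib_right sum_subtractf algebra_simps)
    also have "\<dots> = (if k = l then 1 else 0) - a k j * (G r l / y r)"
      using B that coord_expand[OF B that(1)] by (simp add: basis_def y_def)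
    finally show ?thesis by simp
  qed
  moreover have "coord G' (\<lambda>k. a k ((\<beta>(r := j)) l)) i = (if i = l then 1 else 0)" if "i < d" "l < d" for i l
    unfolding c using B that yr \<open>r < d\<close> by (auto simp: coord_basis y_def)
  ultimately show "basis (\<beta>(r := j)) G'"
    using B \<open>j < n\<close> by (auto simp: basis_def)
qed

end

text \<open>Start from the unit vectors and exchange them against columns for as long as possible.\<close>

lemma full_row_rank_imp_basis:
  fixes a :: "nat \<Rightarrow> nat \<Rightarrow> real"
  assumes full: "\<And>g k. (\<And>j. j < n \<Longrightarrow> (\<Sum>k<d. g k * a k j) = 0) \<Longrightarrow> k < d \<Longrightarrow> g k = 0"
  shows "\<exists>\<beta> G. columns.basis d n a \<beta> G"
proof -
  \<comment> \<open>The unit vectors are appended as columns \<open>n\<close>, ...,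
    \<open>n + d - 1\<close>.\<close>
  define a' where "a' k j = (if j < n then a k j else if k = j - n then 1 else 0)" for k j
  interpret E: columns d "n + d" a' .
  interpret columns d n a .
  \<comment> \<open>Counts the unit vectors still in the basis; a basis that minimizes it turns out
    to have none.\<close>
  define bad where "bad \<beta> = card {i. i < d \<and> n \<le> \<beta> i}" for \<beta> :: "nat \<Rightarrow> nat"
  have "E.basis (\<lambda>i. n + i) (\<lambda>i k. if i = k then 1 else 0)"
    by (simp add: E.basis_def E.coord_def a'_def sum_delta_mult)
  then have "\<exists>\<beta>. (\<exists>G. E.basis \<beta> G) \<and> (\<forall>\<gamma>. (\<exists>G. E.basis \<gamma> G) \<longrightarrow> bad \<beta> \<le> bad \<gamma>)"
    by (intro ex_has_least_nat) blast
  then obtain \<beta> where \<beta>: "\<exists>G. E.basis \<beta> G" "\<And>\<gamma>. \<exists>G. E.basis \<gamma> G \<Longrightarrow> bad \<beta> \<le> bad \<gamma>"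
    by blast
  then obtain G where G: "E.basis \<beta> G" by blast
  have "\<beta> r < n" if "r < d" for r
  proof (rule ccontr)
    assume "\<not> \<beta> r < n"
    \<comment> \<open>Otherwise row \<open>r\<close> of the inverse annihilates all columns and is
      zero by full rank, although its product with the column \<open>\<beta> r\<close> is 1.\<close>
    have "\<exists>j<n. E.coord G (\<lambda>k. a' k j) r \<noteq> 0"
    proof (rule ccontr)
      assume "\<not> ?thesis"
      then have "(\<Sum>k<d. G r k * a k j) = 0" if "j < n" for j
        using that by (simp add: E.coord_def a'_def)
      note full[OF this]
      then have "E.coord G (\<lambda>k. a' k (\<beta> r)) r = 0"
        by (simp add: E.coord_def)
      with E.coord_basis[OF G that that] show False by simp
    qed
    then obtain j where j: "j < n" "E.coord G (\<lambda>k. a' k j) r \<noteq> 0" by blast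
    have "{i. i < d \<and> n \<le> (\<beta>(r := j)) i} \<subset> {i. i < d \<and> n \<le> \<beta> i}"
    proof (rule psubsetI)
      show "{i. i < d \<and> n \<le> (\<beta>(r := j)) i} \<subseteq> {i. i < d \<and> n \<le> \<beta> i}"
        using j(1) by (auto split: if_splits)
      have "r \<in> {i. i < d \<and> n \<le> \<beta> i}" "r \<notin> {i. i < d \<and> n \<le> (\<beta>(r := j)) i}"
        using \<open>\<not> \<beta> r < n\<close> j(1) that by auto
      then show "{i. i < d \<and> n \<le> (\<beta>(r := j)) i} \<noteq> {i. i < d \<and> n \<le> \<beta> i}"
        by blast
    qed
    then have "bad (\<beta>(r := j)) < bad \<beta>"
      unfolding bad_def by (intro psubset_card_mono) auto
    moreover have "bad \<beta> \<le> bad (\<beta>(r := j))"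
      using E.basis_exchange(1)[OF G _ that j(2)] j(1) by (intro \<beta>(2)) auto
    ultimately show False
      by simp
  qed
  then have "basis \<beta> G"
    using G by (auto simp: basis_def E.basis_def coord_def E.coord_def a'_def)
  then show ?thesis by blast
qed

section \<open>Caratheodory reduction and optimal bases\<close>

context columns
begin

text \<open>A Caratheodory step. If adding \<open>w\<close> times column \<open>j\<close> leaves the
  cone over the basis, column \<open>j\<close> enters with the least weight that keeps the rest of
  the point in the cone, and the blocking coordinate leaves the basis.\<close>

lemma absorb_column:
  assumes B: "basis \<beta> G" and "j < n" "0 \<le> w"
    and y: "\<And>i. i < d \<Longrightarrow> 0 \<le> coord G y i"
  shows "\<exists>\<beta> G. basis \<beta> G \<and> (\<forall>i<d. 0 \<le> coord G (\<lambda>k. y k + a k j * w) i)"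
proof (cases "\<forall>i<d. 0 \<le> coord G (\<lambda>k. y k + a k j * w) i")
  case False
  define u where "u = coord G (\<lambda>k. a k j)"
  define z where "z = coord G (\<lambda>k. y k + a k j * w)"
  have z: "z i = coord G y i + u i * w" for i
    by (simp add: z_def u_def coord_add coord_scale)
  let ?N = "{i. i < d \<and> u i < 0}"
  obtain i0 where i0: "i0 < d" "z i0 < 0"
    using False by (auto simp: z_def not_le)
  moreover from this have "u i0 < 0"
    using y[OF i0(1)] \<open>0 \<le> w\<close> z[of i0] mult_nonneg_nonneg[of "u i0" w] by linarith
  ultimately have i0N: "i0 \<in> ?N" by simp
  have fin: "finite ?N" by simp
  have "Max ((\<lambda>i. z i / u i) ` ?N) \<in> (\<lambda>i. z i / u i) ` ?N"
    using i0N by (intro Max_in) auto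
  then obtain r where "r \<in> ?N" "z r / u r = Max ((\<lambda>i. z i / u i) ` ?N)"
    by auto
  \<comment> \<open>Each \<open>i\<close> with \<open>u i < 0\<close> demands a weight of at least
    \<open>z i / u i\<close> on column \<open>j\<close>; the largest demand is the weight it
    receives.\<close>
  then have "\<exists>r\<in>?N. \<forall>i\<in>?N. z i / u i \<le> z r / u r"
    using fin by (intro bexI[of _ r]) auto
  then obtain r where r: "r < d" "u r < 0" "\<And>i. i < d \<Longrightarrow> u i < 0 \<Longrightarrow> z i / u i \<le> z r / u r"
    by blast
  have pos: "0 \<le> z r / u r"
    using r(3)[of i0] i0 i0N divide_neg_neg[of "z i0" "u i0"] by simp
  \<comment> \<open>The weight does not exceed \<open>w\<close>, since \<open>y\<close> has a
    nonnegative coordinate at \<open>r\<close>. This keeps the coordinates with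
    \<open>u i \<ge> 0\<close> nonnegative.\<close>
  have le: "z r / u r \<le> w"
    using y[OF r(1)] r(2) z[of r] by (simp add: field_simps)
  note ex = basis_exchange[OF B \<open>j < n\<close> r(1), folded u_def]
  have "u r \<noteq> 0" using r by simp
  note ex = ex[OF this]
  define G' where "G' = (\<lambda>i k. if i = r then G r k / u r else G i k - u i / u r * G r k)"
  have "0 \<le> coord G' (\<lambda>k. y k + a k j * w) i" if "i < d" for i
  proof (cases "i = r")
    case True
    then show ?thesis
      unfolding G'_def ex(2) using pos by (simp add: z_def)
  next
    case False
    have "0 \<le> z i - u i * (z r / u r)"
    proof (cases "u i < 0")
      case True
      have "u i * (z r / u r) \<le> u i * (z i / u i)"
        using True r(3)[OF that True] by (intro mult_left_mono_neg) auto
      then show ?thesis using True by simp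
    next
      case False
      then have "0 \<le> u i * (w - z r / u r)"
        using le by simp
      then show ?thesis using y[OF that] by (simp add: z algebra_simps)
    qed
    then show ?thesis
      unfolding G'_def ex(2) using False by (simp add: z_def)
  qed
  then show ?thesis
    using ex(1) unfolding G'_def by blast
qed (use B in blast)

text \<open>The columns enter one at a time, starting from an arbitrary point \<open>y\<close> of a
  simplicial cone; this freedom is used with a small perturbation as \<open>y\<close>.\<close>

lemma absorb_columns:
  assumes "basis \<beta> G" "\<And>i. i < d \<Longrightarrow> 0 \<le> coord G y i" "\<And>j. j < N \<Longrightarrow> 0 \<le> w j" "N \<le> n"
  shows "\<exists>\<beta> G. basis \<beta> G \<and> (\<forall>i<d. 0 \<le> coord G (\<lambda>k. y k + (\<Sum>j<N. a k j * w j)) i)"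
  using assms(3,4)
proof (induction N)
  case 0
  then show ?case using assms(1,2) by auto
next
  case (Suc N)
  then obtain \<beta>' G' where "basis \<beta>' G'" "\<forall>i<d. 0 \<le> coord G' (\<lambda>k. y k + (\<Sum>j<N. a k j * w j)) i"
    by auto
  from absorb_column[OF this(1), of N "w N" "\<lambda>k. y k + (\<Sum>j<N. a k j * w j)"] this Suc.prems
  show ?case by (simp add: add.assoc)
qed

lemma basis_restrict: "basis (restrict \<beta> {..<d}) G \<longleftrightarrow> basis \<beta> G"
  by (simp add: basis_def)

text \<open>Extensional functions make the set finite; every basis is represented by its restriction
  to \<open>{..<d}\<close>.\<close>

definition bases :: "(nat \<Rightarrow> nat) set" where
  "bases = {\<beta> \<in> {..<d} \<rightarrow>\<^sub>E {..<n}. \<exists>G. basis \<beta> G}"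

definition inverse_of :: "(nat \<Rightarrow> nat) \<Rightarrow> nat \<Rightarrow> nat \<Rightarrow> real" where
  "inverse_of \<beta> = (SOME G. basis \<beta> G)"

lemma finite_bases: "finite bases"
proof -
  have "finite ({..<d} \<rightarrow>\<^sub>E {..<n})"
    by (intro finite_PiE) auto
  then show ?thesis
    by (rule rev_finite_subset) (auto simp: bases_def)
qed

lemma basis_inverse_of: "\<beta> \<in> bases \<Longrightarrow> basis \<beta> (inverse_of \<beta>)"
  unfolding bases_def inverse_of_def by (blast intro: someI_ex[of "basis \<beta>"])

lemma restrict_in_bases:
  assumes "basis \<beta> G"
  shows "restrict \<beta> {..<d} \<in> bases"
    and "i < d \<Longrightarrow> coord (inverse_of (restrict \<beta> {..<d})) y i = coord G y i"
proof -
  show "restrict \<beta> {..<d} \<in> bases"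
    using assms basis_restrict[of \<beta> G] by (auto simp: bases_def basis_less)
  from basis_inverse_of[OF this] show "i < d \<Longrightarrow> coord (inverse_of (restrict \<beta> {..<d})) y i = coord G y i"
    by (rule basis_unique[OF _ assms]) auto
qed

text \<open>Dual feasibility of the functional h, whose value is the sum of the coordinates. Every
  functional vanishes on a zero column, so those are exempt.\<close>

definition lower :: "(nat \<Rightarrow> nat \<Rightarrow> real) \<Rightarrow> bool" where
  "lower G \<longleftrightarrow> (\<forall>j<n. (\<exists>k<d. a k j \<noteq> 0) \<longrightarrow> 1 \<le> (\<Sum>i<d. coord G (\<lambda>k. a k j) i))"

text \<open>Nonnegativity excludes an unbounded improving direction, genericity excludes degenerate pivots.\<close>

lemma optimal_basis:
  assumes nonneg: "\<And>k j. k < d \<Longrightarrow> j < n \<Longrightarrow> 0 \<le> a k j"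
    and generic: "\<And>\<beta> G i. basis \<beta> G \<Longrightarrow> i < d \<Longrightarrow> coord G y i \<noteq> 0"
    and start: "basis \<beta>0 G0" "\<forall>i<d. 0 \<le> coord G0 y i"
  shows "\<exists>\<beta> G. basis \<beta> G \<and> (\<forall>i<d. 0 \<le> coord G y i) \<and> lower G"
proof -
  \<comment> \<open>The objective values of all bases whose cone contains \<open>y\<close>; there
    are finitely many, so one of them is largest.\<close>
  define V where "V = {\<Sum>i<d. coord G y i |\<beta> G. basis \<beta> G \<and> (\<forall>i<d. 0 \<le> coord G y i)}"
  have "V \<subseteq> (\<lambda>\<beta>. \<Sum>i<d. coord (inverse_of \<beta>) y i) ` bases"
  proof
    fix v assume "v \<in> V"
    then obtain \<beta> G where v: "basis \<beta> G" "v = (\<Sum>i<d. coord G y i)"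
      by (auto simp: V_def)
    then have "v = (\<Sum>i<d. coord (inverse_of (restrict \<beta> {..<d})) y i)"
      by (simp add: restrict_in_bases)
    then show "v \<in> (\<lambda>\<beta>. \<Sum>i<d. coord (inverse_of \<beta>) y i) ` bases"
      using restrict_in_bases(1)[OF v(1)] by blast
  qed
  then have "finite V"
    by (rule finite_subset) (simp add: finite_bases)
  moreover have "V \<noteq> {}"
    using start by (auto simp: V_def)
  ultimately have "Max V \<in> V"
    by (rule Max_in)
  then obtain \<beta> G where B: "basis \<beta> G" "\<forall>i<d. 0 \<le> coord G y i" "Max V = (\<Sum>i<d. coord G y i)"
    by (auto simp: V_def)
  have "lower G"
    unfolding lower_def
  proof (intro allI impI, rule ccontr)
    fix j assume j: "j < n" "\<exists>k<d. a k j \<noteq> 0"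
    assume "\<not> 1 \<le> (\<Sum>i<d. coord G (\<lambda>k. a k j) i)"
    moreover define u where "u = coord G (\<lambda>k. a k j)"
    ultimately have sum_u: "(\<Sum>i<d. u i) < 1" by simp
    let ?N = "{i. i < d \<and> 0 < u i}"
    \<comment> \<open>A nonzero nonnegative column is not a nonpositive combination of nonnegative
      columns, so the ratio test has a candidate.\<close>
    have "?N \<noteq> {}"
    proof
      assume "?N = {}"
      have "a k j = 0" if "k < d" for k
      proof -
        have "a k j = (\<Sum>i<d. a k (\<beta> i) * u i)"
          unfolding u_def using coord_expand[OF B(1) that] by simp
        also have "\<dots> \<le> 0"
        proof (intro sum_nonpos mult_nonneg_nonpos)
          fix i assume i: "i \<in> {..<d}"
          show "0 \<le> a k (\<beta> i)"
            using i nonneg[OF that basis_less[OF B(1)]] by simp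
          have "i \<notin> ?N"
            unfolding \<open>?N = {}\<close> by simp
          then show "u i \<le> 0"
            using i by simp
        qed
        finally show ?thesis
          using nonneg[OF that j(1)] by simp
      qed
      with j(2) show False by blast
    qed
    then have "Min ((\<lambda>i. coord G y i / u i) ` ?N) \<in> (\<lambda>i. coord G y i / u i) ` ?N"
      by (intro Min_in) auto
    then obtain r where r: "r < d" "0 < u r"
      "coord G y r / u r = Min ((\<lambda>i. coord G y i / u i) ` ?N)"
      by auto
    have le: "coord G y r / u r \<le> coord G y i / u i" if "i < d" "0 < u i" for i
      unfolding r(3) using that by (intro Min_le) auto
    \<comment> \<open>The step length of the exchange. Genericity makes it positive, so the
      objective grows by \<open>t * (1 - (\<Sum>i<d. u i)) > 0\<close>, against maximality.\<close>
    define t where "t = coord G y r / u r"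
    have "0 < t"
      using B(2) generic[OF B(1) r(1)] r(1,2) unfolding t_def by (smt (verit) zero_less_divide_iff)
    note ex = basis_exchange[OF B(1) j(1) r(1), folded u_def]
    have "u r \<noteq> 0" using r by simp
    note ex = ex[OF this]
    define G' where "G' = (\<lambda>i k. if i = r then G r k / u r else G i k - u i / u r * G r k)"
    have c: "coord G' y i = (if i = r then t else coord G y i - u i * t)" for i
      unfolding G'_def ex(2) by (simp add: t_def)
    have "0 \<le> coord G' y i" if "i < d" for i
    proof -
      have "u i * t \<le> coord G y i"
      proof (cases "0 < u i")
        case True
        then show ?thesis
          using le[OF that True] by (simp add: t_def field_simps)
      next
        case False
        then have "u i * t \<le> 0"
          using \<open>0 < t\<close> by (simp add: mult_nonpos_nonneg)
        then show ?thesis using B(2) that by force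
      qed
      then show ?thesis using \<open>0 < t\<close> by (simp add: c)
    qed
    then have "(\<Sum>i<d. coord G' y i) \<in> V"
      using ex(1) unfolding V_def G'_def by blast
    then have "(\<Sum>i<d. coord G' y i) \<le> (\<Sum>i<d. coord G y i)"
      using Max_ge[OF \<open>finite V\<close>] B(3) by simp
    moreover have "(\<Sum>i<d. coord G' y i) = (\<Sum>i<d. coord G y i - u i * t) + t"
    proof -
      have "(\<Sum>i<d. coord G' y i) = t + (\<Sum>i\<in>{..<d} - {r}. coord G y i - u i * t)"
        using r(1) by (subst sum.remove[of _ r]) (auto simp: c intro!: sum.cong)
      also have "(\<Sum>i\<in>{..<d} - {r}. coord G y i - u i * t) = (\<Sum>i<d. coord G y i - u i * t)"
        using r(1,2) by (subst (2) sum.remove[of _ r]) (auto simp: t_def)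
      finally show ?thesis by simp
    qed
    moreover have "(\<Sum>i<d. coord G y i - u i * t) = (\<Sum>i<d. coord G y i) - (\<Sum>i<d. u i) * t"
      by (simp add: sum_subtractf sum_distrib_right)
    moreover have "(\<Sum>i<d. u i) * t < t"
      using sum_u \<open>0 < t\<close> by simp
    ultimately show False by linarith
  qed
  with B show ?thesis by blast
qed

text \<open>
  A point in general position has a nondegenerate optimal basis; a basis serving points
  arbitrarily close to \<open>x\<close> also serves \<open>x\<close>.
\<close>

lemma cone_covered_by_lower_bases:
  assumes nonneg: "\<And>k j. k < d \<Longrightarrow> j < n \<Longrightarrow> 0 \<le> a k j"
    and "basis \<tau> H" and r: "\<And>j. j < n \<Longrightarrow> 0 \<le> r j"
  shows "\<exists>\<beta> G. basis \<beta> G \<and> (\<forall>i<d. 0 \<le> coord G (\<lambda>k. \<Sum>j<n. a k j * r j) i) \<and> lower G"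
proof (rule ccontr)
  assume neg: "\<not> ?thesis"
  define x where "x k = (\<Sum>j<n. a k j * r j)" for k
  \<comment> \<open>The perturbation has distinct powers of \<open>e\<close> as coordinates over
    \<open>\<tau>\<close>, so that in every basis each coordinate of the moved point is a nonzero
    polynomial in \<open>e\<close>.\<close>
  define p where "p e k = (\<Sum>l<d. a k (\<tau> l) * e ^ Suc l)" for e k
  define P where "P G i = [:coord G x i:] + (\<Sum>l<d. monom (coord G (\<lambda>k. a k (\<tau> l)) i) (Suc l))" for G i
  have P: "poly (P G i) e = coord G (\<lambda>k. p e k + x k) i" for G i e
    by (simp add: P_def coord_add p_def coord_sum poly_sum poly_monom)
  \<comment> \<open>If all higher coefficients vanished, the \<open>i\<close>-th coordinate would be
    zero on the columns of \<open>\<tau>\<close> and hence on every vector.\<close>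
  have P_nz: "P G i \<noteq> 0" if "basis \<beta> G" "i < d" for \<beta> G i
  proof
    assume "P G i = 0"
    have "coord G (\<lambda>k. a k (\<tau> l)) i = 0" if "l < d" for l
    proof -
      have "coeff (P G i) (Suc l) = (\<Sum>l'<d. if l' = l then coord G (\<lambda>k. a k (\<tau> l')) i else 0)"
        by (simp add: P_def coeff_sum eq_commute[of "Suc l"])
      with \<open>P G i = 0\<close> that show ?thesis by simp
    qed
    then have "coord G (\<lambda>k. \<Sum>l<d. a k (\<tau> l) * coord H y l) i = 0" for y
      by (simp add: coord_sum)
    moreover have "coord G (\<lambda>k. \<Sum>l<d. a k (\<tau> l) * coord H y l) i = coord G y i" for y
      using coord_expand[OF \<open>basis \<tau> H\<close>] by (intro coord_cong) simp
    ultimately show False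
      using coord_basis[OF that(1) that(2) that(2)] by simp
  qed
  \<comment> \<open>A lower basis that fails at \<open>x\<close> has a strictly negative coordinate
    there and keeps it for all small \<open>e\<close>, by continuity.\<close>
  have "eventually (\<lambda>e. \<exists>i<d. poly (P (inverse_of \<beta>) i) e < 0) (at_right 0)"
    if \<beta>: "\<beta> \<in> bases" "lower (inverse_of \<beta>)" for \<beta>
  proof -
    obtain i where i: "i < d" "coord (inverse_of \<beta>) x i < 0"
      using neg basis_inverse_of[OF \<beta>(1)] \<beta>(2) unfolding x_def by (meson not_le)
    have "((\<lambda>e. poly (P (inverse_of \<beta>) i) e) \<longlongrightarrow> poly (P (inverse_of \<beta>) i) 0) (at_right 0)"
      by (intro tendsto_intros)
    moreover have "poly (P (inverse_of \<beta>) i) 0 < 0"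
      using i(2) by (simp add: P p_def)
    ultimately have "eventually (\<lambda>e. poly (P (inverse_of \<beta>) i) e < 0) (at_right 0)"
      by (rule order_tendstoD)
    then show ?thesis
      by eventually_elim (use i in blast)
  qed
  then have "eventually (\<lambda>e. \<forall>\<beta>\<in>{\<beta>\<in>bases. lower (inverse_of \<beta>)}.
      \<exists>i<d. poly (P (inverse_of \<beta>) i) e < 0) (at_right 0)"
    using finite_bases by (intro eventually_ball_finite) auto
  moreover have "eventually (\<lambda>e. e \<notin> (\<Union>\<beta>\<in>bases. \<Union>i<d. {e. poly (P (inverse_of \<beta>) i) e = 0})) (at_right 0)"
    using finite_bases P_nz basis_inverse_of
    by (intro eventually_at_right_notin_finite finite_UN_I poly_roots_finite) auto
  moreover have "eventually (\<lambda>e :: real. 0 < e) (at_right 0)"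
    by (rule eventually_at_right_less)
  ultimately have "eventually (\<lambda>e. (\<forall>\<beta>\<in>{\<beta>\<in>bases. lower (inverse_of \<beta>)}.
      \<exists>i<d. poly (P (inverse_of \<beta>) i) e < 0) \<and>
      e \<notin> (\<Union>\<beta>\<in>bases. \<Union>i<d. {e. poly (P (inverse_of \<beta>) i) e = 0}) \<and> 0 < e) (at_right 0)"
    by eventually_elim auto
  from eventually_happens'[OF trivial_limit_at_right_real this] obtain e where e':
    "(\<forall>\<beta>\<in>{\<beta>\<in>bases. lower (inverse_of \<beta>)}. \<exists>i<d. poly (P (inverse_of \<beta>) i) e < 0) \<and>
      e \<notin> (\<Union>\<beta>\<in>bases. \<Union>i<d. {e. poly (P (inverse_of \<beta>) i) e = 0}) \<and> 0 < e" ..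
  then have e: "\<And>\<beta>. \<beta> \<in> bases \<Longrightarrow> lower (inverse_of \<beta>) \<Longrightarrow> \<exists>i<d. poly (P (inverse_of \<beta>) i) e < 0"
    "\<And>\<beta> i. \<beta> \<in> bases \<Longrightarrow> i < d \<Longrightarrow> poly (P (inverse_of \<beta>) i) e \<noteq> 0" "0 < e"
    by simp_all
  \<comment> \<open>The perturbation lies in the cone over \<open>\<tau>\<close>, which is the start
    for absorbing the columns that make up \<open>x\<close>.\<close>
  have "coord H (p e) i = e ^ Suc i" if "i < d" for i
    using \<open>basis \<tau> H\<close> that by (rule coord_unique) (simp add: p_def)
  then have "\<And>i. i < d \<Longrightarrow> 0 \<le> coord H (p e) i"
    using \<open>0 < e\<close> by simp
  from absorb_columns[OF \<open>basis \<tau> H\<close> this, of n r] r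
  obtain \<beta>0 G0 where 0: "basis \<beta>0 G0" "\<forall>i<d. 0 \<le> coord G0 (\<lambda>k. p e k + x k) i"
    by (auto simp: x_def)
  have generic: "coord G (\<lambda>k. p e k + x k) i \<noteq> 0" if "basis \<beta> G" "i < d" for \<beta> G i
    using e(2)[OF restrict_in_bases(1)[OF that(1)] that(2)] restrict_in_bases(2)[OF that] by (simp add: P)
  have "\<exists>\<beta> G. basis \<beta> G \<and> (\<forall>i<d. 0 \<le> coord G (\<lambda>k. p e k + x k) i) \<and> lower G"
    by (rule optimal_basis[OF _ _ 0]) (use nonneg generic in auto)
  then obtain \<beta> G where
    B: "basis \<beta> G" "\<forall>i<d. 0 \<le> coord G (\<lambda>k. p e k + x k) i" "lower G" by blast
  let ?\<beta> = "restrict \<beta> {..<d}"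
  have "lower (inverse_of ?\<beta>)"
    using B(3) restrict_in_bases(2)[OF B(1)] by (simp add: lower_def)
  from e(1)[OF restrict_in_bases(1)[OF B(1)] this] obtain i where
    "i < d" "poly (P (inverse_of ?\<beta>) i) e < 0" by blast
  then show False
    using B(2) restrict_in_bases(2)[OF B(1)] by (force simp: P)
qed

end

section \<open>Normality and representatives\<close>

lemma right_inverse_imp_left_inverse:
  fixes F G :: "nat \<Rightarrow> nat \<Rightarrow> 'a :: field"
  assumes "\<And>k l. k < d \<Longrightarrow> l < d \<Longrightarrow> (\<Sum>i<d. F k i * G i l) = (if k = l then 1 else 0)"
    and "i < d" "l < d"
  shows "(\<Sum>k<d. G i k * F k l) = (if i = l then 1 else 0)"
proof -
  let ?F = "mat d d (\<lambda>(k, i). F k i)" and ?G = "mat d d (\<lambda>(i, k). G i k)"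
  have "?F * ?G = 1\<^sub>m d"
    by (rule eq_matI) (use assms(1) in \<open>auto simp: scalar_prod_def atLeast0LessThan\<close>)
  then have "?G * ?F = 1\<^sub>m d"
    by (rule mat_mult_left_right_inverse[rotated 2]) auto
  then have "(?G * ?F) $$ (i, l) = (if i = l then 1 else 0)"
    using assms(2,3) by simp
  then show ?thesis
    using assms(2,3) by (simp add: scalar_prod_def atLeast0LessThan)
qed

locale nonneg_columns =
  fixes d m :: nat and a :: "nat \<Rightarrow> nat \<Rightarrow> int"
  assumes nonneg: "k < d \<Longrightarrow> j < d + m \<Longrightarrow> 0 \<le> a k j"
    and full_rank: "\<exists>\<tau> H. columns.basis d (d + m) (\<lambda>k j. real_of_int (a k j)) \<tau> H"
begin

sublocale columns d "d + m" "\<lambda>k j. real_of_int (a k j)" .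

definition normal_columns :: bool where
  "normal_columns \<longleftrightarrow> (\<forall>(z :: nat \<Rightarrow> int) (r :: nat \<Rightarrow> real).
    (\<forall>j<d + m. 0 \<le> r j) \<longrightarrow>
    (\<forall>k<d. (\<Sum>j<d + m. real_of_int (a k j) * r j) = real_of_int (\<Sum>j<d + m. a k j * z j)) \<longrightarrow>
    (\<exists>w :: nat \<Rightarrow> nat. \<forall>k<d. (\<Sum>j<d + m. a k j * int (w j)) = (\<Sum>j<d + m. a k j * z j)))"

text \<open>
  \<open>T / D\<close> is \<open>A\<^sub>\<beta>\<^sup>-\<^sup>1 A\<close>, where \<open>A\<^sub>\<beta>\<close> consists of the columns outside of \<open>I\<close>, in the order \<open>\<beta>\<close>.
\<close>

definition tableau :: "(nat \<Rightarrow> nat) \<Rightarrow> (nat \<Rightarrow> nat) \<Rightarrow> (nat \<Rightarrow> nat \<Rightarrow> int) \<Rightarrow> int \<Rightarrow> bool" where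
  "tableau I \<beta> T D \<longleftrightarrow> D \<noteq> 0 \<and> bij_betw \<beta> {..<d} ({..<d + m} - I ` {..<m}) \<and>
    (\<forall>k<d. \<forall>j<d + m. (\<Sum>i<d. a k (\<beta> i) * T i j) = D * a k j)"

text \<open>The floor is correct for either sign of \<open>D\<close>. In a tableau, a column of
  \<open>T\<close> vanishes exactly if the column of the matrix does.\<close>

definition lower_test :: "(nat \<Rightarrow> nat \<Rightarrow> int) \<Rightarrow> int \<Rightarrow> bool" where
  "lower_test T D \<longleftrightarrow> (\<forall>j<d + m. (\<exists>i<d. T i j \<noteq> 0) \<longrightarrow> 1 \<le> (\<Sum>i<d. T i j) div D)"

text \<open>The point with multiplicities \<open>u\<close> has the coordinates
  \<open>(\<Sum>j<m. T i (I j) * int (u j)) / D\<close> over the basis; a floor of at most 0 says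
  that they are below 1. Divisibility says that the points of \<open>v\<close> and \<open>u\<close>
  differ by an integer combination of basis columns.\<close>

definition good_representative ::
  "(nat \<Rightarrow> nat) \<Rightarrow> (nat \<Rightarrow> nat \<Rightarrow> int) \<Rightarrow> int \<Rightarrow> (nat \<Rightarrow> int) \<Rightarrow> (nat \<Rightarrow> nat) \<Rightarrow> bool" where
  "good_representative I T D v u \<longleftrightarrow> (\<forall>i<d. (\<Sum>j<m. T i (I j) * int (u j)) div D \<le> 0 \<and>
    D dvd (\<Sum>j<m. T i (I j) * (v j - int (u j))))"

text \<open>The entries of \<open>v\<close> exceed the bound on \<open>u\<close> by one: what
  matters is that a representative with one entry raised has a representative again.\<close>

definition cover_test :: "(nat \<Rightarrow> nat) \<Rightarrow> (nat \<Rightarrow> nat \<Rightarrow> int) \<Rightarrow> int \<Rightarrow> bool" where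
  "cover_test I T D \<longleftrightarrow> (\<forall>v :: nat \<Rightarrow> nat. (\<forall>j<m. v j \<le> Suc d) \<longrightarrow>
    (\<exists>u. (\<forall>j<m. u j \<le> d) \<and> good_representative I T D (\<lambda>j. int (v j)) u))"

definition passes :: "(nat \<Rightarrow> nat) \<Rightarrow> (nat \<Rightarrow> nat \<Rightarrow> int) \<Rightarrow> int \<Rightarrow> bool" where
  "passes I T D \<longleftrightarrow> (lower_test T D \<longrightarrow> cover_test I T D)"

text \<open>This also covers an \<open>I\<close> with repetitions below \<open>m\<close>, for then
  more than \<open>d\<close> columns lie outside.\<close>

definition dependent_outside :: "(nat \<Rightarrow> nat) \<Rightarrow> bool" where
  "dependent_outside I \<longleftrightarrow> (\<exists>y :: nat \<Rightarrow> int. (\<exists>j<d + m. y j \<noteq> 0) \<and> (\<forall>j<m. y (I j) = 0) \<and>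
    (\<forall>k<d. (\<Sum>j<d + m. a k j * y j) = 0))"

lemma real_floor_div: "real_of_int (x div y) \<le> real_of_int x / real_of_int y"
  "real_of_int x / real_of_int y < real_of_int (x div y) + 1"
  using floor_correct[of "real_of_int x / real_of_int y"] by (simp_all add: floor_divide_of_int_eq)

section \<open>Consequences of a complete integer tableau\<close>

context
  fixes I \<beta> T D
  assumes tab: "tableau I \<beta> T D" and I_less: "\<And>j. j < m \<Longrightarrow> I j < d + m"
begin

lemma D_nz: "D \<noteq> 0" and bij: "bij_betw \<beta> {..<d} ({..<d + m} - I ` {..<m})"
  and tableau_eq: "k < d \<Longrightarrow> j < d + m \<Longrightarrow> (\<Sum>i<d. a k (\<beta> i) * T i j) = D * a k j"
  using tab by (auto simp: tableau_def)

lemma inj_\<beta>: "inj_on \<beta> {..<d}" and image_\<beta>: "\<beta> ` {..<d} = {..<d + m} - I ` {..<m}"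
  using bij by (auto simp: bij_betw_def)

text \<open>Forced by counting: the \<open>d\<close> basis columns leave exactly \<open>m\<close>
  columns for the image of \<open>I\<close>.\<close>

lemma inj_I: "inj_on I {..<m}"
proof (rule eq_card_imp_inj_on)
  have "card ({..<d + m} - I ` {..<m}) = d"
    using bij_betw_same_card[OF bij] by simp
  moreover have "card ({..<d + m} - I ` {..<m}) = d + m - card (I ` {..<m})"
    using I_less by (subst card_Diff_subset) auto
  moreover have "card (I ` {..<m}) \<le> m"
    using card_image_le[of "{..<m}" I] by simp
  ultimately show "card (I ` {..<m}) = card {..<m}" by simp
qed simp

lemma sum_columns:
  fixes f :: "nat \<Rightarrow> 'b :: comm_monoid_add"
  shows "(\<Sum>j<d + m. f j) = (\<Sum>i<d. f (\<beta> i)) + (\<Sum>j<m. f (I j))"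
proof -
  have "{..<d + m} = \<beta> ` {..<d} \<union> I ` {..<m}"
    using I_less unfolding image_\<beta> by auto
  then have "(\<Sum>j<d + m. f j) = (\<Sum>j\<in>\<beta> ` {..<d}. f j) + (\<Sum>j\<in>I ` {..<m}. f j)"
    by (simp only:) (rule sum.union_disjoint, auto simp: image_\<beta>)
  then show ?thesis
    by (simp add: sum.reindex[OF inj_\<beta>] sum.reindex[OF inj_I])
qed

definition glue :: "(nat \<Rightarrow> 'b) \<Rightarrow> (nat \<Rightarrow> 'b) \<Rightarrow> nat \<Rightarrow> 'b" where
  "glue f g c = (if c \<in> \<beta> ` {..<d} then f (inv_into {..<d} \<beta> c) else g (inv_into {..<m} I c))"

lemma glue_\<beta> [simp]: "i < d \<Longrightarrow> glue f g (\<beta> i) = f i"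
  using inj_\<beta> by (simp add: glue_def)

lemma glue_I [simp]: "j < m \<Longrightarrow> glue f g (I j) = g j"
  using inj_I unfolding glue_def image_\<beta> by simp

lemma column_cases:
  assumes "c < d + m"
  obtains i where "i < d" "c = \<beta> i" | j where "j < m" "c = I j"
  using assms image_\<beta> by (cases "c \<in> I ` {..<m}") blast+

lemma tableau_combination:
  assumes "k < d"
  shows "(\<Sum>i<d. a k (\<beta> i) * (\<Sum>j<m. T i (I j) * c j)) = D * (\<Sum>j<m. a k (I j) * c j)"
proof -
  have "(\<Sum>i<d. a k (\<beta> i) * (\<Sum>j<m. T i (I j) * c j)) = (\<Sum>i<d. \<Sum>j<m. a k (\<beta> i) * T i (I j) * c j)"
    by (simp add: sum_distrib_left mult.assoc)
  also have "\<dots> = (\<Sum>j<m. (\<Sum>i<d. a k (\<beta> i) * T i (I j)) * c j)"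
    by (subst sum.swap) (simp add: sum_distrib_right)
  also have "\<dots> = (\<Sum>j<m. D * a k (I j) * c j)"
    using assms I_less by (intro sum.cong) (auto simp: tableau_eq)
  finally show ?thesis
    by (simp add: sum_distrib_left mult.assoc)
qed

text \<open>Restricted to the columns of a known basis \<open>\<tau>\<close> and multiplied by its
  inverse \<open>H\<close>, the tableau equation exhibits a right inverse of the matrix of
  \<open>\<beta>\<close>; for square matrices it is two-sided.\<close>

lemma tableau_basis: "\<exists>G. basis \<beta> G"
proof -
  obtain \<tau> H where \<tau>: "basis \<tau> H"
    using full_rank by blast
  define G where "G i l = (\<Sum>p<d. real_of_int (T i (\<tau> p)) * H p l) / D" for i l
  have right: "(\<Sum>i<d. real_of_int (a k (\<beta> i)) * G i l) = (if k = l then 1 else 0)" if "k < d" "l < d" for k l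
  proof -
    have "(\<Sum>i<d. real_of_int (a k (\<beta> i)) * G i l) =
        (\<Sum>i<d. \<Sum>p<d. real_of_int (a k (\<beta> i) * T i (\<tau> p)) * H p l) / D"
      by (simp add: G_def sum_distrib_left sum_divide_distrib mult.assoc)
    also have "\<dots> = (\<Sum>p<d. real_of_int (\<Sum>i<d. a k (\<beta> i) * T i (\<tau> p)) * H p l) / D"
      by (subst sum.swap) (simp add: sum_distrib_right)
    also have "\<dots> = (\<Sum>p<d. real_of_int (D * a k (\<tau> p)) * H p l) / D"
      using that(1) basis_less[OF \<tau>] by (simp add: tableau_eq)
    also have "\<dots> = (\<Sum>p<d. real_of_int (a k (\<tau> p)) * H p l)"
      using D_nz by (simp add: sum_divide_distrib)
    finally show ?thesis
      using \<tau> that by (simp add: basis_def)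
  qed
  moreover have "coord G (\<lambda>k. real_of_int (a k (\<beta> l))) i = (if i = l then 1 else 0)" if "i < d" "l < d" for i l
    unfolding coord_def by (rule right_inverse_imp_left_inverse[OF right that])
  moreover have "\<beta> i < d + m" if "i < d" for i
    using image_\<beta> that by blast
  ultimately show ?thesis
    unfolding basis_def by blast
qed

lemma tableau_coord:
  assumes "basis \<beta> G" "i < d" "j < d + m"
  shows "coord G (\<lambda>k. real_of_int (a k j)) i = T i j / D"
proof (rule coord_unique[OF assms(1,2)])
  fix k assume "k < d"
  have "(\<Sum>i<d. real_of_int (a k (\<beta> i)) * (T i j / D)) = real_of_int (\<Sum>i<d. a k (\<beta> i) * T i j) / D"
    by (simp add: sum_divide_distrib)
  then show "(\<Sum>i<d. real_of_int (a k (\<beta> i)) * (T i j / D)) = real_of_int (a k j)"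
    using tableau_eq[OF \<open>k < d\<close> assms(3)] D_nz by simp
qed

lemma tableau_independent:
  assumes "\<And>k. k < d \<Longrightarrow> (\<Sum>i<d. a k (\<beta> i) * c i) = 0" "i < d"
  shows "c i = 0"
proof -
  obtain G where G: "basis \<beta> G"
    using tableau_basis by blast
  have "coord G (\<lambda>k. 0) i = real_of_int (c i)"
  proof (rule coord_unique[OF G assms(2)])
    fix k assume "k < d"
    have "(\<Sum>i<d. real_of_int (a k (\<beta> i)) * real_of_int (c i)) = real_of_int (\<Sum>i<d. a k (\<beta> i) * c i)"
      by simp
    then show "(\<Sum>i<d. real_of_int (a k (\<beta> i)) * real_of_int (c i)) = 0"
      using assms(1)[OF \<open>k < d\<close>] by simp
  qed
  then show ?thesis
    by (simp add: coord_def)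
qed

text \<open>
  The representative is read off a representation of the point with coordinates
  \<open>frac (E i / D)\<close>. In a lower tableau the sum of the coordinates bounds the sum of its entries.
\<close>

lemma normal_imp_passes:
  assumes normal_columns
  shows "passes I T D"
  unfolding passes_def cover_test_def
proof (intro impI allI)
  fix v :: "nat \<Rightarrow> nat"
  assume low: "lower_test T D"
  define E where "E i = (\<Sum>j<m. T i (I j) * int (v j))" for i
  define q where "q i = E i div D" for i
  define f where "f i = E i / D - q i" for i
  have f: "0 \<le> f i" "f i < 1" for i
    using real_floor_div[of "E i" D] by (simp_all add: f_def q_def)
  \<comment> \<open>Integer coefficients for the point whose coordinates over the basis are the
    fractional parts \<open>f\<close>; \<open>r\<close> is its nonnegative representation.\<close>
  define z where "z = glue (\<lambda>i. - q i) (\<lambda>j. int (v j))"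
  define r where "r = glue f (\<lambda>j. 0)"
  have "0 \<le> r c" if "c < d + m" for c
    using that f by (auto elim!: column_cases simp: r_def)
  moreover have "(\<Sum>c<d + m. real_of_int (a k c) * r c) = real_of_int (\<Sum>c<d + m. a k c * z c)" if "k < d" for k
  proof -
    have "(\<Sum>c<d + m. real_of_int (a k c) * r c) = (\<Sum>i<d. real_of_int (a k (\<beta> i)) * f i)"
      by (simp add: sum_columns r_def)
    also have "\<dots> = real_of_int (\<Sum>i<d. a k (\<beta> i) * E i) / D - real_of_int (\<Sum>i<d. a k (\<beta> i) * q i)"
      by (simp add: f_def right_diff_distrib sum_subtractf sum_divide_distrib)
    also have "(\<Sum>i<d. a k (\<beta> i) * E i) = D * (\<Sum>j<m. a k (I j) * int (v j))"
      unfolding E_def by (rule tableau_combination[OF that])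
    finally show ?thesis
      using D_nz by (simp add: sum_columns z_def sum_negf)
  qed
  ultimately obtain w0 :: "nat \<Rightarrow> nat" where
    w0: "\<And>k. k < d \<Longrightarrow> (\<Sum>c<d + m. a k c * int (w0 c)) = (\<Sum>c<d + m. a k c * z c)"
    using assms unfolding normal_columns_def by meson
  \<comment> \<open>Multiplicities of zero columns are arbitrary and not controlled by
    \<open>lower_test\<close>, so they are reset to 0.\<close>
  define w where "w c = (if \<exists>k<d. a k c \<noteq> 0 then w0 c else 0)" for c
  have w: "(\<Sum>c<d + m. a k c * int (w c)) = (\<Sum>c<d + m. a k c * z c)" if "k < d" for k
    unfolding w0[OF that, symmetric] using that by (intro sum.cong) (auto simp: w_def)
  define u where "u j = w (I j)" for j
  define F where "F i = (\<Sum>j<m. T i (I j) * int (u j))" for i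
  \<comment> \<open>Two integer representations of one point are compared, and independence of the
    basis columns separates the coordinates.\<close>
  have key: "E i - F i = D * (int (w (\<beta> i)) + q i)" if "i < d" for i
  proof -
    have "E i - F i - D * (int (w (\<beta> i)) + q i) = 0"
    proof (rule tableau_independent[OF _ that])
      fix k assume "k < d"
      have "(\<Sum>i<d. a k (\<beta> i) * (E i - F i - D * (int (w (\<beta> i)) + q i))) =
        (\<Sum>i<d. a k (\<beta> i) * E i) - (\<Sum>i<d. a k (\<beta> i) * F i)
          - D * ((\<Sum>i<d. a k (\<beta> i) * int (w (\<beta> i))) + (\<Sum>i<d. a k (\<beta> i) * q i))"
        by (simp add: sum_subtractf sum.distrib sum_distrib_left algebra_simps)
      also have "\<dots> = D * ((\<Sum>c<d + m. a k c * z c) - (\<Sum>c<d + m. a k c * int (w c)))"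
        unfolding E_def F_def tableau_combination[OF \<open>k < d\<close>] sum_columns
        by (simp add: z_def u_def sum_negf algebra_simps)
      finally show "(\<Sum>i<d. a k (\<beta> i) * (E i - F i - D * (int (w (\<beta> i)) + q i))) = 0"
        using w[OF \<open>k < d\<close>] by simp
    qed
    then show ?thesis by simp
  qed
  have "good_representative I T D (\<lambda>j. int (v j)) u"
    unfolding good_representative_def
  proof (intro allI impI conjI)
    fix i assume i: "i < d"
    \<comment> \<open>The remainder contributes 0 to the floor, which is therefore minus the
      multiplicity of the basis column.\<close>
    have "F i = E i mod D + D * (- int (w (\<beta> i)))"
      using key[OF i] by (simp add: q_def minus_mult_div_eq_mod[symmetric] algebra_simps)
    then have "F i div D = - int (w (\<beta> i))"
      using D_nz by (simp only: div_mult_self2[OF D_nz] mod_div_trivial add_0_right)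
    then show "(\<Sum>j<m. T i (I j) * int (u j)) div D \<le> 0"
      by (simp add: F_def)
    have "(\<Sum>j<m. T i (I j) * (int (v j) - int (u j))) = E i - F i"
      by (simp add: E_def F_def sum_subtractf right_diff_distrib)
    then show "D dvd (\<Sum>j<m. T i (I j) * (int (v j) - int (u j)))"
      using key[OF i] by simp
  qed
  moreover have "u l \<le> d" if "l < m" for l
  proof -
    have fF: "f i = w (\<beta> i) + F i / D" if "i < d" for i
    proof -
      have "real_of_int (E i - F i) = real_of_int (D * (int (w (\<beta> i)) + q i))"
        using key[OF that] by simp
      then show ?thesis
        using D_nz by (simp add: f_def field_simps)
    qed
    \<comment> \<open>Lowness: a used column adds at least its multiplicity to the sum of the
      coordinates.\<close>
    have le: "real (u j) \<le> (\<Sum>i<d. T i (I j)) / D * u j" if "j < m" for j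
    proof (cases "u j = 0")
      case False
      then obtain k where k: "k < d" "a k (I j) \<noteq> 0"
        by (auto simp: u_def w_def split: if_splits)
      have "\<exists>i<d. T i (I j) \<noteq> 0"
      proof (rule ccontr)
        assume "\<not> ?thesis"
        then have "(\<Sum>i<d. a k (\<beta> i) * T i (I j)) = 0" by simp
        with tableau_eq[OF k(1) I_less[OF that]] k(2) D_nz show False by simp
      qed
      then have "1 \<le> (\<Sum>i<d. T i (I j)) div D"
        using low I_less[OF that] by (simp add: lower_test_def)
      then have "1 \<le> real_of_int (\<Sum>i<d. T i (I j)) / D"
        using real_floor_div(1)[of "\<Sum>i<d. T i (I j)" D] by linarith
      from mult_right_mono[OF this, of "u j"] show ?thesis by simp
    qed simp
    have "real (u l) \<le> (\<Sum>j<m. real (u j))"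
      using that by (intro member_le_sum) auto
    also have "\<dots> \<le> (\<Sum>j<m. (\<Sum>i<d. T i (I j)) / D * u j)"
      using le by (intro sum_mono) auto
    also have "\<dots> = (\<Sum>j<m. \<Sum>i<d. real_of_int (T i (I j)) * u j / D)"
      by (simp add: sum_divide_distrib sum_distrib_right)
    also have "\<dots> = (\<Sum>i<d. F i / D)"
      by (subst sum.swap) (simp add: F_def sum_divide_distrib)
    \<comment> \<open>The basis columns contribute nonnegatively to \<open>f\<close>, and each of
      the \<open>d\<close> values of \<open>f\<close> is below 1.\<close>
    also have "\<dots> \<le> (\<Sum>i<d. f i)"
      by (intro sum_mono) (simp add: fF)
    also have "\<dots> \<le> (\<Sum>i<d. 1)"
      using f(2) by (intro sum_mono) (simp add: less_imp_le)
    finally show ?thesis by simp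
  qed
  ultimately show "\<exists>u. (\<forall>j<m. u j \<le> d) \<and> good_representative I T D (\<lambda>j. int (v j)) u"
    by blast
qed

text \<open>An entry above \<open>d + 1\<close> is lowered by 1, the smaller vector is replaced by a
  representative with entries at most \<open>d\<close>, and the missing unit is added back; the
  result lies in the tested box. Integer vectors are first shifted to nonnegative ones.\<close>

lemma cover_test_imp_representative:
  assumes "cover_test I T D"
  shows "\<exists>u. good_representative I T D z u"
proof -
  have nat_case: "\<exists>u. (\<forall>j<m. u j \<le> d) \<and> good_representative I T D (\<lambda>j. int (v j)) u" for v :: "nat \<Rightarrow> nat"
  proof (induction "\<Sum>j<m. v j" arbitrary: v rule: less_induct)
    case less
    show ?case
    proof (cases "\<forall>j<m. v j \<le> Suc d")
      case True
      then show ?thesis using assms by (simp add: cover_test_def)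
    next
      case False
      then obtain l where l: "l < m" "Suc d < v l" by (auto simp: not_le)
      define v' where "v' = v(l := v l - 1)"
      have "(\<Sum>j<m. v' j) < (\<Sum>j<m. v j)"
        using l by (intro sum_strict_mono_ex1) (auto simp: v'_def)
      from less[OF this] obtain u' where u': "\<forall>j<m. u' j \<le> d"
        "good_representative I T D (\<lambda>j. int (v' j)) u'" by blast
      define v'' where "v'' = u'(l := u' l + 1)"
      have "\<forall>j<m. v'' j \<le> Suc d"
        using u'(1) by (auto simp: v''_def le_Suc_eq)
      then obtain u where u: "\<forall>j<m. u j \<le> d" "good_representative I T D (\<lambda>j. int (v'' j)) u"
        using assms by (auto simp: cover_test_def)
      have "D dvd (\<Sum>j<m. T i (I j) * (int (v j) - int (u j)))" if "i < d" for i
      proof -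
        have "int (v j) - int (u j) = (int (v' j) - int (u' j)) + (int (v'' j) - int (u j))" for j
          using l by (auto simp: v'_def v''_def)
        then have "(\<Sum>j<m. T i (I j) * (int (v j) - int (u j))) =
          (\<Sum>j<m. T i (I j) * (int (v' j) - int (u' j))) + (\<Sum>j<m. T i (I j) * (int (v'' j) - int (u j)))"
          by (simp only: distrib_left sum.distrib)
        then show ?thesis
          using u'(2) u(2) that by (simp add: good_representative_def)
      qed
      with u show ?thesis
        by (auto simp: good_representative_def)
    qed
  qed
  \<comment> \<open>\<open>D\<close> times a column is an integer combination of basis columns, so a
    shift by a multiple of \<open>D\<close> stays in the class;
    \<open>\<bar>D\<bar> * \<bar>z j\<bar>\<close> is large enough.\<close>
  define v where "v j = nat (z j + \<bar>D\<bar> * \<bar>z j\<bar>)" for j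
  have v: "int (v j) = z j + D * (sgn D * \<bar>z j\<bar>)" for j
  proof -
    have "\<bar>z j\<bar> \<le> \<bar>D\<bar> * \<bar>z j\<bar>"
      using D_nz mult_right_mono[of 1 "\<bar>D\<bar>" "\<bar>z j\<bar>"] by simp
    then have "int (v j) = z j + \<bar>D\<bar> * \<bar>z j\<bar>"
      by (simp add: v_def)
    then show ?thesis
      by (simp only: abs_sgn[of D] mult.assoc)
  qed
  obtain u where u: "good_representative I T D (\<lambda>j. int (v j)) u"
    using nat_case[of v] by blast
  have "D dvd (\<Sum>j<m. T i (I j) * (z j - int (u j)))" if "i < d" for i
  proof -
    have "(\<Sum>j<m. T i (I j) * (int (v j) - int (u j))) =
      (\<Sum>j<m. T i (I j) * (z j - int (u j))) + D * (\<Sum>j<m. T i (I j) * (sgn D * \<bar>z j\<bar>))"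
      by (simp add: v sum_distrib_left sum.distrib[symmetric] algebra_simps)
    moreover have "D dvd (\<Sum>j<m. T i (I j) * (int (v j) - int (u j)))"
      using u that by (simp add: good_representative_def)
    ultimately show ?thesis
      by (simp only: dvd_add_left_iff[OF dvd_triv_left])
  qed
  with u show ?thesis
    by (auto simp: good_representative_def)
qed

text \<open>\<open>\<omega> i\<close> is a nonnegative coordinate minus a number below 1, and it is
  an integer; so it is nonnegative and can serve as the multiplicity of a basis column.\<close>

lemma representative_imp_combination:
  assumes good: "good_representative I T D (\<lambda>j. z (I j)) u"
    and G: "basis \<beta> G"
    and pos: "\<And>i. i < d \<Longrightarrow> 0 \<le> coord G (\<lambda>k. real_of_int (\<Sum>c<d + m. a k c * z c)) i"
  shows "\<exists>w :: nat \<Rightarrow> nat. \<forall>k<d. (\<Sum>c<d + m. a k c * int (w c)) = (\<Sum>c<d + m. a k c * z c)"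
proof -
  define S where "S i = (\<Sum>j<m. T i (I j) * (z (I j) - int (u j)))" for i
  define F where "F i = (\<Sum>j<m. T i (I j) * int (u j))" for i
  define E where "E i = (\<Sum>j<m. T i (I j) * z (I j))" for i
  have SEF: "S i = E i - F i" for i
    by (simp add: S_def E_def F_def sum_subtractf right_diff_distrib)
  define \<omega> where "\<omega> i = z (\<beta> i) + S i div D" for i
  have D\<omega>: "D * \<omega> i = D * z (\<beta> i) + S i" if "i < d" for i
    using good that by (simp add: good_representative_def \<omega>_def S_def distrib_left)
  have "0 \<le> \<omega> i" if "i < d" for i
  proof -
    have "coord G (\<lambda>k. real_of_int (\<Sum>c<d + m. a k c * z c)) i = z (\<beta> i) + E i / D"
    proof (rule coord_unique[OF G that])
      fix k assume "k < d"
      have "(\<Sum>i<d. real_of_int (a k (\<beta> i)) * (real_of_int (z (\<beta> i)) + E i / D)) =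
        real_of_int (\<Sum>i<d. a k (\<beta> i) * z (\<beta> i)) + real_of_int (\<Sum>i<d. a k (\<beta> i) * E i) / D"
        by (simp add: distrib_left sum.distrib sum_divide_distrib)
      also have "(\<Sum>i<d. a k (\<beta> i) * E i) = D * (\<Sum>j<m. a k (I j) * z (I j))"
        unfolding E_def by (rule tableau_combination[OF \<open>k < d\<close>])
      finally show "(\<Sum>i<d. real_of_int (a k (\<beta> i)) * (real_of_int (z (\<beta> i)) + E i / D)) =
        real_of_int (\<Sum>c<d + m. a k c * z c)"
        using D_nz by (simp add: sum_columns)
    qed
    then have "0 \<le> z (\<beta> i) + E i / D"
      using pos[OF that] by simp
    moreover have "F i / D < 1"
    proof -
      have "F i div D \<le> 0"
        using good that by (simp add: good_representative_def F_def)
      then show ?thesis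
        using real_floor_div(2)[of "F i" D] by linarith
    qed
    moreover have "real_of_int (\<omega> i) = z (\<beta> i) + E i / D - F i / D"
    proof -
      have "real_of_int (D * \<omega> i) = real_of_int (D * z (\<beta> i) + (E i - F i))"
        using D\<omega>[OF that] SEF by simp
      then have "real_of_int (\<omega> i) = (D * z (\<beta> i) + (E i - F i)) / D"
        using D_nz by (simp add: eq_divide_eq mult.commute)
      then show ?thesis
        using D_nz by (simp add: add_divide_distrib diff_divide_distrib)
    qed
    ultimately show ?thesis by linarith
  qed
  note \<omega>_nonneg = this
  have "(\<Sum>c<d + m. a k c * int (glue (\<lambda>i. nat (\<omega> i)) u c)) = (\<Sum>c<d + m. a k c * z c)" if "k < d" for k
  proof -
    have "D * (\<Sum>i<d. a k (\<beta> i) * \<omega> i) = (\<Sum>i<d. a k (\<beta> i) * (D * \<omega> i))"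
      by (simp add: sum_distrib_left algebra_simps)
    also have "\<dots> = D * (\<Sum>i<d. a k (\<beta> i) * z (\<beta> i)) + (\<Sum>i<d. a k (\<beta> i) * S i)"
      by (simp add: D\<omega> sum_distrib_left distrib_left sum.distrib algebra_simps)
    also have "(\<Sum>i<d. a k (\<beta> i) * S i) = D * (\<Sum>j<m. a k (I j) * (z (I j) - int (u j)))"
      unfolding S_def by (rule tableau_combination[OF that])
    finally have "D * (\<Sum>i<d. a k (\<beta> i) * \<omega> i) =
        D * ((\<Sum>i<d. a k (\<beta> i) * z (\<beta> i)) + (\<Sum>j<m. a k (I j) * (z (I j) - int (u j))))"
      by (simp add: distrib_left)
    then have "(\<Sum>i<d. a k (\<beta> i) * \<omega> i) =
        (\<Sum>i<d. a k (\<beta> i) * z (\<beta> i)) + (\<Sum>j<m. a k (I j) * (z (I j) - int (u j)))"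
      using D_nz by simp
    then show ?thesis
      by (simp add: sum_columns \<omega>_nonneg sum_subtractf right_diff_distrib)
  qed
  then show ?thesis by blast
qed

end

text \<open>The covering theorem yields a lower basis whose cone contains the given point, and the
  test for the complement of this basis decomposes the point. \<open>I'\<close> may differ from
  \<open>I\<close> from \<open>m\<close> on because an index set will be given by the first
  \<open>m\<close> digits of a number.\<close>

lemma passes_imp_normal:
  assumes pass: "\<And>I. (\<forall>j<m. I j < d + m) \<Longrightarrow> \<exists>I'. (\<forall>j<m. I' j = I j) \<and>
    (dependent_outside I' \<or> (\<exists>\<beta> T D. tableau I' \<beta> T D \<and> passes I' T D))"
  shows normal_columns
  unfolding normal_columns_def
proof (intro allI impI)
  fix z :: "nat \<Rightarrow> int" and r :: "nat \<Rightarrow> real"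
  assume r: "\<forall>j<d + m. 0 \<le> r j"
    and rz: "\<forall>k<d. (\<Sum>j<d + m. real_of_int (a k j) * r j) = real_of_int (\<Sum>j<d + m. a k j * z j)"
  obtain \<tau> H where "basis \<tau> H"
    using full_rank by blast
  then have "\<exists>\<beta> G. basis \<beta> G \<and> (\<forall>i<d. 0 \<le> coord G (\<lambda>k. \<Sum>j<d + m. real_of_int (a k j) * r j) i) \<and> lower G"
    by (rule cone_covered_by_lower_bases[rotated]) (use r nonneg in auto)
  then obtain \<beta>0 G0 where B0: "basis \<beta>0 G0"
    "\<forall>i<d. 0 \<le> coord G0 (\<lambda>k. \<Sum>j<d + m. real_of_int (a k j) * r j) i" "lower G0" by blast
  have inj0: "inj_on \<beta>0 {..<d}"
  proof (rule inj_onI)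
    fix i l assume "i \<in> {..<d}" "l \<in> {..<d}" "\<beta>0 i = \<beta>0 l"
    then show "i = l"
      using coord_basis[OF B0(1), of i i] coord_basis[OF B0(1), of i l] by (auto split: if_splits)
  qed
  define S where "S = \<beta>0 ` {..<d}"
  have S: "S \<subseteq> {..<d + m}" "card S = d"
    using basis_less[OF B0(1)] inj0 by (auto simp: S_def card_image)
  then have "card ({..<d + m} - S) = m"
    by (subst card_Diff_subset) (auto intro: finite_subset)
  then obtain I where I: "bij_betw I {..<m} ({..<d + m} - S)"
    using ex_bij_betw_nat_finite[of "{..<d + m} - S"] by (auto simp: atLeast0LessThan)
  then have "\<forall>j<m. I j < d + m"
    by (auto dest: bij_betwE)
  from pass[OF this] obtain I' where I': "\<forall>j<m. I' j = I j"
    "dependent_outside I' \<or> (\<exists>\<beta> T D. tableau I' \<beta> T D \<and> passes I' T D)" by blast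
  have im: "I' ` {..<m} = {..<d + m} - S"
    using I I'(1) by (auto simp: bij_betw_def)
  then have less: "I' j < d + m" if "j < m" for j
    using that by blast
  \<comment> \<open>The columns outside of \<open>I'\<close> are those of \<open>\<beta>0\<close>,
    which are independent.\<close>
  have "\<not> dependent_outside I'"
  proof
    assume "dependent_outside I'"
    then obtain y :: "nat \<Rightarrow> int" and j where y: "j < d + m" "y j \<noteq> 0" "\<forall>j<m. y (I' j) = 0"
      "\<forall>k<d. (\<Sum>j<d + m. a k j * y j) = 0"
      by (auto simp: dependent_outside_def)
    have off: "y c = 0" if "c < d + m" "c \<notin> S" for c
    proof -
      have "c \<in> I' ` {..<m}" using that im by simp
      then show ?thesis using y(3) by auto
    qed
    have "coord G0 (\<lambda>k. 0) i = real_of_int (y (\<beta>0 i))" if "i < d" for i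
    proof (rule coord_unique[OF B0(1) that])
      fix k assume "k < d"
      have "(\<Sum>i<d. a k (\<beta>0 i) * y (\<beta>0 i)) = (\<Sum>c\<in>S. a k c * y c)"
        by (simp add: S_def sum.reindex[OF inj0])
      also have "\<dots> = (\<Sum>c<d + m. a k c * y c)"
        using S(1) off by (intro sum.mono_neutral_left) auto
      finally have "real_of_int (\<Sum>i<d. a k (\<beta>0 i) * y (\<beta>0 i)) = 0"
        using y(4) \<open>k < d\<close> by simp
      then show "(\<Sum>i<d. real_of_int (a k (\<beta>0 i)) * real_of_int (y (\<beta>0 i))) = 0"
        by simp
    qed
    then have "y c = 0" if "c \<in> S" for c
      using that by (auto simp: S_def coord_def)
    with off y(1,2) show False by blast
  qed
  with I'(2) obtain \<beta> T D where tab: "tableau I' \<beta> T D" and "passes I' T D" by blast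
  have im_\<beta>: "\<beta> ` {..<d} = S"
    using image_\<beta>[OF tab less] im S(1) by auto
  obtain G where G: "basis \<beta> G"
    using tableau_basis[OF tab less] by blast
  \<comment> \<open>The tableau may list the same columns in another order. Coordinates agree up to
    this permutation, and their sum is unaffected.\<close>
  define \<sigma> where "\<sigma> i = inv_into {..<d} \<beta>0 (\<beta> i)" for i
  have \<sigma>: "\<sigma> i < d" "\<beta>0 (\<sigma> i) = \<beta> i" if "i < d" for i
  proof -
    have "\<beta> i \<in> \<beta>0 ` {..<d}"
      using im_\<beta> that by (auto simp: S_def)
    from inv_into_into[OF this] f_inv_into_f[OF this] show "\<sigma> i < d" "\<beta>0 (\<sigma> i) = \<beta> i"
      unfolding \<sigma>_def by simp_all
  qed
  have "inj_on \<sigma> {..<d}"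
    using inj_\<beta>[OF tab less] \<sigma>(2) by (metis (mono_tags, lifting) inj_onD inj_onI lessThan_iff)
  then have bij_\<sigma>: "bij_betw \<sigma> {..<d} {..<d}"
    using \<sigma>(1) by (intro bij_betw_imageI endo_inj_surj) auto
  have coord_\<sigma>: "coord G y i = coord G0 y (\<sigma> i)" if "i < d" for y i
  proof (rule coord_unique[OF G that])
    fix k assume "k < d"
    have "(\<Sum>i<d. real_of_int (a k (\<beta> i)) * coord G0 y (\<sigma> i)) =
        (\<Sum>i<d. real_of_int (a k (\<beta>0 (\<sigma> i))) * coord G0 y (\<sigma> i))"
      using \<sigma>(2) by (intro sum.cong) auto
    also have "\<dots> = (\<Sum>i<d. real_of_int (a k (\<beta>0 i)) * coord G0 y i)"
      by (rule sum.reindex_bij_betw[OF bij_\<sigma>])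
    finally show "(\<Sum>i<d. real_of_int (a k (\<beta> i)) * coord G0 y (\<sigma> i)) = y k"
      using coord_expand[OF B0(1) \<open>k < d\<close>] by simp
  qed
  have "lower_test T D"
    unfolding lower_test_def
  proof (intro allI impI)
    fix j assume j: "j < d + m" "\<exists>i<d. T i j \<noteq> 0"
    have "\<exists>k<d. real_of_int (a k j) \<noteq> 0"
    proof (rule ccontr)
      assume "\<not> ?thesis"
      then have "coord G (\<lambda>k. real_of_int (a k j)) i = 0" for i
        by (simp add: coord_def)
      then show False
        using tableau_coord[OF tab less G _ j(1)] j(2) D_nz[OF tab less] by auto
    qed
    then have "1 \<le> (\<Sum>i<d. coord G0 (\<lambda>k. real_of_int (a k j)) i)"
      using B0(3) j(1) by (simp add: lower_def)
    also have "\<dots> = (\<Sum>i<d. coord G0 (\<lambda>k. real_of_int (a k j)) (\<sigma> i))"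
      by (rule sum.reindex_bij_betw[OF bij_\<sigma>, symmetric])
    also have "\<dots> = (\<Sum>i<d. T i j / D)"
      using tableau_coord[OF tab less G _ j(1)] coord_\<sigma> by (intro sum.cong) auto
    also have "\<dots> = real_of_int (\<Sum>i<d. T i j) / D"
      by (simp add: sum_divide_distrib)
    finally show "1 \<le> (\<Sum>i<d. T i j) div D"
      using real_floor_div(2)[of "\<Sum>i<d. T i j" D] by linarith
  qed
  then obtain u where "good_representative I' T D (\<lambda>j. z (I' j)) u"
    using \<open>passes I' T D\<close> cover_test_imp_representative[OF tab less] unfolding passes_def by blast
  moreover have "0 \<le> coord G (\<lambda>k. real_of_int (\<Sum>c<d + m. a k c * z c)) i" if "i < d" for i
  proof -
    have "coord G (\<lambda>k. real_of_int (\<Sum>c<d + m. a k c * z c)) i =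
        coord G0 (\<lambda>k. \<Sum>j<d + m. real_of_int (a k j) * r j) (\<sigma> i)"
      unfolding coord_\<sigma>[OF that] using rz by (intro coord_cong) simp
    then show ?thesis
      using B0(2) \<sigma>(1)[OF that] by simp
  qed
  ultimately show "\<exists>w :: nat \<Rightarrow> nat. \<forall>k<d. (\<Sum>j<d + m. a k j * int (w j)) = (\<Sum>j<d + m. a k j * z j)"
    using representative_imp_combination[OF tab less _ G] by blast
qed

end

section \<open>Fraction-free pivoting\<close>

text \<open>Expansion along column \<open>k\<close>: the cofactors do not depend on the entries of
  that column.\<close>

lemma det_replace_col_smult:
  fixes A :: "'a :: comm_ring_1 mat"
  assumes A: "A \<in> carrier_mat d d" and "k < d"
  shows "det (replace_col A (vec d (\<lambda>i. c * y i)) k) = c * det (replace_col A (vec d y) k)"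
proof -
  have car: "replace_col A v k \<in> carrier_mat d d" for v
    using A by (simp add: replace_col_def)
  have del: "mat_delete (replace_col A v k) i k = mat_delete (replace_col A w k) i k" if "i < d" for i v w
    using A that \<open>k < d\<close> by (intro eq_matI) (auto simp: mat_delete_def replace_col_def)
  have cof: "cofactor (replace_col A v k) i k = cofactor (replace_col A w k) i k" if "i < d" for i v w
    unfolding cofactor_def del[OF that, of v w] by (rule refl)
  have entry: "replace_col A v k $$ (i, k) = v $ i" if "i < d" for i v
    using A that \<open>k < d\<close> by (simp add: replace_col_def)
  show ?thesis
    unfolding laplace_expansion_column[OF car \<open>k < d\<close>] sum_distrib_left
  proof (rule sum.cong[OF refl])
    fix i assume "i \<in> {..<d}"
    then have i: "i < d" by simp
    show "replace_col A (vec d (\<lambda>i. c * y i)) k $$ (i, k) * cofactor (replace_col A (vec d (\<lambda>i. c * y i)) k) i k =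
        c * (replace_col A (vec d y) k $$ (i, k) * cofactor (replace_col A (vec d y) k) i k)"
      unfolding entry[OF i] cof[OF i, of "vec d (\<lambda>i. c * y i)" "vec d y"] using i by (simp add: mult.assoc)
  qed
qed

text \<open>Cramer's rule without division; the factor \<open>c\<close> accommodates equations that
  carry a common denominator.\<close>

lemma cramer_scaled:
  fixes B :: "'a :: comm_ring_1 mat"
  assumes B: "B \<in> carrier_mat d d" and "r < d"
    and eq: "\<And>k. k < d \<Longrightarrow> (\<Sum>i<d. B $$ (k, i) * x i) = c * y k"
  shows "c * det (replace_col B (vec d y) r) = x r * det B"
proof -
  have "B *\<^sub>v vec d x = vec d (\<lambda>k. c * y k)"
    using B eq by (intro eq_vecI) (auto simp: scalar_prod_def atLeast0LessThan)
  then show ?thesis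
    using cramer_lemma_mat[OF B, of "vec d x" r] \<open>r < d\<close> det_replace_col_smult[OF B \<open>r < d\<close>] by simp
qed

text \<open>The Leibniz formula has \<open>fact d\<close> terms. The bound is coarse, but its bit
  length is polynomial.\<close>

lemma abs_det_le:
  fixes A :: "int mat"
  assumes A: "A \<in> carrier_mat d d" and le: "\<And>i j. i < d \<Longrightarrow> j < d \<Longrightarrow> \<bar>A $$ (i, j)\<bar> \<le> M"
  shows "\<bar>det A\<bar> \<le> fact d * M ^ d"
proof -
  have "\<bar>det A\<bar> \<le> (\<Sum>p | p permutes {0..<d}. \<bar>signof p * (\<Prod>i = 0..<d. A $$ (i, p i))\<bar>)"
    unfolding det_def'[OF A] by (rule sum_abs)
  also have "\<dots> \<le> (\<Sum>p | p permutes {0..<d}. M ^ d)"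
  proof (rule sum_mono)
    fix p assume "p \<in> {p. p permutes {0..<d}}"
    then have p: "p i < d" if "i < d" for i
      using that permutes_in_image[of p "{0..<d}" i] by simp
    have "\<bar>signof p * (\<Prod>i = 0..<d. A $$ (i, p i))\<bar> = (\<Prod>i = 0..<d. \<bar>A $$ (i, p i)\<bar>)"
      by (simp add: abs_mult abs_prod sign_def)
    also have "\<dots> \<le> (\<Prod>i = 0..<d. M)"
      using le p by (intro prod_mono) auto
    finally show "\<bar>signof p * (\<Prod>i = 0..<d. A $$ (i, p i))\<bar> \<le> M ^ d"
      by simp
  qed
  also have "\<dots> = fact d * M ^ d"
    by (simp add: card_permutations[of "{0..<d}" d])
  finally show ?thesis .
qed

section \<open>Edmonds-Bareiss elimination\<close>

locale int_columns =
  fixes d n :: nat and a :: "nat \<Rightarrow> nat \<Rightarrow> int"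
begin

text \<open>Positions without a pivot hold unit vectors, so the matrix is square at every stage of
  the elimination.\<close>

definition basis_matrix :: "(nat \<Rightarrow> nat) \<Rightarrow> nat set \<Rightarrow> int mat" where
  "basis_matrix \<beta> U = mat d d (\<lambda>(k, i). if i \<in> U then a k (\<beta> i) else if k = i then 1 else 0)"

text \<open>\<open>D\<close> is required to be the determinant and not just some common denominator;
  this is what keeps the entries small and the divisions exact.\<close>

definition partial_tableau ::
  "(nat \<Rightarrow> nat) \<Rightarrow> nat set \<Rightarrow> (nat \<Rightarrow> nat \<Rightarrow> int) \<Rightarrow> int \<Rightarrow> bool" where
  "partial_tableau \<beta> U T D \<longleftrightarrow> U \<subseteq> {..<d} \<and> (\<forall>i\<in>U. \<beta> i < n) \<and>
    det (basis_matrix \<beta> U) = D \<and> D \<noteq> 0 \<and>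
    (\<forall>k<d. \<forall>j<n. (\<Sum>i<d. basis_matrix \<beta> U $$ (k, i) * T i j) = D * a k j)"

lemma basis_matrix_carrier [simp]: "basis_matrix \<beta> U \<in> carrier_mat d d"
  by (simp add: basis_matrix_def)

lemma partial_tableau_empty: "partial_tableau \<beta> {} a 1"
proof -
  have "basis_matrix \<beta> {} = 1\<^sub>m d"
    by (intro eq_matI) (auto simp: basis_matrix_def)
  moreover have "(\<Sum>i<d. (if k = i then 1 else 0) * a i j) = a k j" if "k < d" for k j
    using that by (subst sum.cong[OF refl, of _ _ "\<lambda>i. if k = i then a i j else 0"]) auto
  ultimately show ?thesis
    by (simp add: partial_tableau_def basis_matrix_def)
qed

text \<open>By Cramer's rule all entries of a tableau are determinants.\<close>

lemma partial_tableau_bound: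
  assumes tab: "partial_tableau \<beta> U T D" and "1 \<le> M"
    and le: "\<And>k j. k < d \<Longrightarrow> j < n \<Longrightarrow> \<bar>a k j\<bar> \<le> M"
  shows "\<bar>D\<bar> \<le> fact d * M ^ d" "i < d \<Longrightarrow> j < n \<Longrightarrow> \<bar>T i j\<bar> \<le> fact d * M ^ d"
proof -
  let ?B = "basis_matrix \<beta> U"
  have B: "\<bar>?B $$ (k, l)\<bar> \<le> M" if "k < d" "l < d" for k l
    using that tab le \<open>1 \<le> M\<close> by (auto simp: basis_matrix_def partial_tableau_def)
  then show "\<bar>D\<bar> \<le> fact d * M ^ d"
    using tab abs_det_le[of ?B d M] by (auto simp: partial_tableau_def)
  assume ij: "i < d" "j < n"
  have "D * det (replace_col ?B (vec d (\<lambda>k. a k j)) i) = T i j * det ?B"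
    using tab ij by (intro cramer_scaled) (auto simp: partial_tableau_def)
  then have "T i j = det (replace_col ?B (vec d (\<lambda>k. a k j)) i)"
    using tab by (auto simp: partial_tableau_def)
  moreover have "\<bar>det (replace_col ?B (vec d (\<lambda>k. a k j)) i)\<bar> \<le> fact d * M ^ d"
    by (rule abs_det_le) (use B ij le in \<open>auto simp: replace_col_def basis_matrix_def\<close>)
  ultimately show "\<bar>T i j\<bar> \<le> fact d * M ^ d"
    by simp
qed

text \<open>The Edmonds-Bareiss update: the pivot row is left undivided, and the pivot entry becomes
  the new denominator.\<close>

definition pivot :: "nat \<Rightarrow> nat \<Rightarrow> (nat \<Rightarrow> nat \<Rightarrow> int) \<Rightarrow> int \<Rightarrow> nat \<Rightarrow> nat \<Rightarrow> int" where
  "pivot r c T D i j = (if i = r then T r j else (T r c * T i j - T i c * T r j) div D)"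

text \<open>
  The divisions are exact: \<open>D\<close> times the tableau of the new basis, which is integral because
  it is the adjugate times the matrix, has the numerators as its entries.
\<close>

lemma partial_tableau_pivot:
  assumes tab: "partial_tableau \<beta> U T D" and r: "r < d" "r \<notin> U" and c: "c < n" and nz: "T r c \<noteq> 0"
  shows "partial_tableau (\<beta>(r := c)) (insert r U) (pivot r c T D) (T r c)"
proof -
  let ?B = "basis_matrix \<beta> U" and ?B' = "basis_matrix (\<beta>(r := c)) (insert r U)"
  from tab have D: "det ?B = D" "D \<noteq> 0" "\<And>i. i \<in> U \<Longrightarrow> \<beta> i < n" "U \<subseteq> {..<d}"
    and eq: "\<And>k j. k < d \<Longrightarrow> j < n \<Longrightarrow> (\<Sum>i<d. ?B $$ (k, i) * T i j) = D * a k j"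
    by (auto simp: partial_tableau_def)
  have "replace_col ?B (vec d (\<lambda>k. a k c)) r = ?B'"
    by (intro eq_matI) (auto simp: replace_col_def basis_matrix_def)
  \<comment> \<open>Cramer's rule identifies the pivot entry as the determinant of the exchanged
    matrix.\<close>
  moreover have "D * det (replace_col ?B (vec d (\<lambda>k. a k c)) r) = T r c * det ?B"
    using eq c r by (intro cramer_scaled) auto
  ultimately have det': "det ?B' = T r c"
    using D by simp
  have col: "?B' $$ (k, i) = ?B $$ (k, i)" if "k < d" "i < d" "i \<noteq> r" for k i
    using that by (simp add: basis_matrix_def)
  have col_r: "?B' $$ (k, r) = a k c" if "k < d" for k
    using that r by (simp add: basis_matrix_def)
  \<comment> \<open>\<open>D\<close> times the new tableau, that is, the numerators before
    division.\<close>
  define Y where "Y i j = (if i = r then D * T r j else T r c * T i j - T i c * T r j)" for i j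
  have Y: "(\<Sum>i<d. ?B' $$ (k, i) * Y i j) = D * (T r c * a k j)" if kj: "k < d" "j < n" for k j
  proof -
    have "(\<Sum>i<d. ?B' $$ (k, i) * Y i j) =
        a k c * (D * T r j) + (\<Sum>i\<in>{..<d} - {r}. ?B $$ (k, i) * (T r c * T i j - T i c * T r j))"
      using r kj by (subst sum.remove[of _ r]) (auto simp: col col_r Y_def intro!: sum.cong)
    also have "(\<Sum>i\<in>{..<d} - {r}. ?B $$ (k, i) * (T r c * T i j - T i c * T r j)) =
        (\<Sum>i<d. ?B $$ (k, i) * (T r c * T i j - T i c * T r j))"
      using r by (subst (2) sum.remove[of _ r]) auto
    also have "\<dots> = T r c * (\<Sum>i<d. ?B $$ (k, i) * T i j) - T r j * (\<Sum>i<d. ?B $$ (k, i) * T i c)"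
      by (simp add: sum_distrib_left sum_subtractf algebra_simps)
    also have "\<dots> = D * (T r c * a k j) - D * T r j * a k c"
      unfolding eq[OF kj] eq[OF kj(1) c] by (simp add: algebra_simps)
    also have "a k c * (D * T r j) + (D * (T r c * a k j) - D * T r j * a k c) = D * (T r c * a k j)"
      by (simp add: algebra_simps)
    finally show ?thesis .
  qed
  \<comment> \<open>Cramer's rule for the new matrix presents \<open>Y i j\<close> as
    \<open>D\<close> times a determinant.\<close>
  have dvd: "D dvd Y i j" if ij: "i < d" "j < n" for i j
  proof -
    have "(D * T r c) * det (replace_col ?B' (vec d (\<lambda>k. a k j)) i) = Y i j * det ?B'"
      using Y ij by (intro cramer_scaled) (auto simp: mult.assoc)
    then have "Y i j = D * det (replace_col ?B' (vec d (\<lambda>k. a k j)) i)"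
      using nz by (simp add: det' mult.commute mult.left_commute)
    then show ?thesis by simp
  qed
  have piv: "D * pivot r c T D i j = Y i j" if "i < d" "j < n" for i j
    using dvd[OF that] by (auto simp: pivot_def Y_def)
  have "(\<Sum>i<d. ?B' $$ (k, i) * pivot r c T D i j) = T r c * a k j" if kj: "k < d" "j < n" for k j
  proof -
    have "D * (\<Sum>i<d. ?B' $$ (k, i) * pivot r c T D i j) = (\<Sum>i<d. ?B' $$ (k, i) * Y i j)"
      unfolding sum_distrib_left using kj by (intro sum.cong) (auto simp: piv[symmetric])
    with Y[OF kj] D(2) show ?thesis by simp
  qed
  with det' nz D(3,4) r c show ?thesis
    by (auto simp: partial_tableau_def)
qed

end

section \<open>The program\<close>

definition digit :: "nat \<Rightarrow> nat \<Rightarrow> nat \<Rightarrow> nat" where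
  "digit b j x = x div b ^ j mod b"

text \<open>Lets a single counter below \<open>b ^ m\<close> run through all vectors of length
  \<open>m\<close>.\<close>

lemma ex_digits:
  assumes "\<forall>j<m. f j < b"
  shows "\<exists>x<b ^ m. \<forall>j<m. digit b j x = f j"
  using assms
proof (induction m arbitrary: f)
  case (Suc m)
  then have "\<forall>j<m. f (Suc j) < b"
    by simp
  from Suc.IH[OF this] obtain x where x: "x < b ^ m" "\<forall>j<m. digit b j x = f (Suc j)"
    by blast
  have f0: "f 0 < b"
    using Suc.prems by simp
  have "f 0 + b * x < b * Suc x"
    using f0 by simp
  also have "\<dots> \<le> b * b ^ m"
    using x(1) by (intro mult_le_mono2) simp
  finally have "f 0 + b * x < b ^ Suc m"
    by simp
  moreover have "digit b j (f 0 + b * x) = f j" if "j < Suc m" for j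
  proof (cases j)
    case 0
    then show ?thesis using f0 by (simp add: digit_def)
  next
    case (Suc i)
    have "(f 0 + b * x) div b ^ Suc i = (f 0 + b * x) div b div b ^ i"
      by (simp add: div_mult2_eq)
    also have "(f 0 + b * x) div b = x"
      using f0 by simp
    finally show ?thesis
      using x(2) Suc that by (simp add: digit_def)
  qed
  ultimately show ?case by blast
qed simp

text \<open>Since \<open>m\<close> is fixed, powers, sums and products of length \<open>m\<close>
  are unrolled into expressions.\<close>

fun power_exp :: "ram_exp \<Rightarrow> nat \<Rightarrow> ram_exp" where
  "power_exp e 0 = Const 1"
| "power_exp e (Suc k) = Times e (power_exp e k)"

lemma exp_val_power_exp [simp]: "exp_val (power_exp e k) s = exp_val e s ^ k"
  by (induction k) simp_all

fun sum_exp :: "(nat \<Rightarrow> ram_exp) \<Rightarrow> nat \<Rightarrow> ram_exp" where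
  "sum_exp f 0 = Const 0"
| "sum_exp f (Suc k) = Plus (sum_exp f k) (f k)"

lemma exp_val_sum_exp [simp]: "exp_val (sum_exp f k) s = (\<Sum>j<k. exp_val (f j) s)"
  by (induction k) simp_all

fun prod_exp :: "(nat \<Rightarrow> ram_exp) \<Rightarrow> nat \<Rightarrow> ram_exp" where
  "prod_exp f 0 = Const 1"
| "prod_exp f (Suc k) = Times (prod_exp f k) (f k)"

lemma exp_val_prod_exp [simp]: "exp_val (prod_exp f k) s = (\<Prod>j<k. exp_val (f j) s)"
  by (induction k) simp_all

definition digit_exp :: "ram_exp \<Rightarrow> nat \<Rightarrow> ram_exp \<Rightarrow> ram_exp" where
  "digit_exp b j e = Minus (Quot e (power_exp b j)) (Times b (Quot e (power_exp b (Suc j))))"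

lemma exp_val_digit_exp:
  assumes "exp_val b s = int b'" "exp_val e s = int x"
  shows "exp_val (digit_exp b j e) s = int (digit b' j x)"
proof -
  have "exp_val (digit_exp b j e) s = int (x div b' ^ j) - int (b' * (x div b' ^ Suc j))"
    using assms by (simp only: digit_exp_def exp_val.simps exp_val_power_exp of_nat_mult zdiv_int of_nat_power)
  also have "x div b' ^ Suc j = x div b' ^ j div b'"
    by (simp only: power_Suc2 div_mult2_eq)
  also have "int (x div b' ^ j) - int (b' * (x div b' ^ j div b')) = int (digit b' j x)"
    by (simp add: digit_def minus_mult_div_eq_mod zmod_int zdiv_int)
  finally show ?thesis .
qed

text \<open>Tests of the machine succeed on positive values only; squaring makes them test for being
  nonzero.\<close>

definition square_exp :: "ram_exp \<Rightarrow> ram_exp" where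
  "square_exp e = Times e e"

lemma exp_val_square_exp_pos [simp]: "0 < exp_val (square_exp e) s \<longleftrightarrow> exp_val e s \<noteq> 0"
  by (auto simp: square_exp_def zero_less_mult_iff)

abbreviation "reg r \<equiv> Mem (Const r)"
abbreviation "rows_exp \<equiv> Mem (Const 0)"
abbreviation "cols_exp \<equiv> Mem (Const 1)"

text \<open>
  Registers are the cells at negative addresses. The digits of \<open>rK\<close> in base \<open>n\<close> are the columns left
  out of the basis, \<open>rD\<close> is the determinant of the basis, \<open>rX\<close> is set when the columns fail to be a
  basis or the basis is not lower, \<open>rV\<close> and \<open>rU\<close> encode multiplicity vectors in base \<open>d + 2\<close> and
  \<open>d + 1\<close>, and \<open>rY\<close> holds the verdict.
\<close>

abbreviation (input) rK :: int where "rK \<equiv> - 1"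
abbreviation (input) rC :: int where "rC \<equiv> - 2"
abbreviation (input) rR :: int where "rR \<equiv> - 3"
abbreviation (input) rI :: int where "rI \<equiv> - 4"
abbreviation (input) rJ :: int where "rJ \<equiv> - 5"
abbreviation (input) rD :: int where "rD \<equiv> - 6"
abbreviation (input) rP :: int where "rP \<equiv> - 7"
abbreviation (input) rQ :: int where "rQ \<equiv> - 8"
abbreviation (input) rX :: int where "rX \<equiv> - 9"
abbreviation (input) rV :: int where "rV \<equiv> - 10"
abbreviation (input) rU :: int where "rU \<equiv> - 11"
abbreviation (input) rO :: int where "rO \<equiv> - 12"
abbreviation (input) rF :: int where "rF \<equiv> - 13"
abbreviation (input) rY :: int where "rY \<equiv> - 14"
abbreviation (input) rS :: int where "rS \<equiv> - 15"
abbreviation (input) rZ :: int where "rZ \<equiv> - 16"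

text \<open>The tableau is stored behind the input, and the flags of the rows that have a pivot
  behind the tableau.\<close>

definition tab_addr :: "ram_exp \<Rightarrow> ram_exp \<Rightarrow> ram_exp" where
  "tab_addr i j = Plus (Plus (Const 2) (Times rows_exp cols_exp)) (Plus (Times i cols_exp) j)"

definition used_addr :: "ram_exp \<Rightarrow> ram_exp" where
  "used_addr i = Plus (Plus (Const 2) (Times (Const 2) (Times rows_exp cols_exp))) i"

definition column_exp :: "nat \<Rightarrow> ram_exp" where
  "column_exp j = digit_exp cols_exp j (reg rK)"

definition outside_exp :: "nat \<Rightarrow> ram_exp" where
  "outside_exp m = prod_exp (\<lambda>j. square_exp (Minus (reg rC) (column_exp j))) m"

definition copy_prog :: ram_prog where
  "copy_prog = For rI (Times rows_exp cols_exp)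
    (Store (Plus (Plus (Const 2) (Times rows_exp cols_exp)) (reg rI)) (Mem (Plus (Const 2) (reg rI))))"

definition clear_prog :: ram_prog where
  "clear_prog = For rI rows_exp (Store (used_addr (reg rI)) (Const 0))"

text \<open>There is no early exit: the last admissible row wins, and -1 reports that there is
  none.\<close>

definition find_prog :: ram_prog where
  "find_prog = Seq (Store (Const rR) (Const (- 1))) (For rI rows_exp
    (Cond (Times (Minus (Const 1) (Mem (used_addr (reg rI)))) (square_exp (Mem (tab_addr (reg rI) (reg rC)))))
      (Store (Const rR) (reg rI)) Skip))"

text \<open>The entry in the pivot column is saved in \<open>rQ\<close> because the loop overwrites
  it before the row is finished.\<close>

definition row_prog :: ram_prog where
  "row_prog = Seq (Store (Const rQ) (Mem (tab_addr (reg rI) (reg rC)))) (For rJ cols_exp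
    (Store (tab_addr (reg rI) (reg rJ))
      (Quot (Minus (Times (reg rP) (Mem (tab_addr (reg rI) (reg rJ))))
        (Times (reg rQ) (Mem (tab_addr (reg rR) (reg rJ))))) (reg rD))))"

definition pivot_prog :: ram_prog where
  "pivot_prog = Seq (Store (Const rP) (Mem (tab_addr (reg rR) (reg rC))))
    (Seq (For rI rows_exp (Cond (square_exp (Minus (reg rI) (reg rR))) row_prog Skip))
    (Seq (Store (Const rD) (reg rP)) (Store (used_addr (reg rR)) (Const 1))))"

text \<open>A missing pivot only sets \<open>rX\<close> and the loop goes on, so that its number of
  rounds is always \<open>n\<close>.\<close>

definition eliminate_prog :: "nat \<Rightarrow> ram_prog" where
  "eliminate_prog m = For rC cols_exp (Cond (outside_exp m)
    (Seq find_prog (Cond (Plus (reg rR) (Const 1)) pivot_prog (Store (Const rX) (Const 1)))) Skip)"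

definition lower_prog :: ram_prog where
  "lower_prog = For rJ cols_exp (Seq (Store (Const rS) (Const 0)) (Seq (Store (Const rZ) (Const 0)) (Seq
    (For rI rows_exp (Seq (Store (Const rS) (Plus (reg rS) (Mem (tab_addr (reg rI) (reg rJ)))))
      (Cond (square_exp (Mem (tab_addr (reg rI) (reg rJ)))) (Store (Const rZ) (Const 1)) Skip)))
    (Cond (Times (reg rZ) (Minus (Const 1) (Quot (reg rS) (reg rD)))) (Store (Const rX) (Const 1)) Skip))))"

definition floor_exp :: "nat \<Rightarrow> ram_exp" where
  "floor_exp m = Quot (sum_exp (\<lambda>j. Times (Mem (tab_addr (reg rI) (column_exp j)))
    (digit_exp (Plus rows_exp (Const 1)) j (reg rU))) m) (reg rD)"

definition difference_exp :: "nat \<Rightarrow> ram_exp" where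
  "difference_exp m = sum_exp (\<lambda>j. Times (Mem (tab_addr (reg rI) (column_exp j)))
    (Minus (digit_exp (Plus rows_exp (Const 2)) j (reg rV)) (digit_exp (Plus rows_exp (Const 1)) j (reg rU)))) m"

definition representative_prog :: "nat \<Rightarrow> ram_prog" where
  "representative_prog m = Seq (Store (Const rO) (Const 1)) (For rI rows_exp (Seq
    (Cond (floor_exp m) (Store (Const rO) (Const 0)) Skip)
    (Cond (square_exp (Minus (difference_exp m) (Times (reg rD) (Quot (difference_exp m) (reg rD)))))
      (Store (Const rO) (Const 0)) Skip)))"

definition cover_prog :: "nat \<Rightarrow> ram_prog" where
  "cover_prog m = For rV (power_exp (Plus rows_exp (Const 2)) m) (Seq (Store (Const rF) (Const 0)) (Seq
    (For rU (power_exp (Plus rows_exp (Const 1)) m)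
      (Seq (representative_prog m) (Cond (reg rO) (Store (Const rF) (Const 1)) Skip)))
    (Cond (reg rF) Skip (Store (Const rY) (Const 0)))))"

text \<open>Cell 0 holds the number of rows during the whole computation and receives the verdict at
  the very end.\<close>

definition normality_prog :: "nat \<Rightarrow> ram_prog" where
  "normality_prog m = Seq (Store (Const rY) (Const 1)) (Seq
    (For rK (power_exp cols_exp m) (Seq (Store (Const rX) (Const 0)) (Seq (Store (Const rD) (Const 1))
      (Seq copy_prog (Seq clear_prog (Seq (eliminate_prog m) (Seq lower_prog
        (Cond (reg rX) Skip (cover_prog m)))))))))
    (Store (Const 0) (reg rY)))"

section \<open>Correctness of the program\<close>

text \<open>Loops run to \<open>d\<close>, \<open>n\<close>, \<open>d * n\<close>,
  \<open>n ^ m\<close>, \<open>(d + 1) ^ m\<close> or \<open>(d + 2) ^ m\<close>, all at most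
  \<open>L\<close>. \<open>W_ge\<close> leaves room for determinants and for column sums of them;
  values inside an expression may be longer, which \<open>exp_weight\<close> takes into
  account.\<close>

locale normality_run = nonneg_columns d m a + ram_bounds L W
  for d m :: nat and a :: "nat \<Rightarrow> nat \<Rightarrow> int" and L W :: nat +
  fixes M :: int
  assumes M_pos: "1 \<le> M"
    and entry_le: "k < d \<Longrightarrow> j < d + m \<Longrightarrow> a k j \<le> M"
    and L_ge: "(d + m + 2) ^ (m + 2) \<le> L"
    and L_le: "L \<le> 2 ^ W"
    and W_ge: "(int d + 1) * (fact d * M ^ Suc d) \<le> 2 ^ W"
begin

sublocale int_columns d "d + m" a .

abbreviation n :: nat where "n \<equiv> d + m"

lemma power_le_L: "x \<le> d + m + 2 \<Longrightarrow> k \<le> m + 2 \<Longrightarrow> x ^ k \<le> L"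
proof -
  assume "x \<le> d + m + 2" "k \<le> m + 2"
  then have "x ^ k \<le> (d + m + 2) ^ k"
    by (intro power_mono) auto
  also have "\<dots> \<le> (d + m + 2) ^ (m + 2)"
    using \<open>k \<le> m + 2\<close> by (intro power_increasing) auto
  finally show ?thesis using L_ge by simp
qed

lemma rows_cols_le_L: "d * n \<le> L" "d \<le> L" "n \<le> L" "2 \<le> L"
proof -
  have "d * n \<le> (d + m + 2) ^ 2"
    unfolding power2_eq_square by (intro mult_le_mono) auto
  also have "\<dots> \<le> L"
    by (rule power_le_L) auto
  finally show "d * n \<le> L" .
  show "d \<le> L" "n \<le> L" "2 \<le> L"
    using power_le_L[of d 1] power_le_L[of n 1] power_le_L[of 2 1] by simp_all
qed

lemma le_L_imp: "x \<le> L \<Longrightarrow> int x \<le> 2 ^ W"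
  using L_le by (metis of_nat_le_iff of_nat_numeral of_nat_power order_trans)

lemma small_le [simp]: "1 \<le> (2 :: int) ^ W"
  by simp

lemma le_L_imp_nat: "x \<le> L \<Longrightarrow> x \<le> 2 ^ W"
  using L_le by simp

section \<open>Memory layout\<close>

definition cells :: int where
  "cells = int (d * n)"

definition tab_pos :: "nat \<Rightarrow> nat \<Rightarrow> int" where
  "tab_pos i j = 2 + cells + int (i * n + j)"

definition used_pos :: "nat \<Rightarrow> int" where
  "used_pos i = 2 + 2 * cells + int i"

definition input_part :: "memory \<Rightarrow> bool" where
  "input_part s \<longleftrightarrow> s 0 = int d \<and> s 1 = int n \<and> (\<forall>l<d * n. s (2 + int l) = a (l div n) (l mod n))"

definition state :: "(nat \<Rightarrow> nat \<Rightarrow> int) \<Rightarrow> nat set \<Rightarrow> memory \<Rightarrow> bool" where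
  "state T U s \<longleftrightarrow> input_part s \<and> (\<forall>i<d. \<forall>j<n. s (tab_pos i j) = T i j) \<and>
    (\<forall>i<d. s (used_pos i) = (if i \<in> U then 1 else 0))"

lemma cells_nonneg [simp]: "0 \<le> cells"
  by (simp add: cells_def)

lemma index_less: "i < d \<Longrightarrow> j < n \<Longrightarrow> i * n + j < d * n"
proof -
  assume "i < d" "j < n"
  then have "i * n + j < Suc i * n" by simp
  also have "\<dots> \<le> d * n"
    using \<open>i < d\<close> by (intro mult_le_mono1) simp
  finally show ?thesis .
qed

lemma less_cells: "l < d * n \<Longrightarrow> int l < cells"
  unfolding cells_def by (simp only: of_nat_less_iff)

lemma tab_pos_less: "i < d \<Longrightarrow> j < n \<Longrightarrow> tab_pos i j < 2 + 2 * cells"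
  using less_cells[OF index_less] by (simp add: tab_pos_def)

lemma tab_pos_ge: "2 + cells \<le> tab_pos i j"
  unfolding tab_pos_def by linarith

lemma used_pos_ge: "2 + 2 * cells \<le> used_pos i"
  by (simp add: used_pos_def)

lemma pos_nonneg [simp]: "0 \<le> tab_pos i j" "0 \<le> used_pos i"
  using tab_pos_ge[of i j] used_pos_ge[of i] cells_nonneg by linarith+

lemma pos_neq_neg [simp]: "x < 0 \<Longrightarrow> tab_pos i j \<noteq> x" "x < 0 \<Longrightarrow> x \<noteq> tab_pos i j"
  "x < 0 \<Longrightarrow> used_pos i \<noteq> x" "x < 0 \<Longrightarrow> x \<noteq> used_pos i"
  using pos_nonneg(1)[of i j] pos_nonneg(2)[of i] by linarith+

lemma tab_pos_neq_used_pos: "i < d \<Longrightarrow> j < n \<Longrightarrow> tab_pos i j \<noteq> used_pos i'"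
  "i < d \<Longrightarrow> j < n \<Longrightarrow> used_pos i' \<noteq> tab_pos i j"
  using tab_pos_less[of i j] used_pos_ge[of i'] by linarith+

lemma used_pos_eq_iff [simp]: "used_pos i = used_pos i' \<longleftrightarrow> i = i'"
  by (simp add: used_pos_def)

lemma tab_pos_eq_iff:
  assumes "j < n" "j' < n"
  shows "tab_pos i j = tab_pos i' j' \<longleftrightarrow> i = i' \<and> j = j'"
proof
  assume "tab_pos i j = tab_pos i' j'"
  then have eq: "i * n + j = i' * n + j'"
    unfolding tab_pos_def by linarith
  have "(i * N + j) div N = i \<and> (i * N + j) mod N = j" if "j < N" for i j N :: nat
    using that by simp
  from this[of _ n] eq assms show "i = i' \<and> j = j'"
    by metis
qed simp

lemma input_part_upd:
  assumes s: "input_part s" and x: "x < 0 \<or> 2 + cells \<le> x"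
  shows "input_part (s(x := v))"
proof -
  have "2 + int l \<noteq> x" if "l < d * n" for l
    using less_cells[OF that] x by linarith
  moreover have "x \<noteq> 0" "x \<noteq> 1"
    using x cells_nonneg by linarith+
  ultimately show ?thesis
    using s by (auto simp: input_part_def)
qed

lemma state_reg:
  assumes "state T U s" "x < 0"
  shows "state T U (s(x := v))"
proof -
  have "tab_pos i j \<noteq> x" "used_pos i \<noteq> x" for i j
    using assms(2) pos_nonneg(1)[of i j] pos_nonneg(2)[of i] by linarith+
  then show ?thesis
    using assms by (auto simp: state_def input_part_upd)
qed

lemma state_tab:
  assumes "state T U s" "i < d" "j < n"
    and "\<And>i' j'. i' < d \<Longrightarrow> j' < n \<Longrightarrow> T' i' j' = (if i' = i \<and> j' = j then v else T i' j')"
  shows "state T' U (s(tab_pos i j := v))"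
  using assms tab_pos_ge[of i j] tab_pos_neq_used_pos[OF assms(2,3)]
  by (auto simp: state_def input_part_upd tab_pos_eq_iff)

lemma state_used:
  assumes "state T U s" "i < d"
  shows "state T (insert i U) (s(used_pos i := 1))"
proof -
  have "2 + cells \<le> used_pos i"
    using used_pos_ge[of i] cells_nonneg by linarith
  then show ?thesis
    using assms by (auto simp: state_def input_part_upd tab_pos_neq_used_pos)
qed

lemma input_part_dims: "input_part s \<Longrightarrow> s 0 = int d" "input_part s \<Longrightarrow> s 1 = int n"
  by (simp_all add: input_part_def)

lemma input_part_cells: "input_part s \<Longrightarrow> s 0 * s 1 = cells"
  by (simp add: input_part_def cells_def)

lemma state_input: "state T U s \<Longrightarrow> input_part s"
  by (simp add: state_def)

lemma state_dims: "state T U s \<Longrightarrow> s 0 = int d" "state T U s \<Longrightarrow> s 1 = int n"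
  by (simp_all add: state_def input_part_def)

lemma exp_val_tab_addr:
  "state T U s \<Longrightarrow> exp_val i s = int i' \<Longrightarrow> exp_val j s = int j' \<Longrightarrow> exp_val (tab_addr i j) s = tab_pos i' j'"
  using input_part_cells[OF state_input] by (simp add: tab_addr_def tab_pos_def state_dims)

lemma state_tab_val: "state T U s \<Longrightarrow> i < d \<Longrightarrow> j < n \<Longrightarrow> s (tab_pos i j) = T i j"
  by (simp add: state_def)

lemma exp_val_used_addr:
  "input_part s \<Longrightarrow> exp_val i s = int i' \<Longrightarrow> exp_val (used_addr i) s = used_pos i'"
  using input_part_cells by (simp add: used_addr_def used_pos_def)

lemma state_used_val: "state T U s \<Longrightarrow> i < d \<Longrightarrow> s (used_pos i) = (if i \<in> U then 1 else 0)"
  by (simp add: state_def)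

lemmas state_simps = exp_val_tab_addr state_tab_val exp_val_used_addr[OF state_input] state_used_val state_dims

definition env :: "nat \<Rightarrow> int \<Rightarrow> int \<Rightarrow> int \<Rightarrow> memory \<Rightarrow> bool" where
  "env K D X Y s \<longleftrightarrow> s rK = int K \<and> s rD = D \<and> s rX = X \<and> s rY = Y"

lemma env_upd: "env K D X Y s \<Longrightarrow> x \<notin> {rK, rD, rX, rY} \<Longrightarrow> env K D X Y (s(x := v))"
  by (simp add: env_def)

section \<open>Loading the initial tableau\<close>

lemma copy_triple:
  "triple L W (\<lambda>s. input_part s \<and> env K D X Y s) copy_prog
    (\<lambda>s. input_part s \<and> (\<forall>i<d. \<forall>j<n. s (tab_pos i j) = a i j) \<and> env K D X Y s)"
  unfolding copy_prog_def
proof (rule triple_For[where N = "d * n" and I = "\<lambda>l s. input_part s \<and> env K D X Y s \<and>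
    (\<forall>l'<l. s (2 + cells + int l') = a (l' div n) (l' mod n))"])
  fix l assume l: "l < d * n"
  show "triple L W (\<lambda>s. (input_part s \<and> env K D X Y s \<and>
      (\<forall>l'<l. s (2 + cells + int l') = a (l' div n) (l' mod n))) \<and> s rI = int l)
    (Store (Plus (Plus (Const 2) (Times rows_exp cols_exp)) (reg rI)) (Mem (Plus (Const 2) (reg rI))))
    (\<lambda>s. (input_part s \<and> env K D X Y s \<and>
      (\<forall>l'<Suc l. s (2 + cells + int l') = a (l' div n) (l' mod n))) \<and> s rI = int l)"
  proof (rule triple_Store, intro conjI)
    fix s assume s: "bounded_memory W s" "(input_part s \<and> env K D X Y s \<and>
      (\<forall>l'<l. s (2 + cells + int l') = a (l' div n) (l' mod n))) \<and> s rI = int l"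
    show "\<bar>exp_val (Mem (Plus (Const 2) (reg rI))) s\<bar> \<le> 2 ^ W"
      using bounded_memoryD[OF s(1)] by simp
    have pos: "exp_val (Plus (Plus (Const 2) (Times rows_exp cols_exp)) (reg rI)) s = 2 + cells + int l"
      using s(2) input_part_cells by simp
    have val: "exp_val (Mem (Plus (Const 2) (reg rI))) s = a (l div n) (l mod n)"
      using s(2) l by (simp add: input_part_def)
    let ?s = "s(exp_val (Plus (Plus (Const 2) (Times rows_exp cols_exp)) (reg rI)) s :=
      exp_val (Mem (Plus (Const 2) (reg rI))) s)"
    show "input_part ?s" "env K D X Y ?s" "?s rI = int l"
      unfolding pos using s(2) cells_nonneg by (auto intro!: input_part_upd env_upd simp: add_nonneg_eq_0_iff simp del: cells_nonneg)
    show "\<forall>l'<Suc l. ?s (2 + cells + int l') = a (l' div n) (l' mod n)"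
      unfolding pos val using s(2) by (auto simp: less_Suc_eq)
  qed
next
  fix l s v assume s: "input_part s \<and> env K D X Y s \<and>
    (\<forall>l'<l. s (2 + cells + int l') = a (l' div n) (l' mod n))"
  have "2 + cells + int l' \<noteq> rI" for l'
    using cells_nonneg by linarith
  then show "input_part (s(rI := v)) \<and> env K D X Y (s(rI := v)) \<and>
    (\<forall>l'<l. (s(rI := v)) (2 + cells + int l') = a (l' div n) (l' mod n))"
    using s by (auto intro: input_part_upd env_upd)
next
  fix s assume s: "input_part s \<and> env K D X Y s \<and>
    (\<forall>l'<d * n. s (2 + cells + int l') = a (l' div n) (l' mod n))"
  have "s (tab_pos i j) = a i j" if "i < d" "j < n" for i j
  proof -
    have "s (tab_pos i j) = a ((i * n + j) div n) ((i * n + j) mod n)"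
      unfolding tab_pos_def using s index_less[OF that] by blast
    then show ?thesis using that by simp
  qed
  with s show "input_part s \<and> (\<forall>i<d. \<forall>j<n. s (tab_pos i j) = a i j) \<and> env K D X Y s"
    by blast
qed (use rows_cols_le_L le_L_imp_nat in \<open>auto simp: input_part_dims\<close>)

lemma clear_triple:
  "triple L W (\<lambda>s. input_part s \<and> (\<forall>i<d. \<forall>j<n. s (tab_pos i j) = a i j) \<and> env K D X Y s) clear_prog
    (\<lambda>s. state a {} s \<and> env K D X Y s)"
  unfolding clear_prog_def
proof (rule triple_For[where N = d and I = "\<lambda>i s. input_part s \<and> (\<forall>i<d. \<forall>j<n. s (tab_pos i j) = a i j) \<and>
    env K D X Y s \<and> (\<forall>i'<i. s (used_pos i') = 0)"])
  fix i assume i: "i < d"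
  show "triple L W (\<lambda>s. (input_part s \<and> (\<forall>i<d. \<forall>j<n. s (tab_pos i j) = a i j) \<and>
      env K D X Y s \<and> (\<forall>i'<i. s (used_pos i') = 0)) \<and> s rI = int i)
    (Store (used_addr (reg rI)) (Const 0))
    (\<lambda>s. (input_part s \<and> (\<forall>i<d. \<forall>j<n. s (tab_pos i j) = a i j) \<and>
      env K D X Y s \<and> (\<forall>i'<Suc i. s (used_pos i') = 0)) \<and> s rI = int i)"
  proof (rule triple_Store)
    fix s assume s: "(input_part s \<and> (\<forall>i<d. \<forall>j<n. s (tab_pos i j) = a i j) \<and>
      env K D X Y s \<and> (\<forall>i'<i. s (used_pos i') = 0)) \<and> s rI = int i"
    then have pos: "exp_val (used_addr (reg rI)) s = used_pos i"
      by (simp add: exp_val_used_addr)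
    have "2 + cells \<le> used_pos i"
      using used_pos_ge[of i] cells_nonneg by linarith
    then show "\<bar>exp_val (Const 0) s\<bar> \<le> 2 ^ W \<and>
      (input_part (s(exp_val (used_addr (reg rI)) s := exp_val (Const 0) s)) \<and>
      (\<forall>i<d. \<forall>j<n. (s(exp_val (used_addr (reg rI)) s := exp_val (Const 0) s)) (tab_pos i j) = a i j) \<and>
      env K D X Y (s(exp_val (used_addr (reg rI)) s := exp_val (Const 0) s)) \<and>
      (\<forall>i'<Suc i. (s(exp_val (used_addr (reg rI)) s := exp_val (Const 0) s)) (used_pos i') = 0)) \<and>
      (s(exp_val (used_addr (reg rI)) s := exp_val (Const 0) s)) rI = int i"
      unfolding pos using s by (auto simp: less_Suc_eq tab_pos_neq_used_pos intro!: input_part_upd env_upd)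
  qed
next
  fix i s v assume s: "input_part s \<and> (\<forall>i<d. \<forall>j<n. s (tab_pos i j) = a i j) \<and>
    env K D X Y s \<and> (\<forall>i'<i. s (used_pos i') = 0)"
  have "tab_pos i j \<noteq> rI" "used_pos i \<noteq> rI" for i j
    using pos_nonneg(1)[of i j] pos_nonneg(2)[of i] by linarith+
  then show "input_part (s(rI := v)) \<and> (\<forall>i<d. \<forall>j<n. (s(rI := v)) (tab_pos i j) = a i j) \<and>
    env K D X Y (s(rI := v)) \<and> (\<forall>i'<i. (s(rI := v)) (used_pos i') = 0)"
    using s by (auto intro: input_part_upd env_upd)
qed (use rows_cols_le_L le_L_imp_nat in \<open>auto simp: input_part_dims state_def\<close>)

section \<open>Elimination in memory\<close>

lemma find_triple:
  assumes c: "c < n"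
  shows "triple L W (\<lambda>s. state T U s \<and> env K D X Y s \<and> s rC = int c) find_prog
    (\<lambda>s. (state T U s \<and> env K D X Y s \<and> s rC = int c) \<and>
      (s rR = - 1 \<and> (\<forall>i<d. i \<in> U \<or> T i c = 0) \<or> (\<exists>r<d. r \<notin> U \<and> T r c \<noteq> 0 \<and> s rR = int r)))"
  unfolding find_prog_def
proof (rule triple_Seq)
  show "triple L W (\<lambda>s. state T U s \<and> env K D X Y s \<and> s rC = int c) (Store (Const rR) (Const (- 1)))
    (\<lambda>s. (state T U s \<and> env K D X Y s \<and> s rC = int c) \<and> s rR = - 1)"
    by (rule triple_Store) (auto intro: state_reg env_upd)
  let ?e = "Times (Minus (Const 1) (Mem (used_addr (reg rI)))) (square_exp (Mem (tab_addr (reg rI) (reg rC))))"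
  let ?I = "\<lambda>i s. (state T U s \<and> env K D X Y s \<and> s rC = int c) \<and>
    (s rR = - 1 \<and> (\<forall>i'<i. i' \<in> U \<or> T i' c = 0) \<or> (\<exists>r<d. r \<notin> U \<and> T r c \<noteq> 0 \<and> s rR = int r))"
  show "triple L W (\<lambda>s. (state T U s \<and> env K D X Y s \<and> s rC = int c) \<and> s rR = - 1)
    (For rI rows_exp
      (Cond ?e (Store (Const rR) (reg rI)) Skip))
    (\<lambda>s. (state T U s \<and> env K D X Y s \<and> s rC = int c) \<and>
      (s rR = - 1 \<and> (\<forall>i<d. i \<in> U \<or> T i c = 0) \<or> (\<exists>r<d. r \<notin> U \<and> T r c \<noteq> 0 \<and> s rR = int r)))"
  proof (rule triple_For[where N = d and I = ?I])
    fix i assume i: "i < d"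
    have test: "0 < exp_val ?e s \<longleftrightarrow> i \<notin> U \<and> T i c \<noteq> 0"
      if "state T U s" "s rC = int c" "s rI = int i" for s
      using that i c exp_val_square_exp_pos[of "Mem (tab_addr (reg rI) (reg rC))" s]
      by (auto simp: state_simps square_exp_def zero_less_mult_iff)
    show "triple L W (\<lambda>s. ?I i s \<and> s rI = int i)
      (Cond ?e (Store (Const rR) (reg rI)) Skip)
      (\<lambda>s. ?I (Suc i) s \<and> s rI = int i)"
    proof (rule triple_Cond)
      show "triple L W (\<lambda>s. (?I i s \<and> s rI = int i) \<and> 0 < exp_val ?e s)
        (Store (Const rR) (reg rI)) (\<lambda>s. ?I (Suc i) s \<and> s rI = int i)"
      proof (rule triple_Store)
        fix s assume s: "bounded_memory W s" "(?I i s \<and> s rI = int i) \<and> 0 < exp_val ?e s"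
        then have "i \<notin> U" "T i c \<noteq> 0"
          using test[of s] by auto
        then show "\<bar>exp_val (reg rI) s\<bar> \<le> 2 ^ W \<and> ?I (Suc i) (s(exp_val (Const rR) s := exp_val (reg rI) s)) \<and>
          (s(exp_val (Const rR) s := exp_val (reg rI) s)) rI = int i"
          using s i bounded_memoryD[OF s(1), of rI] by (auto intro: state_reg env_upd)
      qed
      show "triple L W (\<lambda>s. (?I i s \<and> s rI = int i) \<and> \<not> 0 < exp_val ?e s)
        Skip (\<lambda>s. ?I (Suc i) s \<and> s rI = int i)"
      proof (rule triple_Skip)
        fix s assume s: "(?I i s \<and> s rI = int i) \<and> \<not> 0 < exp_val ?e s"
        then have "i \<in> U \<or> T i c = 0"
          using test[of s] by auto
        then show "?I (Suc i) s \<and> s rI = int i"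
          using s by (auto simp: less_Suc_eq)
      qed
    qed
  qed (use rows_cols_le_L le_L_imp_nat in \<open>auto simp: state_dims intro: state_reg env_upd\<close>)
qed

definition bound :: int where
  "bound = fact d * M ^ Suc d"

lemma bound_pos: "1 \<le> bound"
  using M_pos unfolding bound_def by (metis fact_ge_1 mult_mono' mult_1 one_le_power zero_le_one)

lemma bound_le: "int k \<le> int d + 1 \<Longrightarrow> int k * bound \<le> 2 ^ W"
proof -
  assume "int k \<le> int d + 1"
  then have "int k * bound \<le> (int d + 1) * bound"
    using bound_pos by (intro mult_right_mono) auto
  also have "\<dots> \<le> 2 ^ W"
    using W_ge by (simp only: bound_def)
  finally show ?thesis .
qed

lemma bound_le_1: "bound \<le> 2 ^ W"
  using bound_le[of 1] by simp

lemma tableau_le_bound: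
  assumes "partial_tableau \<beta> U T D"
  shows "\<bar>D\<bar> \<le> bound" "i < d \<Longrightarrow> j < n \<Longrightarrow> \<bar>T i j\<bar> \<le> bound"
proof -
  have "fact d * M ^ d \<le> bound"
    using M_pos unfolding bound_def by (intro mult_left_mono power_increasing) auto
  moreover have "\<bar>a k j\<bar> \<le> M" if "k < d" "j < n" for k j
    using nonneg[OF that] entry_le[OF that] by simp
  ultimately show "\<bar>D\<bar> \<le> bound" "i < d \<Longrightarrow> j < n \<Longrightarrow> \<bar>T i j\<bar> \<le> bound"
    using partial_tableau_bound[OF assms M_pos] by (meson order_trans)+
qed

context
  fixes K c r :: nat and X Y D :: int and U :: "nat set" and T :: "nat \<Rightarrow> nat \<Rightarrow> int" and \<beta>
  assumes tab: "partial_tableau \<beta> U T D" and r: "r < d" "r \<notin> U" and c: "c < n" and nz: "T r c \<noteq> 0"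
begin

text \<open>The tableau in memory while it is rewritten in place, row by row and from left to
  right.\<close>

definition mixed :: "nat \<Rightarrow> nat \<Rightarrow> nat \<Rightarrow> nat \<Rightarrow> int" where
  "mixed i j i' j' = (if i' < i \<or> i' = i \<and> j' < j then pivot r c T D i' j' else T i' j')"

definition pivot_frame :: "memory \<Rightarrow> bool" where
  "pivot_frame s \<longleftrightarrow> env K D X Y s \<and> s rC = int c \<and> s rR = int r \<and> s rP = T r c"

lemma pivot_frame_upd: "pivot_frame s \<Longrightarrow> x \<notin> {rK, rD, rX, rY, rC, rR, rP} \<Longrightarrow> pivot_frame (s(x := v))"
  by (simp add: pivot_frame_def env_def)

text \<open>The new entries again belong to a partial tableau, so they are determinants and fit into
  a cell.\<close>

lemma pivot_le: "i < d \<Longrightarrow> j < n \<Longrightarrow> \<bar>pivot r c T D i j\<bar> \<le> 2 ^ W"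
  using tableau_le_bound(2)[OF partial_tableau_pivot[OF tab r c nz]] bound_le_1 by (rule order_trans)

lemma row_triple:
  assumes i: "i < d" "i \<noteq> r"
  shows "triple L W (\<lambda>s. (state (mixed i 0) U s \<and> pivot_frame s) \<and> s rI = int i) row_prog
    (\<lambda>s. (state (mixed (Suc i) 0) U s \<and> pivot_frame s) \<and> s rI = int i)"
  unfolding row_prog_def
proof (rule triple_Seq)
  let ?I = "\<lambda>j s. state (mixed i j) U s \<and> pivot_frame s \<and> s rI = int i \<and> s rQ = T i c"
  show "triple L W (\<lambda>s. (state (mixed i 0) U s \<and> pivot_frame s) \<and> s rI = int i)
    (Store (Const rQ) (Mem (tab_addr (reg rI) (reg rC)))) (?I 0)"
  proof (rule triple_Store)
    fix s assume s: "bounded_memory W s" "(state (mixed i 0) U s \<and> pivot_frame s) \<and> s rI = int i"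
    then have "exp_val (Mem (tab_addr (reg rI) (reg rC))) s = T i c"
      using i c by (clarsimp simp: state_simps pivot_frame_def mixed_def)
    then show "\<bar>exp_val (Mem (tab_addr (reg rI) (reg rC))) s\<bar> \<le> 2 ^ W \<and>
        ?I 0 (s(exp_val (Const rQ) s := exp_val (Mem (tab_addr (reg rI) (reg rC))) s))"
      using s abs_exp_val_le[OF s(1) W_pos, of "Mem (tab_addr (reg rI) (reg rC))"]
      by (simp add: state_reg pivot_frame_upd)
  qed
  let ?e = "Quot (Minus (Times (reg rP) (Mem (tab_addr (reg rI) (reg rJ))))
        (Times (reg rQ) (Mem (tab_addr (reg rR) (reg rJ))))) (reg rD)"
  show "triple L W (?I 0) (For rJ cols_exp (Store (tab_addr (reg rI) (reg rJ)) ?e))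
    (\<lambda>s. (state (mixed (Suc i) 0) U s \<and> pivot_frame s) \<and> s rI = int i)"
  proof (rule triple_For[where N = n and I = ?I])
    fix j assume j: "j < n"
    show "triple L W (\<lambda>s. ?I j s \<and> s rJ = int j) (Store (tab_addr (reg rI) (reg rJ)) ?e)
      (\<lambda>s. ?I (Suc j) s \<and> s rJ = int j)"
    proof (rule triple_Store)
      fix s assume s: "bounded_memory W s" "?I j s \<and> s rJ = int j"
      have pos: "exp_val (tab_addr (reg rI) (reg rJ)) s = tab_pos i j"
        using s by (clarsimp simp: state_simps)
      have "exp_val (tab_addr (reg rR) (reg rJ)) s = tab_pos r j"
        using s by (clarsimp simp: state_simps pivot_frame_def)
      \<comment> \<open>The pivot leaves row \<open>r\<close> unchanged, so it is read correctly
        whether or not the sweep has passed it.\<close>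
      moreover have "mixed i j r j = T r j" "mixed i j i j = T i j"
        by (simp_all add: mixed_def pivot_def)
      ultimately have val: "exp_val ?e s = pivot r c T D i j"
        using s i r j pos by (clarsimp simp: state_tab_val pivot_frame_def env_def pivot_def)
      have "state (mixed i (Suc j)) U (s(tab_pos i j := pivot r c T D i j))"
        using s by (intro state_tab[of "mixed i j"]) (auto simp: mixed_def i j less_Suc_eq)
      then show "\<bar>exp_val ?e s\<bar> \<le> 2 ^ W \<and> (?I (Suc j) (s(exp_val (tab_addr (reg rI) (reg rJ)) s := exp_val ?e s)) \<and>
        (s(exp_val (tab_addr (reg rI) (reg rJ)) s := exp_val ?e s)) rJ = int j)"
        unfolding pos val using s pivot_le i j by (simp add: pivot_frame_upd)
    qed
  next
    fix s assume s: "?I n s"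
    have "state (mixed (Suc i) 0) U s"
      using s by (auto simp: state_def mixed_def less_Suc_eq)
    with s show "(state (mixed (Suc i) 0) U s \<and> pivot_frame s) \<and> s rI = int i"
      by blast
  qed (use rows_cols_le_L le_L_imp_nat in \<open>auto simp: state_dims intro: state_reg pivot_frame_upd\<close>)
qed

lemma pivot_triple:
  "triple L W (\<lambda>s. state T U s \<and> env K D X Y s \<and> s rC = int c \<and> s rR = int r) pivot_prog
    (\<lambda>s. state (pivot r c T D) (insert r U) s \<and> env K (T r c) X Y s \<and> s rC = int c)"
  unfolding pivot_prog_def
proof (rule triple_Seq)
  show "triple L W (\<lambda>s. state T U s \<and> env K D X Y s \<and> s rC = int c \<and> s rR = int r)
    (Store (Const rP) (Mem (tab_addr (reg rR) (reg rC)))) (\<lambda>s. state (mixed 0 0) U s \<and> pivot_frame s)"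
  proof (rule triple_Store)
    fix s assume s: "bounded_memory W s" "state T U s \<and> env K D X Y s \<and> s rC = int c \<and> s rR = int r"
    have "mixed 0 0 = T"
      by (intro ext) (simp add: mixed_def)
    moreover have "exp_val (Mem (tab_addr (reg rR) (reg rC))) s = T r c"
      using s r c by (clarsimp simp: state_simps)
    ultimately show "\<bar>exp_val (Mem (tab_addr (reg rR) (reg rC))) s\<bar> \<le> 2 ^ W \<and>
        state (mixed 0 0) U (s(exp_val (Const rP) s := exp_val (Mem (tab_addr (reg rR) (reg rC))) s)) \<and>
        pivot_frame (s(exp_val (Const rP) s := exp_val (Mem (tab_addr (reg rR) (reg rC))) s))"
      using s bounded_memoryD[OF s(1), of "tab_pos r c"] state_tab_val[of T U s r c] r c
      by (simp add: state_reg pivot_frame_def env_upd)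
  qed
next
  show "triple L W (\<lambda>s. state (mixed 0 0) U s \<and> pivot_frame s)
    (Seq (For rI rows_exp (Cond (square_exp (Minus (reg rI) (reg rR))) row_prog Skip))
      (Seq (Store (Const rD) (reg rP)) (Store (used_addr (reg rR)) (Const 1))))
    (\<lambda>s. state (pivot r c T D) (insert r U) s \<and> env K (T r c) X Y s \<and> s rC = int c)"
  proof (rule triple_Seq)
    show "triple L W (\<lambda>s. state (mixed 0 0) U s \<and> pivot_frame s)
      (For rI rows_exp (Cond (square_exp (Minus (reg rI) (reg rR))) row_prog Skip))
      (\<lambda>s. state (pivot r c T D) U s \<and> pivot_frame s)"
    proof (rule triple_For[where N = d and I = "\<lambda>i s. state (mixed i 0) U s \<and> pivot_frame s"])
      fix i assume i: "i < d"
      show "triple L W (\<lambda>s. (state (mixed i 0) U s \<and> pivot_frame s) \<and> s rI = int i)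
        (Cond (square_exp (Minus (reg rI) (reg rR))) row_prog Skip)
        (\<lambda>s. (state (mixed (Suc i) 0) U s \<and> pivot_frame s) \<and> s rI = int i)"
      proof (rule triple_Cond, goal_cases)
        case 1
        show ?case
        proof (cases "i = r")
          case True
          then show ?thesis
            by (auto simp: triple_def pivot_frame_def simp del: exp_val_power_exp)
        next
          case False
          then show ?thesis
            by (intro triple_pre[OF row_triple[OF i]]) auto
        qed
      next
        case 2
        show ?case
        proof (rule triple_Skip)
          fix s assume s: "((state (mixed i 0) U s \<and> pivot_frame s) \<and> s rI = int i) \<and>
            \<not> 0 < exp_val (square_exp (Minus (reg rI) (reg rR))) s"
          then have "i = r"
            by (simp add: pivot_frame_def)
          then have "mixed (Suc i) 0 = mixed i 0"
            by (intro ext) (auto simp: mixed_def pivot_def less_Suc_eq)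
          with s show "(state (mixed (Suc i) 0) U s \<and> pivot_frame s) \<and> s rI = int i"
            by simp
        qed
      qed
    next
      fix s assume "state (mixed d 0) U s \<and> pivot_frame s"
      then show "state (pivot r c T D) U s \<and> pivot_frame s"
        by (auto simp: state_def mixed_def)
    qed (use rows_cols_le_L le_L_imp_nat in \<open>auto simp: state_dims intro: state_reg pivot_frame_upd\<close>)
    show "triple L W (\<lambda>s. state (pivot r c T D) U s \<and> pivot_frame s)
      (Seq (Store (Const rD) (reg rP)) (Store (used_addr (reg rR)) (Const 1)))
      (\<lambda>s. state (pivot r c T D) (insert r U) s \<and> env K (T r c) X Y s \<and> s rC = int c)"
    proof (rule triple_Seq)
      show "triple L W (\<lambda>s. state (pivot r c T D) U s \<and> pivot_frame s) (Store (Const rD) (reg rP))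
        (\<lambda>s. state (pivot r c T D) U s \<and> env K (T r c) X Y s \<and> s rC = int c \<and> s rR = int r)"
      proof (rule triple_Store)
        fix s assume s: "bounded_memory W s" "state (pivot r c T D) U s \<and> pivot_frame s"
        then show "\<bar>exp_val (reg rP) s\<bar> \<le> 2 ^ W \<and>
          state (pivot r c T D) U (s(exp_val (Const rD) s := exp_val (reg rP) s)) \<and>
          env K (T r c) X Y (s(exp_val (Const rD) s := exp_val (reg rP) s)) \<and>
          (s(exp_val (Const rD) s := exp_val (reg rP) s)) rC = int c \<and>
          (s(exp_val (Const rD) s := exp_val (reg rP) s)) rR = int r"
          using bounded_memoryD[OF s(1), of rP] by (auto simp: state_reg pivot_frame_def env_def)
      qed
      show "triple L W (\<lambda>s. state (pivot r c T D) U s \<and> env K (T r c) X Y s \<and> s rC = int c \<and> s rR = int r)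
        (Store (used_addr (reg rR)) (Const 1))
        (\<lambda>s. state (pivot r c T D) (insert r U) s \<and> env K (T r c) X Y s \<and> s rC = int c)"
      proof (rule triple_Store)
        fix s assume s: "state (pivot r c T D) U s \<and> env K (T r c) X Y s \<and> s rC = int c \<and> s rR = int r"
        then have "exp_val (used_addr (reg rR)) s = used_pos r"
          by (clarsimp simp: state_simps)
        then show "\<bar>exp_val (Const 1) s\<bar> \<le> 2 ^ W \<and>
          state (pivot r c T D) (insert r U) (s(exp_val (used_addr (reg rR)) s := exp_val (Const 1) s)) \<and>
          env K (T r c) X Y (s(exp_val (used_addr (reg rR)) s := exp_val (Const 1) s)) \<and>
          (s(exp_val (used_addr (reg rR)) s := exp_val (Const 1) s)) rC = int c"
          using s r by (auto intro: state_used env_upd)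
      qed
    qed
  qed
qed

end

definition columns_of :: "nat \<Rightarrow> nat \<Rightarrow> nat" where
  "columns_of K j = digit n j K"

lemma columns_of_less: "j < m \<Longrightarrow> columns_of K j < n"
  by (simp add: columns_of_def digit_def)

lemma exp_val_column_exp: "state T U s \<Longrightarrow> s rK = int K \<Longrightarrow> exp_val (column_exp j) s = int (columns_of K j)"
  unfolding column_exp_def columns_of_def by (rule exp_val_digit_exp) (simp_all add: state_dims)

lemma exp_val_outside_exp_pos:
  assumes "state T U s" "s rK = int K" "s rC = int c"
  shows "0 < exp_val (outside_exp m) s \<longleftrightarrow> c \<notin> columns_of K ` {..<m}"
proof -
  have "exp_val (outside_exp m) s = (\<Prod>j<m. (int c - int (columns_of K j)) ^ 2)"
    using assms by (simp add: outside_exp_def square_exp_def exp_val_column_exp power2_eq_square)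
  moreover have "0 < (\<Prod>j<m. (int c - int (columns_of K j)) ^ 2)" if "c \<notin> columns_of K ` {..<m}"
    using that by (intro prod_pos) auto
  moreover have "(\<Prod>j<m. (int c - int (columns_of K j)) ^ 2) = 0" if "c \<in> columns_of K ` {..<m}"
    using that by (intro prod_zero) auto
  ultimately show ?thesis
    by (cases "c \<in> columns_of K ` {..<m}") simp_all
qed

text \<open>A column without a pivot is a combination of the columns processed before it.\<close>

lemma no_pivot_imp_dependent:
  assumes tab: "partial_tableau \<beta> U T D" and c: "c < n" "c \<notin> I ` {..<m}"
    and inj: "inj_on \<beta> U" and sub: "\<beta> ` U \<subseteq> {..<c} - I ` {..<m}"
    and zero: "\<forall>i<d. i \<in> U \<or> T i c = 0"
  shows "dependent_outside I"
  unfolding dependent_outside_def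
proof (intro exI[of _ "\<lambda>j. if j = c then D else if j \<in> \<beta> ` U then - T (inv_into U \<beta> j) c else 0"] conjI)
  \<comment> \<open>The relation is \<open>D\<close> times column \<open>c\<close> minus the sum of
    \<open>T i c\<close> times column \<open>\<beta> i\<close> over \<open>U\<close>. Unit vectors
    do not enter, since \<open>T i c\<close> is zero off \<open>U\<close>.\<close>
  let ?y = "\<lambda>j. if j = c then D else if j \<in> \<beta> ` U then - T (inv_into U \<beta> j) c else 0"
  have D: "D \<noteq> 0" and U: "U \<subseteq> {..<d}"
    using tab by (auto simp: partial_tableau_def)
  have nc: "c \<notin> \<beta> ` U"
    using sub by auto
  show "\<exists>j<n. ?y j \<noteq> 0"
    using c D by auto
  show "\<forall>j<m. ?y (I j) = 0"
    using sub c by auto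
  show "\<forall>k<d. (\<Sum>j<n. a k j * ?y j) = 0"
  proof (intro allI impI)
    fix k assume k: "k < d"
    have "(\<Sum>j<n. a k j * ?y j) = (\<Sum>j\<in>insert c (\<beta> ` U). a k j * ?y j)"
      using sub c by (intro sum.mono_neutral_right) auto
    also have "\<dots> = a k c * D + (\<Sum>j\<in>\<beta> ` U. a k j * ?y j)"
      using nc finite_subset[OF U] by (subst sum.insert) auto
    also have "(\<Sum>j\<in>\<beta> ` U. a k j * ?y j) = (\<Sum>i\<in>U. a k (\<beta> i) * (- T i c))"
      using inj nc by (subst sum.reindex[OF inj]) (auto intro!: sum.cong)
    also have "\<dots> = - (\<Sum>i\<in>U. a k (\<beta> i) * T i c)"
      by (simp add: sum_negf)
    also have "(\<Sum>i\<in>U. a k (\<beta> i) * T i c) = (\<Sum>i<d. basis_matrix \<beta> U $$ (k, i) * T i c)"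
      using U k zero by (intro sum.mono_neutral_cong_left) (auto simp: basis_matrix_def)
    also have "\<dots> = D * a k c"
      using tab k c by (simp add: partial_tableau_def)
    finally show "(\<Sum>j<n. a k j * ?y j) = 0"
      by simp
  qed
qed

text \<open>After a failed column the tableau remains valid for the columns that did get a pivot;
  this keeps the entries bounded while the loop continues with the flag set.\<close>

definition eliminated :: "nat \<Rightarrow> int \<Rightarrow> nat \<Rightarrow> memory \<Rightarrow> bool" where
  "eliminated K Y c s \<longleftrightarrow> (\<exists>\<beta> U T D X. partial_tableau \<beta> U T D \<and> inj_on \<beta> U \<and>
    \<beta> ` U \<subseteq> {..<c} - columns_of K ` {..<m} \<and>
    (X = 0 \<and> {..<c} - columns_of K ` {..<m} \<subseteq> \<beta> ` U \<or> X = 1 \<and> dependent_outside (columns_of K)) \<and>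
    state T U s \<and> env K D X Y s)"

lemma eliminated_upd:
  assumes "eliminated K Y c s" "x < 0" "x \<notin> {rK, rD, rX, rY}"
  shows "eliminated K Y c (s(x := v))"
proof -
  obtain \<beta> U T D X where *: "partial_tableau \<beta> U T D \<and> inj_on \<beta> U \<and>
    \<beta> ` U \<subseteq> {..<c} - columns_of K ` {..<m} \<and>
    (X = 0 \<and> {..<c} - columns_of K ` {..<m} \<subseteq> \<beta> ` U \<or> X = 1 \<and> dependent_outside (columns_of K)) \<and>
    state T U s \<and> env K D X Y s"
    using assms(1) unfolding eliminated_def by (elim exE)
  have "state T U (s(x := v)) \<and> env K D X Y (s(x := v))"
    using * assms(2,3) by (simp add: state_reg env_upd)
  with * show ?thesis
    unfolding eliminated_def by (intro exI[of _ \<beta>] exI[of _ U] exI[of _ T] exI[of _ D] exI[of _ X]) simp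
qed

lemma eliminate_step:
  assumes c: "c < n"
  shows "triple L W (\<lambda>s. eliminated K Y c s \<and> s rC = int c)
    (Cond (outside_exp m) (Seq find_prog (Cond (Plus (reg rR) (Const 1)) pivot_prog (Store (Const rX) (Const 1)))) Skip)
    (\<lambda>s. eliminated K Y (Suc c) s \<and> s rC = int c)"
proof (rule triple_obtain)
  fix s0 assume "eliminated K Y c s0 \<and> s0 rC = int c"
  then obtain \<beta> U T D X where tab: "partial_tableau \<beta> U T D" and inj: "inj_on \<beta> U"
    and sub: "\<beta> ` U \<subseteq> {..<c} - columns_of K ` {..<m}"
    and X: "X = 0 \<and> {..<c} - columns_of K ` {..<m} \<subseteq> \<beta> ` U \<or> X = 1 \<and> dependent_outside (columns_of K)"
    and s0: "state T U s0 \<and> env K D X Y s0 \<and> s0 rC = int c"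
    unfolding eliminated_def by blast
  have U: "U \<subseteq> {..<d}"
    using tab by (simp add: partial_tableau_def)
  let ?P = "\<lambda>s. state T U s \<and> env K D X Y s \<and> s rC = int c"
  let ?Q = "\<lambda>s. eliminated K Y (Suc c) s \<and> s rC = int c"
  let ?B = "Seq find_prog (Cond (Plus (reg rR) (Const 1)) pivot_prog (Store (Const rX) (Const 1)))"
  have "triple L W ?P (Cond (outside_exp m) ?B Skip) ?Q"
  proof (rule triple_Cond)
    show "triple L W (\<lambda>s. ?P s \<and> \<not> 0 < exp_val (outside_exp m) s) Skip ?Q"
    proof (rule triple_Skip)
      fix s assume s: "?P s \<and> \<not> 0 < exp_val (outside_exp m) s"
      then have "c \<in> columns_of K ` {..<m}"
        using exp_val_outside_exp_pos[of T U s K c] by (auto simp: env_def)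
      then have "{..<Suc c} - columns_of K ` {..<m} = {..<c} - columns_of K ` {..<m}"
        by (auto simp: less_Suc_eq)
      then have "eliminated K Y (Suc c) s"
        unfolding eliminated_def using tab inj sub X s by (intro exI[of _ \<beta>] exI[of _ U] exI[of _ T] exI[of _ D] exI[of _ X]) simp
      then show "?Q s" using s by simp
    qed
    show "triple L W (\<lambda>s. ?P s \<and> 0 < exp_val (outside_exp m) s) ?B ?Q"
    proof (cases "c \<in> columns_of K ` {..<m}")
      case True
      then have "\<not> 0 < exp_val (outside_exp m) s" if "?P s" for s
        using that exp_val_outside_exp_pos[of T U s K c] by (auto simp: env_def)
      then show ?thesis
        unfolding triple_def by blast
    next
      case False
      then have Suc_c: "{..<Suc c} - columns_of K ` {..<m} = insert c ({..<c} - columns_of K ` {..<m})"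
        by (auto simp: less_Suc_eq)
      let ?R = "\<lambda>s. ?P s \<and> (s rR = - 1 \<and> (\<forall>i<d. i \<in> U \<or> T i c = 0) \<or>
        (\<exists>r<d. r \<notin> U \<and> T r c \<noteq> 0 \<and> s rR = int r))"
      have "triple L W ?R (Cond (Plus (reg rR) (Const 1)) pivot_prog (Store (Const rX) (Const 1))) ?Q"
      proof (rule triple_Cond)
        show "triple L W (\<lambda>s. ?R s \<and> 0 < exp_val (Plus (reg rR) (Const 1)) s) pivot_prog ?Q"
        proof (rule triple_obtain)
          fix s assume s: "?R s \<and> 0 < exp_val (Plus (reg rR) (Const 1)) s"
          then obtain r where r: "r < d" "r \<notin> U" "T r c \<noteq> 0" "s rR = int r" by auto
          let ?\<beta> = "\<beta>(r := c)"
          have im: "?\<beta> ` insert r U = insert c (\<beta> ` U)"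
            using r by (auto simp: image_iff)
          have inj': "inj_on ?\<beta> (insert r U)"
          proof (rule inj_on_insert[THEN iffD2], intro conjI)
            have same: "?\<beta> i = \<beta> i" if "i \<in> U" for i
              using that r by auto
            show "inj_on ?\<beta> U"
              using inj same by (simp cong: inj_on_cong)
            have "?\<beta> ` (U - {r}) \<subseteq> \<beta> ` U"
              using same by auto
            then show "?\<beta> r \<notin> ?\<beta> ` (U - {r})"
              using sub by auto
          qed
          have "triple L W (\<lambda>s. state T U s \<and> env K D X Y s \<and> s rC = int c \<and> s rR = int r) pivot_prog ?Q"
          proof (rule triple_post[OF pivot_triple[OF tab r(1,2) c r(3)]])
            fix s assume s: "state (pivot r c T D) (insert r U) s \<and> env K (T r c) X Y s \<and> s rC = int c"
            have "eliminated K Y (Suc c) s"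
              unfolding eliminated_def
            proof (intro exI conjI)
              show "partial_tableau ?\<beta> (insert r U) (pivot r c T D) (T r c)"
                by (rule partial_tableau_pivot[OF tab r(1,2) c r(3)])
              show "inj_on ?\<beta> (insert r U)"
                by (rule inj')
              show "?\<beta> ` insert r U \<subseteq> {..<Suc c} - columns_of K ` {..<m}"
                unfolding im Suc_c using sub by (rule insert_mono)
              show "X = 0 \<and> {..<Suc c} - columns_of K ` {..<m} \<subseteq> ?\<beta> ` insert r U \<or>
                  X = 1 \<and> dependent_outside (columns_of K)"
                unfolding im Suc_c using X by (meson insert_mono)
              show "state (pivot r c T D) (insert r U) s" "env K (T r c) X Y s"
                using s by blast+
            qed
            with s show "?Q s" by simp
          qed
          moreover have "state T U s \<and> env K D X Y s \<and> s rC = int c \<and> s rR = int r"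
            using s r(4) by simp
          ultimately show "\<exists>P'. P' s \<and> triple L W P' pivot_prog ?Q"
            by (intro exI conjI)
        qed
        show "triple L W (\<lambda>s. ?R s \<and> \<not> 0 < exp_val (Plus (reg rR) (Const 1)) s) (Store (Const rX) (Const 1)) ?Q"
        proof (rule triple_Store)
          fix s assume s: "?R s \<and> \<not> 0 < exp_val (Plus (reg rR) (Const 1)) s"
          then have "dependent_outside (columns_of K)"
            using no_pivot_imp_dependent[OF tab c False inj sub] by auto
          moreover have "state T U (s(rX := 1))" "env K D 1 Y (s(rX := 1))" "(s(rX := 1)) rC = int c"
            using s by (auto simp: state_reg env_def)
          moreover have "\<beta> ` U \<subseteq> {..<Suc c} - columns_of K ` {..<m}"
            using sub by auto
          ultimately have "?Q (s(rX := 1))"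
            unfolding eliminated_def using tab inj by blast
          then show "\<bar>exp_val (Const 1) s\<bar> \<le> 2 ^ W \<and> ?Q (s(exp_val (Const rX) s := exp_val (Const 1) s))"
            by simp
        qed
      qed
      from triple_Seq[OF find_triple[OF c] this] show ?thesis
        by (rule triple_pre) (rule conjunct1)
    qed
  qed
  with s0 show "\<exists>P'. P' s0 \<and> triple L W P' (Cond (outside_exp m) ?B Skip) ?Q"
    by (intro exI conjI)
qed

lemma eliminate_triple:
  "triple L W (\<lambda>s. state a {} s \<and> env K 1 0 Y s) (eliminate_prog m) (eliminated K Y n)"
  unfolding eliminate_prog_def
proof (rule triple_For[where N = n and I = "eliminated K Y"])
  fix s assume "state a {} s \<and> env K 1 0 Y s"
  then show "eliminated K Y 0 s"
    unfolding eliminated_def using partial_tableau_empty[of id]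
    by (intro exI[of _ id] exI[of _ "{}"] exI[of _ a] exI[of _ 1] exI[of _ 0]) simp
next
  fix c s assume "eliminated K Y c s"
  then show "exp_val cols_exp s = int n"
    by (auto simp: eliminated_def state_dims)
next
  fix c s v assume "eliminated K Y c s"
  then show "eliminated K Y c (s(rC := v))"
    by (rule eliminated_upd) auto
qed (rule eliminate_step rows_cols_le_L le_L_imp_nat | assumption)+

text \<open>At most \<open>m\<close> columns are excluded, so at least \<open>d\<close> remain, each
  with a row of its own. Hence every row is used and no unit vector is left.\<close>

lemma eliminated_imp_tableau:
  assumes tab: "partial_tableau \<beta> U T D" and inj: "inj_on \<beta> U"
    and im: "\<beta> ` U = {..<n} - columns_of K ` {..<m}"
  shows "tableau (columns_of K) \<beta> T D" "U = {..<d}"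
proof -
  have U: "U \<subseteq> {..<d}"
    using tab by (simp add: partial_tableau_def)
  have "d + card (columns_of K ` {..<m}) \<le> d + m"
    using card_image_le[of "{..<m}" "columns_of K"] by simp
  moreover have "card ({..<n} - columns_of K ` {..<m}) = n - card (columns_of K ` {..<m})"
    using columns_of_less by (subst card_Diff_subset) auto
  moreover have "card U = card ({..<n} - columns_of K ` {..<m})"
    using card_image[OF inj] im by simp
  ultimately have "d \<le> card U" by simp
  then show Ud: "U = {..<d}"
    using U by (intro card_seteq) auto
  show "tableau (columns_of K) \<beta> T D"
    using tab inj im unfolding tableau_def partial_tableau_def Ud
    by (auto simp: bij_betw_def basis_matrix_def)
qed

section \<open>The test for lowness\<close>

context
  fixes K :: nat and D :: int and U :: "nat set" and T :: "nat \<Rightarrow> nat \<Rightarrow> int" and \<beta>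
  assumes tab: "partial_tableau \<beta> U T D"
begin

definition column_passes :: "nat \<Rightarrow> bool" where
  "column_passes j \<longleftrightarrow> ((\<exists>i<d. T i j \<noteq> 0) \<longrightarrow> 1 \<le> (\<Sum>i<d. T i j) div D)"

lemma column_sum_triple:
  assumes j: "j < n"
  shows "triple L W
    (\<lambda>s. (state T U s \<and> env K D X Y s \<and> s rJ = int j) \<and> s rS = 0 \<and> s rZ = 0)
    (For rI rows_exp (Seq (Store (Const rS) (Plus (reg rS) (Mem (tab_addr (reg rI) (reg rJ)))))
      (Cond (square_exp (Mem (tab_addr (reg rI) (reg rJ)))) (Store (Const rZ) (Const 1)) Skip)))
    (\<lambda>s. (state T U s \<and> env K D X Y s \<and> s rJ = int j) \<and> s rS = (\<Sum>i<d. T i j) \<and>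
      s rZ = (if \<exists>i<d. T i j \<noteq> 0 then 1 else 0))"
proof (rule triple_For[where N = d and I = "\<lambda>i s. (state T U s \<and> env K D X Y s \<and> s rJ = int j) \<and>
    s rS = (\<Sum>i'<i. T i' j) \<and> s rZ = (if \<exists>i'<i. T i' j \<noteq> 0 then 1 else 0)"])
  let ?F = "\<lambda>s. state T U s \<and> env K D X Y s \<and> s rJ = int j"
  let ?Z = "\<lambda>i. if \<exists>i'<i. T i' j \<noteq> 0 then 1 else 0"
  fix i assume i: "i < d"
  show "triple L W (\<lambda>s. (?F s \<and> s rS = (\<Sum>i'<i. T i' j) \<and> s rZ = ?Z i) \<and> s rI = int i)
    (Seq (Store (Const rS) (Plus (reg rS) (Mem (tab_addr (reg rI) (reg rJ)))))
      (Cond (square_exp (Mem (tab_addr (reg rI) (reg rJ)))) (Store (Const rZ) (Const 1)) Skip))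
    (\<lambda>s. (?F s \<and> s rS = (\<Sum>i'<Suc i. T i' j) \<and> s rZ = ?Z (Suc i)) \<and> s rI = int i)"
  proof (rule triple_Seq)
    let ?M = "\<lambda>s. (?F s \<and> s rS = (\<Sum>i'<Suc i. T i' j) \<and> s rZ = ?Z i) \<and> s rI = int i"
    show "triple L W (\<lambda>s. (?F s \<and> s rS = (\<Sum>i'<i. T i' j) \<and> s rZ = ?Z i) \<and> s rI = int i)
      (Store (Const rS) (Plus (reg rS) (Mem (tab_addr (reg rI) (reg rJ))))) ?M"
    proof (rule triple_Store)
      fix s assume s: "(?F s \<and> s rS = (\<Sum>i'<i. T i' j) \<and> s rZ = ?Z i) \<and> s rI = int i"
      have val: "exp_val (Plus (reg rS) (Mem (tab_addr (reg rI) (reg rJ)))) s = (\<Sum>i'<Suc i. T i' j)"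
        using s i j by (clarsimp simp: state_simps)
      have "\<bar>\<Sum>i'<Suc i. T i' j\<bar> \<le> (\<Sum>i'<Suc i. \<bar>T i' j\<bar>)"
        by (rule sum_abs)
      also have "\<dots> \<le> (\<Sum>i'<Suc i. bound)"
        using tableau_le_bound(2)[OF tab] i j by (intro sum_mono) auto
      also have "\<dots> = int (Suc i) * bound"
        by simp
      also have "\<dots> \<le> 2 ^ W"
        using i by (intro bound_le) simp
      finally show "\<bar>exp_val (Plus (reg rS) (Mem (tab_addr (reg rI) (reg rJ)))) s\<bar> \<le> 2 ^ W \<and>
          ?M (s(exp_val (Const rS) s := exp_val (Plus (reg rS) (Mem (tab_addr (reg rI) (reg rJ)))) s))"
        unfolding val using s by (simp add: state_reg env_upd)
    qed
    show "triple L W ?M (Cond (square_exp (Mem (tab_addr (reg rI) (reg rJ)))) (Store (Const rZ) (Const 1)) Skip)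
      (\<lambda>s. (?F s \<and> s rS = (\<Sum>i'<Suc i. T i' j) \<and> s rZ = ?Z (Suc i)) \<and> s rI = int i)"
    proof -
      have test: "0 < exp_val (square_exp (Mem (tab_addr (reg rI) (reg rJ)))) s \<longleftrightarrow> T i j \<noteq> 0" if "?M s" for s
        using that i j by (clarsimp simp: state_simps)
      show ?thesis
      proof (rule triple_Cond)
        show "triple L W (\<lambda>s. ?M s \<and> 0 < exp_val (square_exp (Mem (tab_addr (reg rI) (reg rJ)))) s)
          (Store (Const rZ) (Const 1))
          (\<lambda>s. (?F s \<and> s rS = (\<Sum>i'<Suc i. T i' j) \<and> s rZ = ?Z (Suc i)) \<and> s rI = int i)"
        proof (rule triple_Store)
          fix s assume s: "?M s \<and> 0 < exp_val (square_exp (Mem (tab_addr (reg rI) (reg rJ)))) s"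
          then have "T i j \<noteq> 0" using test by blast
          then have Z: "?Z (Suc i) = (1 :: int)" by auto
          show "\<bar>exp_val (Const 1) s\<bar> \<le> 2 ^ W \<and>
            (?F (s(exp_val (Const rZ) s := exp_val (Const 1) s)) \<and>
            (s(exp_val (Const rZ) s := exp_val (Const 1) s)) rS = (\<Sum>i'<Suc i. T i' j) \<and>
            (s(exp_val (Const rZ) s := exp_val (Const 1) s)) rZ = ?Z (Suc i)) \<and>
            (s(exp_val (Const rZ) s := exp_val (Const 1) s)) rI = int i"
            unfolding Z using s by (simp add: state_reg env_upd)
        qed
        show "triple L W (\<lambda>s. ?M s \<and> \<not> 0 < exp_val (square_exp (Mem (tab_addr (reg rI) (reg rJ)))) s) Skip
          (\<lambda>s. (?F s \<and> s rS = (\<Sum>i'<Suc i. T i' j) \<and> s rZ = ?Z (Suc i)) \<and> s rI = int i)"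
        proof (rule triple_Skip)
          fix s assume s: "?M s \<and> \<not> 0 < exp_val (square_exp (Mem (tab_addr (reg rI) (reg rJ)))) s"
          then have "T i j = 0" using test by blast
          then have "(\<exists>i'<Suc i. T i' j \<noteq> 0) \<longleftrightarrow> (\<exists>i'<i. T i' j \<noteq> 0)"
            by (metis less_Suc_eq)
          with s show "(?F s \<and> s rS = (\<Sum>i'<Suc i. T i' j) \<and> s rZ = ?Z (Suc i)) \<and> s rI = int i"
            by simp
        qed
      qed
    qed
  qed
next
  fix i s v
  assume "(state T U s \<and> env K D X Y s \<and> s rJ = int j) \<and>
    s rS = (\<Sum>i'<i. T i' j) \<and> s rZ = (if \<exists>i'<i. T i' j \<noteq> 0 then 1 else 0)"
  then show "(state T U (s(rI := v)) \<and> env K D X Y (s(rI := v)) \<and> (s(rI := v)) rJ = int j) \<and>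
    (s(rI := v)) rS = (\<Sum>i'<i. T i' j) \<and> (s(rI := v)) rZ = (if \<exists>i'<i. T i' j \<noteq> 0 then 1 else 0)"
    by (simp add: state_reg env_upd)
next
  fix i s
  assume "(state T U s \<and> env K D X Y s \<and> s rJ = int j) \<and>
    s rS = (\<Sum>i'<i. T i' j) \<and> s rZ = (if \<exists>i'<i. T i' j \<noteq> 0 then 1 else 0)"
  then show "exp_val rows_exp s = int d"
    by (clarsimp simp: state_dims)
qed (use rows_cols_le_L le_L_imp_nat in simp_all)

text \<open>The test also runs on an incomplete tableau; the flag is then 1 already and stays
  1.\<close>

lemma lower_triple:
  assumes "X = 0 \<or> X = 1"
  shows "triple L W (\<lambda>s. state T U s \<and> env K D X Y s) lower_prog
    (\<lambda>s. state T U s \<and> env K D (if X = 0 \<and> lower_test T D then 0 else 1) Y s)"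
  unfolding lower_prog_def
proof (rule triple_For[where N = n and
    I = "\<lambda>j s. state T U s \<and> env K D (if X = 0 \<and> (\<forall>j'<j. column_passes j') then 0 else 1) Y s"])
  fix j assume j: "j < n"
  let ?X = "\<lambda>j. if X = 0 \<and> (\<forall>j'<j. column_passes j') then 0 else 1"
  let ?F = "\<lambda>s. state T U s \<and> env K D (?X j) Y s \<and> s rJ = int j"
  let ?Q = "\<lambda>s. (state T U s \<and> env K D (?X (Suc j)) Y s) \<and> s rJ = int j"
  let ?R = "\<lambda>s. ?F s \<and> s rS = (\<Sum>i<d. T i j) \<and> s rZ = (if \<exists>i<d. T i j \<noteq> 0 then 1 else 0)"
  let ?e = "Times (reg rZ) (Minus (Const 1) (Quot (reg rS) (reg rD)))"
  have 1: "triple L W (\<lambda>s. (state T U s \<and> env K D (?X j) Y s) \<and> s rJ = int j) (Store (Const rS) (Const 0))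
      (\<lambda>s. ?F s \<and> s rS = 0)"
    by (rule triple_Store) (simp add: state_reg env_upd)
  have 2: "triple L W (\<lambda>s. ?F s \<and> s rS = 0) (Store (Const rZ) (Const 0)) (\<lambda>s. ?F s \<and> s rS = 0 \<and> s rZ = 0)"
    by (rule triple_Store) (simp add: state_reg env_upd)
  have test: "0 < exp_val ?e s \<longleftrightarrow> \<not> column_passes j" if "?R s" for s
    using that by (auto simp: column_passes_def env_def)
  have 3: "triple L W ?R (Cond ?e (Store (Const rX) (Const 1)) Skip) ?Q"
  proof (rule triple_Cond)
    show "triple L W (\<lambda>s. ?R s \<and> 0 < exp_val ?e s) (Store (Const rX) (Const 1)) ?Q"
    proof (rule triple_Store)
      fix s assume s: "?R s \<and> 0 < exp_val ?e s"
      then have "\<not> column_passes j" using test by blast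
      then have X: "?X (Suc j) = (1 :: int)" by auto
      show "\<bar>exp_val (Const 1) s\<bar> \<le> 2 ^ W \<and> ?Q (s(exp_val (Const rX) s := exp_val (Const 1) s))"
        unfolding X using s by (simp add: state_reg env_def)
    qed
    show "triple L W (\<lambda>s. ?R s \<and> \<not> 0 < exp_val ?e s) Skip ?Q"
    proof (rule triple_Skip)
      fix s assume s: "?R s \<and> \<not> 0 < exp_val ?e s"
      then have "column_passes j" using test by blast
      then have "(\<forall>j'<Suc j. column_passes j') \<longleftrightarrow> (\<forall>j'<j. column_passes j')"
        by (metis less_Suc_eq)
      then show "?Q s" using s by simp
    qed
  qed
  show "triple L W (\<lambda>s. (state T U s \<and> env K D (?X j) Y s) \<and> s rJ = int j)
    (Seq (Store (Const rS) (Const 0)) (Seq (Store (Const rZ) (Const 0)) (Seq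
    (For rI rows_exp (Seq (Store (Const rS) (Plus (reg rS) (Mem (tab_addr (reg rI) (reg rJ)))))
      (Cond (square_exp (Mem (tab_addr (reg rI) (reg rJ)))) (Store (Const rZ) (Const 1)) Skip)))
    (Cond ?e (Store (Const rX) (Const 1)) Skip)))) ?Q"
    by (rule triple_Seq[OF 1 triple_Seq[OF 2 triple_Seq[OF column_sum_triple[OF j] 3]]])
next
  fix j s v
  assume "state T U s \<and> env K D (if X = 0 \<and> (\<forall>j'<j. column_passes j') then 0 else 1) Y s"
  then show "state T U (s(rJ := v)) \<and> env K D (if X = 0 \<and> (\<forall>j'<j. column_passes j') then 0 else 1) Y (s(rJ := v))"
    by (simp add: state_reg env_upd)
next
  fix j s
  assume "state T U s \<and> env K D (if X = 0 \<and> (\<forall>j'<j. column_passes j') then 0 else 1) Y s"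
  then show "exp_val cols_exp s = int n"
    by (clarsimp simp: state_dims)
next
  fix s
  assume "state T U s \<and> env K D (if X = 0 \<and> (\<forall>j'<n. column_passes j') then 0 else 1) Y s"
  then show "state T U s \<and> env K D (if X = 0 \<and> lower_test T D then 0 else 1) Y s"
    by (simp add: lower_test_def column_passes_def)
qed (use assms rows_cols_le_L le_L_imp_nat in auto)

end

section \<open>The search for representatives\<close>

lemma exp_val_floor_exp:
  assumes "state T U s" "env K D X Y s" "s rU = int u" "s rI = int i" "i < d"
  shows "exp_val (floor_exp m) s = (\<Sum>j<m. T i (columns_of K j) * int (digit (d + 1) j u)) div D"
proof -
  have "exp_val (Times (Mem (tab_addr (reg rI) (column_exp j))) (digit_exp (Plus rows_exp (Const 1)) j (reg rU))) s =
      T i (columns_of K j) * int (digit (d + 1) j u)" if "j < m" for j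
  proof -
    have "exp_val (column_exp j) s = int (columns_of K j)"
      using assms(1,2) by (intro exp_val_column_exp) (auto simp: env_def)
    then have "exp_val (tab_addr (reg rI) (column_exp j)) s = tab_pos i (columns_of K j)"
      using assms by (intro exp_val_tab_addr) auto
    moreover have "exp_val (digit_exp (Plus rows_exp (Const 1)) j (reg rU)) s = int (digit (d + 1) j u)"
      using assms by (intro exp_val_digit_exp) (auto simp: state_dims)
    ultimately show ?thesis
      using assms columns_of_less[OF that] by (simp add: state_tab_val)
  qed
  then show ?thesis
    using assms(2) by (simp add: floor_exp_def env_def)
qed

lemma exp_val_difference_exp:
  assumes "state T U s" "env K D X Y s" "s rU = int u" "s rV = int v" "s rI = int i" "i < d"
  shows "exp_val (difference_exp m) s =
    (\<Sum>j<m. T i (columns_of K j) * (int (digit (d + 2) j v) - int (digit (d + 1) j u)))"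
proof -
  have "exp_val (Times (Mem (tab_addr (reg rI) (column_exp j)))
      (Minus (digit_exp (Plus rows_exp (Const 2)) j (reg rV)) (digit_exp (Plus rows_exp (Const 1)) j (reg rU)))) s =
      T i (columns_of K j) * (int (digit (d + 2) j v) - int (digit (d + 1) j u))" if "j < m" for j
  proof -
    have "exp_val (column_exp j) s = int (columns_of K j)"
      using assms(1,2) by (intro exp_val_column_exp) (auto simp: env_def)
    then have "exp_val (tab_addr (reg rI) (column_exp j)) s = tab_pos i (columns_of K j)"
      using assms by (intro exp_val_tab_addr) auto
    moreover have "exp_val (digit_exp (Plus rows_exp (Const 1)) j (reg rU)) s = int (digit (d + 1) j u)"
      "exp_val (digit_exp (Plus rows_exp (Const 2)) j (reg rV)) s = int (digit (d + 2) j v)"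
      using assms by (intro exp_val_digit_exp; auto simp: state_dims)+
    ultimately show ?thesis
      using assms columns_of_less[OF that] by (simp add: state_tab_val)
  qed
  then show ?thesis
    by (simp add: difference_exp_def)
qed

context
  fixes K :: nat and D :: int and U :: "nat set" and T :: "nat \<Rightarrow> nat \<Rightarrow> int"
begin

definition row_good :: "nat \<Rightarrow> nat \<Rightarrow> nat \<Rightarrow> bool" where
  "row_good v u i \<longleftrightarrow> (\<Sum>j<m. T i (columns_of K j) * int (digit (d + 1) j u)) div D \<le> 0 \<and>
    D dvd (\<Sum>j<m. T i (columns_of K j) * (int (digit (d + 2) j v) - int (digit (d + 1) j u)))"

definition cover_frame :: "int \<Rightarrow> nat \<Rightarrow> nat \<Rightarrow> int \<Rightarrow> memory \<Rightarrow> bool" where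
  "cover_frame Y v u f s \<longleftrightarrow> state T U s \<and> env K D 0 Y s \<and> s rV = int v \<and> s rU = int u \<and> s rF = f"

lemma cover_frame_upd:
  "cover_frame Y v u f s \<Longrightarrow> x < 0 \<Longrightarrow> x \<notin> {rK, rD, rX, rY, rV, rU, rF} \<Longrightarrow> cover_frame Y v u f (s(x := w))"
  by (simp add: cover_frame_def state_reg env_upd)

lemma representative_triple:
  "triple L W (cover_frame Y v u f) (representative_prog m)
    (\<lambda>s. cover_frame Y v u f s \<and> s rO = (if \<forall>i<d. row_good v u i then 1 else 0))"
  unfolding representative_prog_def
proof (rule triple_Seq)
  let ?F = "cover_frame Y v u f"
  let ?O = "\<lambda>i. if \<forall>i'<i. row_good v u i' then 1 else 0"
  let ?d = "square_exp (Minus (difference_exp m) (Times (reg rD) (Quot (difference_exp m) (reg rD))))"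
  show "triple L W ?F (Store (Const rO) (Const 1)) (\<lambda>s. ?F s \<and> s rO = 1)"
    by (rule triple_Store) (simp add: cover_frame_upd)
  show "triple L W (\<lambda>s. ?F s \<and> s rO = 1)
    (For rI rows_exp (Seq (Cond (floor_exp m) (Store (Const rO) (Const 0)) Skip)
      (Cond ?d (Store (Const rO) (Const 0)) Skip)))
    (\<lambda>s. ?F s \<and> s rO = (if \<forall>i<d. row_good v u i then 1 else 0))"
  proof (rule triple_For[where N = d and I = "\<lambda>i s. ?F s \<and> s rO = ?O i"])
    fix i assume i: "i < d"
    let ?E = "(\<Sum>j<m. T i (columns_of K j) * int (digit (d + 1) j u)) div D"
    let ?G = "(\<Sum>j<m. T i (columns_of K j) * (int (digit (d + 2) j v) - int (digit (d + 1) j u)))"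
    let ?M = "\<lambda>s. (?F s \<and> s rO = (if ?E \<le> 0 then ?O i else 0)) \<and> s rI = int i"
    have fl: "exp_val (floor_exp m) s = ?E" if "?F s" "s rI = int i" for s
      using that i by (intro exp_val_floor_exp) (auto simp: cover_frame_def)
    have df: "0 < exp_val ?d s \<longleftrightarrow> \<not> D dvd ?G" if "?F s" "s rI = int i" for s
    proof -
      have "exp_val (difference_exp m) s = ?G"
        using that i by (intro exp_val_difference_exp) (auto simp: cover_frame_def)
      moreover have "s rD = D"
        using that by (simp add: cover_frame_def env_def)
      ultimately show ?thesis
        by (simp add: minus_mult_div_eq_mod dvd_eq_mod_eq_0)
    qed
    show "triple L W (\<lambda>s. (?F s \<and> s rO = ?O i) \<and> s rI = int i)
      (Seq (Cond (floor_exp m) (Store (Const rO) (Const 0)) Skip) (Cond ?d (Store (Const rO) (Const 0)) Skip))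
      (\<lambda>s. (?F s \<and> s rO = ?O (Suc i)) \<and> s rI = int i)"
    proof (rule triple_Seq)
      show "triple L W (\<lambda>s. (?F s \<and> s rO = ?O i) \<and> s rI = int i)
        (Cond (floor_exp m) (Store (Const rO) (Const 0)) Skip) ?M"
        by (rule triple_Cond; rule triple_Store triple_Skip) (auto simp: fl cover_frame_upd)
      have O: "?O (Suc i) = (if D dvd ?G then if ?E \<le> 0 then ?O i else 0 else (0 :: int))"
        by (auto simp: row_good_def less_Suc_eq)
      show "triple L W ?M (Cond ?d (Store (Const rO) (Const 0)) Skip)
        (\<lambda>s. (?F s \<and> s rO = ?O (Suc i)) \<and> s rI = int i)"
        unfolding O
      proof (rule triple_Cond)
        show "triple L W (\<lambda>s. ?M s \<and> 0 < exp_val ?d s) (Store (Const rO) (Const 0))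
          (\<lambda>s. (?F s \<and> s rO = (if D dvd ?G then if ?E \<le> 0 then ?O i else 0 else 0)) \<and> s rI = int i)"
        proof (rule triple_Store)
          fix s assume s: "?M s \<and> 0 < exp_val ?d s"
          then have "\<not> D dvd ?G"
            using df[of s] by blast
          with s show "\<bar>exp_val (Const 0) s\<bar> \<le> 2 ^ W \<and>
            (?F (s(exp_val (Const rO) s := exp_val (Const 0) s)) \<and>
            (s(exp_val (Const rO) s := exp_val (Const 0) s)) rO =
              (if D dvd ?G then if ?E \<le> 0 then ?O i else 0 else 0)) \<and>
            (s(exp_val (Const rO) s := exp_val (Const 0) s)) rI = int i"
            by (simp only: if_False) (simp add: cover_frame_upd)
        qed
        show "triple L W (\<lambda>s. ?M s \<and> \<not> 0 < exp_val ?d s) Skip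
          (\<lambda>s. (?F s \<and> s rO = (if D dvd ?G then if ?E \<le> 0 then ?O i else 0 else 0)) \<and> s rI = int i)"
        proof (rule triple_Skip)
          fix s assume s: "?M s \<and> \<not> 0 < exp_val ?d s"
          then have "D dvd ?G"
            using df[of s] by blast
          with s show "(?F s \<and> s rO = (if D dvd ?G then if ?E \<le> 0 then ?O i else 0 else 0)) \<and> s rI = int i"
            by (simp only: if_True)
        qed
      qed
    qed
  next
    fix i s w assume "?F s \<and> s rO = ?O i"
    then show "?F (s(rI := w)) \<and> (s(rI := w)) rO = ?O i"
      by (simp add: cover_frame_upd)
  next
    fix i s assume "?F s \<and> s rO = ?O i"
    then show "exp_val rows_exp s = int d"
      by (clarsimp simp: cover_frame_def state_dims)
  qed (use rows_cols_le_L le_L_imp_nat in simp_all)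
qed

definition search_frame :: "int \<Rightarrow> nat \<Rightarrow> int \<Rightarrow> memory \<Rightarrow> bool" where
  "search_frame Y v f s \<longleftrightarrow> state T U s \<and> env K D 0 Y s \<and> s rV = int v \<and> s rF = f"

definition found :: "nat \<Rightarrow> nat \<Rightarrow> bool" where
  "found v N \<longleftrightarrow> (\<exists>u<N. \<forall>i<d. row_good v u i)"

lemma search_triple:
  "triple L W (search_frame Y v 0)
    (For rU (power_exp (Plus rows_exp (Const 1)) m)
      (Seq (representative_prog m) (Cond (reg rO) (Store (Const rF) (Const 1)) Skip)))
    (search_frame Y v (if found v ((d + 1) ^ m) then 1 else 0))"
proof (rule triple_For[where N = "(d + 1) ^ m" and I = "\<lambda>u. search_frame Y v (if found v u then 1 else 0)"])
  fix u
  let ?f = "\<lambda>u. if found v u then 1 else 0"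
  let ?R = "\<lambda>s. cover_frame Y v u (?f u) s \<and> s rO = (if \<forall>i<d. row_good v u i then 1 else 0)"
  let ?Q = "\<lambda>s. search_frame Y v (?f (Suc u)) s \<and> s rU = int u"
  have Suc_u: "found v (Suc u) \<longleftrightarrow> found v u \<or> (\<forall>i<d. row_good v u i)"
    by (auto simp: found_def less_Suc_eq)
  have 1: "triple L W (\<lambda>s. search_frame Y v (?f u) s \<and> s rU = int u) (representative_prog m) ?R"
    by (rule triple_pre[OF representative_triple]) (auto simp: search_frame_def cover_frame_def)
  have 2: "triple L W ?R (Cond (reg rO) (Store (Const rF) (Const 1)) Skip) ?Q"
  proof (rule triple_Cond)
    show "triple L W (\<lambda>s. ?R s \<and> 0 < exp_val (reg rO) s) (Store (Const rF) (Const 1)) ?Q"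
    proof (rule triple_Store)
      fix s assume s: "?R s \<and> 0 < exp_val (reg rO) s"
      then have "\<forall>i<d. row_good v u i"
        by (auto split: if_splits)
      then have f: "?f (Suc u) = (1 :: int)"
        by (simp add: Suc_u)
      show "\<bar>exp_val (Const 1) s\<bar> \<le> 2 ^ W \<and> ?Q (s(exp_val (Const rF) s := exp_val (Const 1) s))"
        unfolding f using s by (simp add: search_frame_def cover_frame_def state_reg env_upd)
    qed
    show "triple L W (\<lambda>s. ?R s \<and> \<not> 0 < exp_val (reg rO) s) Skip ?Q"
    proof (rule triple_Skip)
      fix s assume s: "?R s \<and> \<not> 0 < exp_val (reg rO) s"
      then have "\<not> (\<forall>i<d. row_good v u i)"
        by (auto split: if_splits)
      then have f: "?f (Suc u) = (?f u :: int)"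
        by (simp only: Suc_u simp_thms)
      show "?Q s"
        unfolding f using s by (simp add: search_frame_def cover_frame_def)
    qed
  qed
  show "triple L W (\<lambda>s. search_frame Y v (?f u) s \<and> s rU = int u)
    (Seq (representative_prog m) (Cond (reg rO) (Store (Const rF) (Const 1)) Skip)) ?Q"
    by (rule triple_Seq[OF 1 2])
next
  fix u s w assume "search_frame Y v (if found v u then 1 else 0) s"
  then show "search_frame Y v (if found v u then 1 else 0) (s(rU := w))"
    by (simp add: search_frame_def state_reg env_upd)
next
  fix u s assume "search_frame Y v (if found v u then 1 else 0) s"
  then show "exp_val (power_exp (Plus rows_exp (Const 1)) m) s = int ((d + 1) ^ m)"
    by (clarsimp simp: search_frame_def state_dims add.commute)
next
  show "(d + 1) ^ m \<le> L" "(d + 1) ^ m \<le> 2 ^ W"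
    using power_le_L[of "d + 1" m] le_L_imp_nat by auto
next
  fix s assume "search_frame Y v 0 s"
  then show "search_frame Y v (if found v 0 then 1 else 0) s"
    by (simp add: found_def)
qed

text \<open>Digits in base \<open>d + 2\<close> range over 0 to \<open>d + 1\<close> and digits in
  base \<open>d + 1\<close> over 0 to \<open>d\<close>, so the two counters enumerate exactly the
  two boxes of \<open>cover_test\<close>.\<close>

lemma cover_test_iff:
  "cover_test (columns_of K) T D \<longleftrightarrow> (\<forall>v<(d + 2) ^ m. found v ((d + 1) ^ m))"
proof
  assume test: "cover_test (columns_of K) T D"
  show "\<forall>v<(d + 2) ^ m. found v ((d + 1) ^ m)"
  proof (intro allI impI)
    fix v
    have "\<forall>j<m. digit (d + 2) j v \<le> Suc d"
      by (simp add: digit_def flip: less_Suc_eq_le)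
    with test[unfolded cover_test_def, THEN spec, of "\<lambda>j. digit (d + 2) j v"]
    obtain u' where u': "\<forall>j<m. u' j \<le> d"
      "good_representative (columns_of K) T D (\<lambda>j. int (digit (d + 2) j v)) u'"
      by (elim impE) auto
    from u'(1) have "\<forall>j<m. u' j < d + 1"
      by auto
    from ex_digits[OF this] obtain u where u: "u < (d + 1) ^ m" "\<forall>j<m. digit (d + 1) j u = u' j"
      by blast
    have "row_good v u i" if "i < d" for i
      using u'(2) u(2) that by (simp add: good_representative_def row_good_def)
    with u(1) show "found v ((d + 1) ^ m)"
      unfolding found_def by blast
  qed
next
  assume all: "\<forall>v<(d + 2) ^ m. found v ((d + 1) ^ m)"
  show "cover_test (columns_of K) T D"
    unfolding cover_test_def
  proof (intro allI impI)
    fix v' :: "nat \<Rightarrow> nat" assume "\<forall>j<m. v' j \<le> Suc d"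
    then have "\<forall>j<m. v' j < d + 2" by auto
    from ex_digits[OF this] obtain v where v: "v < (d + 2) ^ m" "\<forall>j<m. digit (d + 2) j v = v' j"
      by blast
    with all obtain u where u: "\<forall>i<d. row_good v u i"
      unfolding found_def by blast
    have "good_representative (columns_of K) T D (\<lambda>j. int (v' j)) (\<lambda>j. digit (d + 1) j u)"
      unfolding good_representative_def using u v(2) by (simp add: row_good_def)
    moreover have "digit (d + 1) j u \<le> d" for j
      by (simp add: digit_def flip: less_Suc_eq_le)
    ultimately show "\<exists>u. (\<forall>j<m. u j \<le> d) \<and> good_representative (columns_of K) T D (\<lambda>j. int (v' j)) u"
      by (intro exI[of _ "\<lambda>j. digit (d + 1) j u"]) simp
  qed
qed

lemma cover_triple:
  "triple L W (\<lambda>s. state T U s \<and> env K D 0 Y s) (cover_prog m)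
    (\<lambda>s. state T U s \<and> env K D 0 (if cover_test (columns_of K) T D then Y else 0) s)"
  unfolding cover_prog_def
proof (rule triple_For[where N = "(d + 2) ^ m" and
    I = "\<lambda>v s. state T U s \<and> env K D 0 (if \<forall>v'<v. found v' ((d + 1) ^ m) then Y else 0) s"])
  fix v
  let ?Y = "\<lambda>v. if \<forall>v'<v. found v' ((d + 1) ^ m) then Y else 0"
  let ?f = "if found v ((d + 1) ^ m) then 1 else 0"
  let ?Q = "\<lambda>s. (state T U s \<and> env K D 0 (?Y (Suc v)) s) \<and> s rV = int v"
  have 1: "triple L W (\<lambda>s. (state T U s \<and> env K D 0 (?Y v) s) \<and> s rV = int v)
      (Store (Const rF) (Const 0)) (search_frame (?Y v) v 0)"
    by (rule triple_Store) (simp add: search_frame_def state_reg env_upd)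
  have 2: "triple L W (search_frame (?Y v) v ?f) (Cond (reg rF) Skip (Store (Const rY) (Const 0))) ?Q"
  proof (rule triple_Cond)
    show "triple L W (\<lambda>s. search_frame (?Y v) v ?f s \<and> 0 < exp_val (reg rF) s) Skip ?Q"
    proof (rule triple_Skip)
      fix s assume s: "search_frame (?Y v) v ?f s \<and> 0 < exp_val (reg rF) s"
      then have "found v ((d + 1) ^ m)"
        by (auto simp: search_frame_def split: if_splits)
      then have "(\<forall>v'<Suc v. found v' ((d + 1) ^ m)) \<longleftrightarrow> (\<forall>v'<v. found v' ((d + 1) ^ m))"
        by (metis less_Suc_eq)
      with s show "?Q s"
        by (simp only: search_frame_def simp_thms)
    qed
    show "triple L W (\<lambda>s. search_frame (?Y v) v ?f s \<and> \<not> 0 < exp_val (reg rF) s) (Store (Const rY) (Const 0)) ?Q"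
    proof (rule triple_Store)
      fix s assume s: "search_frame (?Y v) v ?f s \<and> \<not> 0 < exp_val (reg rF) s"
      then have "\<not> found v ((d + 1) ^ m)"
        by (auto simp: search_frame_def split: if_splits)
      then have Y: "?Y (Suc v) = 0"
        by auto
      show "\<bar>exp_val (Const 0) s\<bar> \<le> 2 ^ W \<and> ?Q (s(exp_val (Const rY) s := exp_val (Const 0) s))"
        unfolding Y using s by (simp add: search_frame_def state_reg env_def)
    qed
  qed
  show "triple L W (\<lambda>s. (state T U s \<and> env K D 0 (?Y v) s) \<and> s rV = int v)
    (Seq (Store (Const rF) (Const 0)) (Seq
    (For rU (power_exp (Plus rows_exp (Const 1)) m)
      (Seq (representative_prog m) (Cond (reg rO) (Store (Const rF) (Const 1)) Skip)))
    (Cond (reg rF) Skip (Store (Const rY) (Const 0))))) ?Q"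
    by (rule triple_Seq[OF 1 triple_Seq[OF search_triple 2]])
next
  fix v s w
  assume "state T U s \<and> env K D 0 (if \<forall>v'<v. found v' ((d + 1) ^ m) then Y else 0) s"
  then show "state T U (s(rV := w)) \<and> env K D 0 (if \<forall>v'<v. found v' ((d + 1) ^ m) then Y else 0) (s(rV := w))"
    by (simp add: state_reg env_upd)
next
  fix v s
  assume "state T U s \<and> env K D 0 (if \<forall>v'<v. found v' ((d + 1) ^ m) then Y else 0) s"
  then show "exp_val (power_exp (Plus rows_exp (Const 2)) m) s = int ((d + 2) ^ m)"
    by (clarsimp simp: state_dims add.commute)
next
  show "(d + 2) ^ m \<le> L" "(d + 2) ^ m \<le> 2 ^ W"
    using power_le_L[of "d + 2" m] le_L_imp_nat by auto
next
  fix s assume "state T U s \<and> env K D 0 (if \<forall>v'<(d + 2) ^ m. found v' ((d + 1) ^ m) then Y else 0) s"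
  then show "state T U s \<and> env K D 0 (if cover_test (columns_of K) T D then Y else 0) s"
    by (simp only: cover_test_iff)
qed simp

end

section \<open>The verdict over all index sets\<close>

definition index_set_passes :: "nat \<Rightarrow> bool" where
  "index_set_passes K \<longleftrightarrow> dependent_outside (columns_of K) \<or>
    (\<exists>\<beta> T D. tableau (columns_of K) \<beta> T D \<and> passes (columns_of K) T D)"

definition index_set_fails :: bool where
  "index_set_fails \<longleftrightarrow> (\<exists>K \<beta> T D. tableau (columns_of K) \<beta> T D \<and> \<not> passes (columns_of K) T D)"

lemma index_set_fails_imp: "index_set_fails \<Longrightarrow> \<not> normal_columns"
  unfolding index_set_fails_def using normal_imp_passes columns_of_less by blast

lemma index_sets_pass_imp:
  assumes "\<forall>K<n ^ m. index_set_passes K"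
  shows normal_columns
proof (rule passes_imp_normal)
  fix I assume "\<forall>j<m. I j < d + m"
  from ex_digits[OF this] obtain K where K: "K < n ^ m" "\<forall>j<m. digit n j K = I j"
    by blast
  have "\<forall>j<m. columns_of K j = I j"
    using K(2) by (simp add: columns_of_def)
  with assms K(1) show "\<exists>I'. (\<forall>j<m. I' j = I j) \<and>
    (dependent_outside I' \<or> (\<exists>\<beta> T D. tableau I' \<beta> T D \<and> passes I' T D))"
    unfolding index_set_passes_def by (intro exI[of _ "columns_of K"]) simp
qed

text \<open>Verdict 0 stands for one failing index set, which refutes normality by itself and makes
  the verdict final; verdict 1 has to remember that all earlier sets passed.\<close>

definition progress :: "nat \<Rightarrow> int \<Rightarrow> bool" where
  "progress K Y \<longleftrightarrow> Y = 1 \<and> (\<forall>K'<K. index_set_passes K') \<or> Y = 0 \<and> index_set_fails"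

lemma progress_passes: "progress K Y \<Longrightarrow> index_set_passes K \<Longrightarrow> progress (Suc K) Y"
  by (auto simp: progress_def less_Suc_eq)

lemma test_triple:
  assumes Y: "progress K Y"
  shows "triple L W (eliminated K Y n) (Seq lower_prog (Cond (reg rX) Skip (cover_prog m)))
    (\<lambda>s. input_part s \<and> progress (Suc K) (s rY) \<and> s rK = int K)"
proof (rule triple_obtain)
  fix s0 assume "eliminated K Y n s0"
  then obtain \<beta> U T D X where tab: "partial_tableau \<beta> U T D" and inj: "inj_on \<beta> U"
    and sub: "\<beta> ` U \<subseteq> {..<n} - columns_of K ` {..<m}"
    and X: "X = 0 \<and> {..<n} - columns_of K ` {..<m} \<subseteq> \<beta> ` U \<or> X = 1 \<and> dependent_outside (columns_of K)"
    and s0: "state T U s0 \<and> env K D X Y s0"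
    unfolding eliminated_def by (elim exE conjE) blast
  have X01: "X = 0 \<or> X = 1"
    using X by blast
  have full: "tableau (columns_of K) \<beta> T D" if "X = 0"
    using that X sub by (intro eliminated_imp_tableau(1)[OF tab inj]) auto
  let ?X = "if X = 0 \<and> lower_test T D then 0 else 1"
  let ?Q = "\<lambda>s. input_part s \<and> progress (Suc K) (s rY) \<and> s rK = int K"
  have "triple L W (\<lambda>s. state T U s \<and> env K D ?X Y s) (Cond (reg rX) Skip (cover_prog m)) ?Q"
  proof (cases "X = 0 \<and> lower_test T D")
    case True
    then have X0: "?X = 0" by simp
    let ?Y = "if cover_test (columns_of K) T D then Y else 0"
    have "progress (Suc K) ?Y"
    proof (cases "cover_test (columns_of K) T D")
      case True
      then have "passes (columns_of K) T D"
        by (simp add: passes_def)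
      with full \<open>X = 0 \<and> lower_test T D\<close> have "index_set_passes K"
        unfolding index_set_passes_def by blast
      with Y True show ?thesis
        by (simp add: progress_passes)
    next
      case False
      then have "\<not> passes (columns_of K) T D"
        using \<open>X = 0 \<and> lower_test T D\<close> by (simp add: passes_def)
      with full \<open>X = 0 \<and> lower_test T D\<close> have index_set_fails
        unfolding index_set_fails_def by blast
      with False show ?thesis
        by (simp add: progress_def)
    qed
    then have post: "?Q s" if "state T U s \<and> env K D 0 ?Y s" for s
      using that by (simp add: state_def env_def)
    show ?thesis
      unfolding X0
    proof (rule triple_Cond)
      show "triple L W (\<lambda>s. (state T U s \<and> env K D 0 Y s) \<and> 0 < exp_val (reg rX) s) Skip ?Q"
        by (rule triple_Skip) (auto simp: env_def)
      show "triple L W (\<lambda>s. (state T U s \<and> env K D 0 Y s) \<and> \<not> 0 < exp_val (reg rX) s) (cover_prog m) ?Q"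
        by (rule triple_conseq[OF cover_triple[of T U K D Y]]) (use post in auto)
    qed
  next
    case False
    then have X1: "?X = 1"
      by (rule if_not_P)
    \<comment> \<open>Either the columns outside are dependent or the basis is not lower; in both
      cases nothing is demanded of this index set.\<close>
    have "index_set_passes K"
      using X full False unfolding index_set_passes_def passes_def by blast
    then have prog: "progress (Suc K) Y"
      by (rule progress_passes[OF Y])
    show ?thesis
      unfolding X1
    proof (rule triple_Cond)
      show "triple L W (\<lambda>s. (state T U s \<and> env K D 1 Y s) \<and> 0 < exp_val (reg rX) s) Skip ?Q"
        by (rule triple_Skip) (use prog in \<open>auto simp: env_def state_def\<close>)
      show "triple L W (\<lambda>s. (state T U s \<and> env K D 1 Y s) \<and> \<not> 0 < exp_val (reg rX) s) (cover_prog m) ?Q"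
        by (auto simp: triple_def env_def)
    qed
  qed
  from triple_Seq[OF lower_triple[OF tab X01] this] s0
  show "\<exists>P'. P' s0 \<and> triple L W P' (Seq lower_prog (Cond (reg rX) Skip (cover_prog m))) ?Q"
    by (intro exI conjI)
qed

lemma normality_triple:
  "triple L W input_part (normality_prog m) (\<lambda>s. s 0 = (if normal_columns then 1 else 0))"
  unfolding normality_prog_def
proof (rule triple_Seq)
  show "triple L W input_part (Store (Const rY) (Const 1)) (\<lambda>s. input_part s \<and> progress 0 (s rY))"
    by (rule triple_Store) (simp add: input_part_upd progress_def)
  let ?N = "\<lambda>s. input_part s \<and> s rY = (if normal_columns then 1 else 0)"
  let ?B = "Seq (Store (Const rX) (Const 0)) (Seq (Store (Const rD) (Const 1))
      (Seq copy_prog (Seq clear_prog (Seq (eliminate_prog m) (Seq lower_prog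
        (Cond (reg rX) Skip (cover_prog m)))))))"
  show "triple L W (\<lambda>s. input_part s \<and> progress 0 (s rY))
    (Seq (For rK (power_exp cols_exp m) ?B) (Store (Const 0) (reg rY)))
    (\<lambda>s. s 0 = (if normal_columns then 1 else 0))"
  proof (rule triple_Seq)
    show "triple L W (\<lambda>s. input_part s \<and> progress 0 (s rY)) (For rK (power_exp cols_exp m) ?B) ?N"
    proof (rule triple_For[where N = "n ^ m" and I = "\<lambda>K s. input_part s \<and> progress K (s rY)"])
      fix K
      let ?Q = "\<lambda>s. (input_part s \<and> progress (Suc K) (s rY)) \<and> s rK = int K"
      show "triple L W (\<lambda>s. (input_part s \<and> progress K (s rY)) \<and> s rK = int K) ?B ?Q"
      proof (rule triple_obtain)
        fix s0 assume s0: "(input_part s0 \<and> progress K (s0 rY)) \<and> s0 rK = int K"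
        define Y where "Y = s0 rY"
        let ?P = "\<lambda>s. input_part s \<and> s rK = int K \<and> s rY = Y"
        have 1: "triple L W ?P (Store (Const rX) (Const 0)) (\<lambda>s. ?P s \<and> s rX = 0)"
          by (rule triple_Store) (simp add: input_part_upd)
        have 2: "triple L W (\<lambda>s. ?P s \<and> s rX = 0) (Store (Const rD) (Const 1)) (\<lambda>s. input_part s \<and> env K 1 0 Y s)"
          by (rule triple_Store) (simp add: input_part_upd env_def)
        have 3: "triple L W (eliminated K Y n) (Seq lower_prog (Cond (reg rX) Skip (cover_prog m))) ?Q"
          using s0 by (intro triple_post[OF test_triple]) (auto simp: Y_def)
        have "triple L W ?P ?B ?Q"
          by (rule triple_Seq[OF 1 triple_Seq[OF 2 triple_Seq[OF copy_triple
            triple_Seq[OF clear_triple triple_Seq[OF eliminate_triple 3]]]]])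
        moreover have "?P s0"
          using s0 by (simp add: Y_def)
        ultimately show "\<exists>P'. P' s0 \<and> triple L W P' ?B ?Q"
          by (intro exI conjI)
      qed
    next
      fix K s v assume "input_part s \<and> progress K (s rY)"
      then show "input_part (s(rK := v)) \<and> progress K ((s(rK := v)) rY)"
        by (simp add: input_part_upd)
    next
      fix K s assume "input_part s \<and> progress K (s rY)"
      then show "exp_val (power_exp cols_exp m) s = int (n ^ m)"
        by (simp add: input_part_dims)
    next
      show "n ^ m \<le> L" "n ^ m \<le> 2 ^ W"
        using power_le_L[of n m] le_L_imp_nat by auto
    next
      fix s assume "input_part s \<and> progress (n ^ m) (s rY)"
      then show "?N s"
        using index_sets_pass_imp index_set_fails_imp unfolding progress_def by auto
    qed
    show "triple L W ?N (Store (Const 0) (reg rY)) (\<lambda>s. s 0 = (if normal_columns then 1 else 0))"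
      by (rule triple_Store) auto
  qed
qed

end

section \<open>Normal matrices and input sizes\<close>

text \<open>By full rank a maximal independent set of columns spans the space. So \<open>g\<close>
  is a combination of columns and orthogonal to each of them, and its sum of squares
  vanishes.\<close>

lemma full_rank_imp_no_annihilator:
  assumes A: "A \<in> carrier_mat d n" and rank: "vec_space.rank d (A :: real mat) = d"
    and ann: "\<And>j. j < n \<Longrightarrow> (\<Sum>k<d. g k * A $$ (k, j)) = 0" and "k < d"
  shows "g k = 0"
proof -
  interpret vec_space "TYPE(real)" d .
  have cols: "set (cols A) \<subseteq> carrier_vec d"
    using A cols_dim by blast
  have "lin_indpt {}"
    by (meson empty_subsetI fin_dim finite_basis_exists subset_li_is_li basis_def)
  then obtain S where S: "finite S" "maximal S (\<lambda>T. T \<subseteq> set (cols A) \<and> lin_indpt T)"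
    using maximal_exists_superset[of "set (cols A)" "\<lambda>T. T \<subseteq> set (cols A) \<and> lin_indpt T" "{}"] by auto
  have S': "S \<subseteq> set (cols A)" "lin_indpt S"
    using S(2) by (auto simp: maximal_def)
  have "card S = d"
    using rank_card_indpt[OF A S(2)] rank by simp
  then have "basis S"
    using S(1) S' cols by (intro dim_li_is_basis) (auto simp: dim_is_n fin_dim)
  then have "vec d g \<in> span S"
    by (auto simp: basis_def)
  then obtain c where c: "vec d g = lincomb c S"
    using finite_span[OF S(1)] S' cols by auto
  have orth: "(\<Sum>k<d. g k * x $ k) = 0" if x: "x \<in> S" for x
  proof -
    obtain j where "j < n" "x = col A j"
      using x S'(1) A by (auto simp: cols_def)
    with ann[of j] A show ?thesis by simp
  qed
  have "(\<Sum>k<d. g k * g k) = (\<Sum>k<d. g k * (\<Sum>x\<in>S. c x * x $ k))"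
  proof (rule sum.cong[OF refl])
    fix k assume "k \<in> {..<d}"
    then have "g k = lincomb c S $ k"
      by (simp flip: c)
    also have "\<dots> = (\<Sum>x\<in>S. c x * x $ k)"
      using \<open>k \<in> {..<d}\<close> S' cols by (intro lincomb_index) auto
    finally show "g k * g k = g k * (\<Sum>x\<in>S. c x * x $ k)"
      by simp
  qed
  also have "\<dots> = (\<Sum>x\<in>S. c x * (\<Sum>k<d. g k * x $ k))"
    unfolding sum_distrib_left by (subst sum.swap) (simp add: mult.left_commute)
  also have "\<dots> = 0"
    by (simp add: orth)
  finally have "\<forall>k\<in>{..<d}. g k * g k = 0"
    by (subst (asm) sum_nonneg_eq_0_iff) auto
  with \<open>k < d\<close> show ?thesis by simp
qed

lemma mult_mat_vec_sum:
  assumes "A \<in> carrier_mat d n" "r \<in> carrier_vec n" "k < d"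
  shows "(A *\<^sub>v r) $ k = (\<Sum>j<n. A $$ (k, j) * r $ j)"
  using assms by (simp add: scalar_prod_def atLeast0LessThan)

lemma (in nonneg_columns) normal_mat_iff_normal_columns:
  assumes A: "A \<in> carrier_mat d (d + m)" and a: "\<And>k j. k < d \<Longrightarrow> j < d + m \<Longrightarrow> a k j = A $$ (k, j)"
  shows "normal_mat A \<longleftrightarrow> normal_columns"
proof -
  let ?A = "map_mat real_of_int A"
  have A': "?A \<in> carrier_mat d (d + m)"
    using A by simp
  have entry: "(?A *\<^sub>v r) $ k = (\<Sum>j<d + m. real_of_int (a k j) * r $ j)"
    if "r \<in> carrier_vec (d + m)" "k < d" for r k
    unfolding mult_mat_vec_sum[OF A' that] using A that by (intro sum.cong) (auto simp: a)
  \<comment> \<open>This inclusion holds for every matrix; normality is about the other one.\<close>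
  have semi: "column_semigroup A \<subseteq> column_cone A \<inter> column_lattice A"
    unfolding column_semigroup_def column_cone_def column_lattice_def column_combinations_def
    by (auto simp: Nats_altdef2)
  show ?thesis
  proof
    assume normal: "normal_mat A"
    show normal_columns
      unfolding normal_columns_def
    proof (intro allI impI)
      fix z :: "nat \<Rightarrow> int" and r :: "nat \<Rightarrow> real"
      assume r: "\<forall>j<d + m. 0 \<le> r j"
        and eq: "\<forall>k<d. (\<Sum>j<d + m. real_of_int (a k j) * r j) = real_of_int (\<Sum>j<d + m. a k j * z j)"
      let ?r = "vec (d + m) r" and ?z = "vec (d + m) (\<lambda>j. real_of_int (z j))"
      have "?A *\<^sub>v ?r = ?A *\<^sub>v ?z"
        using A eq by (intro eq_vecI) (simp_all add: entry del: index_mult_mat_vec)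
      moreover have "?A *\<^sub>v ?r \<in> column_cone A"
        unfolding column_cone_def column_combinations_def using A r by (intro CollectI exI[of _ ?r]) auto
      moreover have "?A *\<^sub>v ?z \<in> column_lattice A"
        unfolding column_lattice_def column_combinations_def using A by (intro CollectI exI[of _ ?z]) auto
      ultimately have "?A *\<^sub>v ?z \<in> column_semigroup A"
        using normal unfolding normal_mat_def by auto
      then obtain w where w: "?A *\<^sub>v ?z = ?A *\<^sub>v w" "w \<in> carrier_vec (d + m)" "\<forall>j<d + m. w $ j \<in> \<nat>"
        using A unfolding column_semigroup_def column_combinations_def by auto
      define u where "u j = (SOME x. w $ j = of_nat x)" for j
      have u: "w $ j = real (u j)" if "j < d + m" for j
      proof -
        have "\<exists>x. w $ j = of_nat x"
          using w(3) that by (auto elim: Nats_cases)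
        then show ?thesis
          unfolding u_def by (rule someI_ex)
      qed
      have "(\<Sum>j<d + m. a k j * int (u j)) = (\<Sum>j<d + m. a k j * z j)" if "k < d" for k
      proof -
        have "real_of_int (\<Sum>j<d + m. a k j * int (u j)) = (?A *\<^sub>v w) $ k"
          unfolding entry[OF w(2) that] by (simp add: u)
        also have "\<dots> = (?A *\<^sub>v ?z) $ k"
          by (simp only: w(1))
        also have "\<dots> = real_of_int (\<Sum>j<d + m. a k j * z j)"
          by (subst entry) (use that in auto)
        finally show ?thesis
          by (simp only: of_int_eq_iff)
      qed
      then show "\<exists>w :: nat \<Rightarrow> nat. \<forall>k<d. (\<Sum>j<d + m. a k j * int (w j)) = (\<Sum>j<d + m. a k j * z j)"
        by blast
    qed
  next
    assume normal: normal_columns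
    have "x \<in> column_semigroup A" if x: "x \<in> column_cone A" "x \<in> column_lattice A" for x
    proof -
      obtain r where r: "x = ?A *\<^sub>v r" "r \<in> carrier_vec (d + m)" "\<forall>j<d + m. 0 \<le> r $ j"
        using x(1) A unfolding column_cone_def column_combinations_def by auto
      obtain y where y: "x = ?A *\<^sub>v y" "y \<in> carrier_vec (d + m)" "\<forall>j<d + m. y $ j \<in> \<int>"
        using x(2) A unfolding column_lattice_def column_combinations_def by auto
      define z where "z j = \<lfloor>y $ j\<rfloor>" for j
      have z: "y $ j = real_of_int (z j)" if "j < d + m" for j
        using y(3) that by (simp add: z_def)
      have "\<forall>k<d. (\<Sum>j<d + m. real_of_int (a k j) * r $ j) = real_of_int (\<Sum>j<d + m. a k j * z j)"
      proof (intro allI impI)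
        fix k assume k: "k < d"
        have "(\<Sum>j<d + m. real_of_int (a k j) * r $ j) = (?A *\<^sub>v y) $ k"
          unfolding entry[OF r(2) k, symmetric] r(1)[symmetric] y(1)[symmetric] ..
        also have "\<dots> = real_of_int (\<Sum>j<d + m. a k j * z j)"
          unfolding entry[OF y(2) k] by (simp add: z)
        finally show "(\<Sum>j<d + m. real_of_int (a k j) * r $ j) = real_of_int (\<Sum>j<d + m. a k j * z j)" .
      qed
      with normal[unfolded normal_columns_def, rule_format, of "\<lambda>j. r $ j" z] r(3)
      obtain w :: "nat \<Rightarrow> nat" where w: "\<forall>k<d. (\<Sum>j<d + m. a k j * int (w j)) = (\<Sum>j<d + m. a k j * z j)"
        by blast
      let ?w = "vec (d + m) (\<lambda>j. real (w j))"
      have "x = ?A *\<^sub>v ?w"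
      proof (rule eq_vecI)
        show "dim_vec x = dim_vec (?A *\<^sub>v ?w)"
          by (simp add: r(1))
        fix k assume "k < dim_vec (?A *\<^sub>v ?w)"
        then have k: "k < d"
          using A by simp
        have "x $ k = real_of_int (\<Sum>j<d + m. a k j * z j)"
          unfolding y(1) entry[OF y(2) k] by (simp add: z)
        also have "\<dots> = real_of_int (\<Sum>j<d + m. a k j * int (w j))"
          using w k by simp
        also have "\<dots> = (?A *\<^sub>v ?w) $ k"
          by (subst entry) (use k in auto)
        finally show "x $ k = (?A *\<^sub>v ?w) $ k" .
      qed
      then show ?thesis
        unfolding column_semigroup_def column_combinations_def using A
        by (intro CollectI exI[of _ ?w]) auto
    qed
    then show "normal_mat A"
      unfolding normal_mat_def using semi by blast
  qed
qed

section \<open>Word length and the polynomial bound\<close>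

lemma entry_le_bit_size:
  assumes "A \<in> carrier_mat d n" "i < d" "j < n"
  shows "A $$ (i, j) \<le> 2 ^ bit_size A"
proof -
  have "bit_length (A $$ (i, j)) \<le> (\<Sum>j<n. bit_length (A $$ (i, j)))"
    using assms by (intro member_le_sum) auto
  also have "\<dots> \<le> (\<Sum>i<d. \<Sum>j<n. bit_length (A $$ (i, j)))"
    using assms by (intro member_le_sum[of i "{..<d}" "\<lambda>i. \<Sum>j<n. bit_length (A $$ (i, j))"]) auto
  also have "\<dots> = bit_size A"
    using assms by (simp add: bit_size_def)
  finally have "(2 :: int) ^ bit_length (A $$ (i, j)) \<le> 2 ^ bit_size A"
    by (intro power_increasing) auto
  then show ?thesis
    using abs_less_bit_length[of "A $$ (i, j)"] by linarith
qed

text \<open>The sum of two exponents: the first bounds the number of rounds, the second bounds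
  \<open>(d + 1) * fact d * M ^ (d + 1)\<close> with \<open>M = 2 ^ b\<close>, where
  \<open>n * n\<close> accounts for \<open>fact d \<le> d ^ d\<close>.\<close>

definition word_size :: "nat \<Rightarrow> nat \<Rightarrow> nat \<Rightarrow> nat" where
  "word_size m n b = (n + 2) * (m + 2) + (n + 1 + n * n + b * (n + 1))"

lemma word_size_ge:
  assumes "d \<le> n"
  shows "(n + 2) ^ (m + 2) \<le> 2 ^ word_size m n b"
    and "(int d + 1) * (fact d * (2 ^ b) ^ Suc d) \<le> 2 ^ word_size m n b"
proof -
  have "(n + 2) ^ (m + 2) \<le> (2 ^ (n + 2)) ^ (m + 2)"
    by (intro power_mono less_imp_le less_exp) simp
  also have "\<dots> = 2 ^ ((n + 2) * (m + 2))"
    by (simp only: power_mult)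
  also have "\<dots> \<le> 2 ^ word_size m n b"
    by (intro power_increasing) (auto simp: word_size_def)
  finally show "(n + 2) ^ (m + 2) \<le> 2 ^ word_size m n b" .
  have 1: "int d + 1 \<le> 2 ^ (n + 1)"
  proof -
    have "d + 1 \<le> n + 1" using assms by simp
    also have "\<dots> \<le> 2 ^ (n + 1)" by (intro less_imp_le less_exp)
    finally have "int (d + 1) \<le> int (2 ^ (n + 1))" by (simp only: of_nat_le_iff)
    then show ?thesis by simp
  qed
  have 2: "fact d \<le> (2 :: int) ^ (n * n)"
  proof -
    have "fact d \<le> d ^ d"
      using fact_le_power[of d, where ?'a = nat] by simp
    also have "d ^ d \<le> (2 ^ n) ^ d"
      by (intro power_mono order_trans[OF assms less_imp_le[OF less_exp]]) simp
    also have "\<dots> \<le> (2 ^ n) ^ n"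
      using assms by (intro power_increasing) auto
    also have "\<dots> = 2 ^ (n * n)"
      by (simp only: power_mult)
    finally have "int (fact d) \<le> int (2 ^ (n * n))"
      by (simp only: of_nat_le_iff)
    then show ?thesis by simp
  qed
  have 3: "((2 :: int) ^ b) ^ Suc d \<le> 2 ^ (b * (n + 1))"
    unfolding power_mult[symmetric] using assms by (intro power_increasing mult_le_mono2) auto
  have "(int d + 1) * (fact d * (2 ^ b) ^ Suc d) \<le> 2 ^ (n + 1) * (2 ^ (n * n) * 2 ^ (b * (n + 1)))"
    using 1 2 3 by (intro mult_mono) auto
  also have "\<dots> = 2 ^ (n + 1 + n * n + b * (n + 1))"
    by (simp add: power_add)
  also have "\<dots> \<le> 2 ^ word_size m n b"
    by (intro power_increasing) (auto simp: word_size_def)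
  finally show "(int d + 1) * (fact d * (2 ^ b) ^ Suc d) \<le> 2 ^ word_size m n b" .
qed

text \<open>The outer indeterminate stands for \<open>n\<close> and the inner one for the bit-size;
  \<open>m\<close>, \<open>C\<close> and \<open>e\<close> are constants.\<close>

lemma word_size_poly:
  "\<exists>p :: nat poly poly. \<forall>n b. poly (poly p [:n:]) b = C * ((n + 2) ^ (m + 2)) ^ e * word_size m n b"
proof -
  let ?N = "[:0, 1:] :: nat poly poly" and ?B = "[:[:0, 1:]:] :: nat poly poly"
  let ?c = "\<lambda>k. [:[:k:]:] :: nat poly poly"
  have ev: "poly (poly ?N [:n:]) b = n" "poly (poly ?B [:n:]) b = b" "poly (poly (?c k) [:n:]) b = k" for n b k
    by simp_all
  show ?thesis
    by (rule exI[of _ "?c C * ((?N + ?c 2) ^ (m + 2)) ^ e *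
      ((?N + ?c 2) * ?c (m + 2) + (?N + ?c 1 + ?N * ?N + ?B * (?N + ?c 1)))"])
      (simp only: word_size_def poly_add poly_mult poly_power ev simp_thms)
qed

theorem theorem2:
  fixes m :: nat
  shows "\<exists>(c :: ram_prog) (p :: nat poly poly). \<forall>(d :: nat) (n :: nat) (A :: int mat).
    A \<in> carrier_mat d n \<longrightarrow>
    (\<forall>i<d. \<forall>j<n. 0 \<le> A $$ (i, j)) \<longrightarrow>
    vec_space.rank d (map_mat real_of_int A) = d \<longrightarrow>
    n = d + m \<longrightarrow>
    (\<exists>t s. runs c (input_memory A) t s \<and>
      s 0 = (if normal_mat A then 1 else 0) \<and>
      t \<le> poly (poly p [:n:]) (bit_size A))"
proof -
  \<comment> \<open>The program depends on \<open>m\<close> only, so these constants and the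
    polynomial are fixed before the matrix is given.\<close>
  obtain C e where Ce: "\<forall>L\<ge>1. prog_weight L (normality_prog m) \<le> C * L ^ e"
    using prog_weight_le_power by blast
  obtain p :: "nat poly poly" where p: "\<And>n b. poly (poly p [:n:]) b = C * ((n + 2) ^ (m + 2)) ^ e * word_size m n b"
    using word_size_poly by blast
  show ?thesis
  proof (intro exI[of _ "normality_prog m"] exI[of _ p] allI impI)
    fix d n :: nat and A :: "int mat"
    assume A: "A \<in> carrier_mat d n" and nn: "\<forall>i<d. \<forall>j<n. 0 \<le> A $$ (i, j)"
      and rank: "vec_space.rank d (map_mat real_of_int A) = d" and n: "n = d + m"
    define a where "a k j = A $$ (k, j)" for k j
    define L where "L = (n + 2) ^ (m + 2)"
    define W where "W = word_size m n (bit_size A)"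
    have basis: "\<exists>\<tau> H. columns.basis d (d + m) (\<lambda>k j. real_of_int (a k j)) \<tau> H"
    proof (rule full_row_rank_imp_basis)
      fix g k assume *: "\<And>j. j < d + m \<Longrightarrow> (\<Sum>k<d. g k * real_of_int (a k j)) = 0" and "k < d"
      show "g k = 0"
        by (rule full_rank_imp_no_annihilator[OF _ rank _ \<open>k < d\<close>, of n])
          (use A * in \<open>auto simp: n a_def\<close>)
    qed
    have ge: "L \<le> 2 ^ W" "(int d + 1) * (fact d * (2 ^ bit_size A) ^ Suc d) \<le> 2 ^ W"
      unfolding L_def W_def using word_size_ge[of d n] n by auto
    interpret normality_run d m a L W "2 ^ bit_size A"
    proof
      show "0 \<le> a k j" "a k j \<le> 2 ^ bit_size A" if "k < d" "j < d + m" for k j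
        using that nn entry_le_bit_size[OF A, of k j] by (simp_all add: a_def n)
      show "1 \<le> W"
        by (simp add: W_def word_size_def)
      show "(d + m + 2) ^ (m + 2) \<le> L"
        by (simp add: L_def n)
    qed (use basis ge in auto)
    have dims: "dim_row A = d" "dim_col A = d + m"
      using A n by auto
    have "input_memory A (2 + int l) = a (l div (d + m)) (l mod (d + m))" if "l < d * (d + m)" for l
    proof -
      have "int l < int (d * (d + m))"
        using that by (simp only: of_nat_less_iff)
      then show ?thesis
        unfolding input_memory_def dims a_def by (simp del: of_nat_mult)
    qed
    then have "input_part (input_memory A)"
      by (simp add: input_part_def) (simp add: input_memory_def dims)
    moreover have "bounded_memory W (input_memory A)"
      unfolding bounded_memory_def
    proof
      fix k
      have "\<bar>a i j\<bar> \<le> 2 ^ W" if "i < d" "j < d + m" for i j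
      proof -
        \<comment> \<open>The input is itself the tableau before any pivot, so the bound on tableaux
          applies to it.\<close>
        have "\<bar>a i j\<bar> \<le> bound"
          using tableau_le_bound(2)[OF partial_tableau_empty that] .
        then show ?thesis
          using bound_le_1 by simp
      qed
      moreover have "nat (k - 2) div (d + m) < d \<and> nat (k - 2) mod (d + m) < d + m"
        if "2 \<le> k" "k < 2 + int (d * (d + m))"
      proof -
        have "nat (k - 2) < d * (d + m)"
          using that by (simp add: nat_less_iff)
        then show ?thesis
          by (metis less_mult_imp_div_less mod_less_divisor mult_0_right not_gr_zero not_less_zero)
      qed
      ultimately show "\<bar>input_memory A k\<bar> \<le> 2 ^ W"
        using le_L_imp[OF rows_cols_le_L(2)] le_L_imp[OF rows_cols_le_L(3)]
        unfolding input_memory_def dims a_def by auto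
    qed
    ultimately obtain t s where ts: "runs (normality_prog m) (input_memory A) t s"
      "t \<le> prog_weight L (normality_prog m) * W" "s 0 = (if normal_columns then 1 else 0)"
      using normality_triple unfolding triple_def by blast
    have "prog_weight L (normality_prog m) \<le> C * L ^ e"
      using Ce rows_cols_le_L(4) by simp
    then have "t \<le> C * L ^ e * W"
      using ts(2) mult_le_mono1 order_trans by blast
    then have "t \<le> poly (poly p [:n:]) (bit_size A)"
      by (simp add: p L_def W_def)
    moreover have "normal_mat A \<longleftrightarrow> normal_columns"
      using A n by (intro normal_mat_iff_normal_columns) (auto simp: a_def)
    ultimately show "\<exists>t s. runs (normality_prog m) (input_memory A) t s \<and>
      s 0 = (if normal_mat A then 1 else 0) \<and> t \<le> poly (poly p [:n:]) (bit_size A)"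
      using ts(1,3) by (intro exI[of _ t] exI[of _ s]) simp
  qed
qed

end
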